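(* Suppose that the system $y(t+1)=f(y(t),u(t),\sigma(t))$ satisfies the weak $h$-approximation conditions for every vector function $h=(q_1,\dots,q_j)$, $j=1,2,\dots$. For each such $h$ let $V_h\subset\mathbb R^j$ be the convex and compact set (which exists under these conditions) such that $d_H(V_h(T,y_0),V_h)\le\nu_h'(T)$ for all $y_0\in Y$, for some $\nu'_h$ with $\lim_{T\to\infty}\nu'_h(T)=0$, and let $$\Gamma=\Big\{\gamma\in\mathcal P(Y\times\hat U)\ \Big|\ \int_{Y\times\hat U}h(y,u)\,\gamma(dy,du)\in V_h\ \text{ for every } h=(q_1,\dots,q_j),\ j=1,2,\dots\Big\}.$$ Then (i) $\Gamma=W$, and (ii) there is a function $\nu^*(T)$ with $\lim_{T\to\infty}\nu^*(T)=0$ such that $\rho_H(\Gamma_T(y_0),W)\le\nu^*(T)$ for every $y_0\in Y$.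
   Context: Setting. $Y\subset\mathbb R^m$ is compact, $\hat U$ and $S$ are compact metric spaces, $f:Y\times\hat U\times S\to\mathbb R^m$ is continuous, and $f(y,u,\sigma)\in Y$ for all $(y,u,\sigma)\in Y\times\hat U\times S$. $\sigma(0),\sigma(1),\dots$ are independent, identically distributed random elements of $S$ on a common probability space; $\sigma$ denotes a random element with their common law. The system is $y(t+1)=f(y(t),u(t),\sigma(t))$, $y(0)=y_0\in Y$, $t=0,1,2,\dots$. A control plan is a sequence $\pi=\{\pi_t\}_{t\ge0}$ with $\pi_0\in\hat U$ and $\pi_t:S^t\to\hat U$ Borel measurable for $t\ge1$; the controls are $u(0)=\pi_0$, $u(t)=\pi_t(\sigma(0),\dots,\sigma(t-1))$. $\Pi$ is the set of all control plans, and $(y^{\pi,y_0}(\cdot),u^{\pi,y_0}(\cdot))$ is the resulting state-control trajectory. Occupational measures. $\mathcal P(Y\times\hat U)$ is the set of Borel probability measures on $Y\times\hat U$. For a positive integer $T$, $\gamma^{\pi,y_0,T}(Q)=\frac1T E\big[\sum_{t=0}^{T-1}1_Q(y^{\pi,y_0}(t),u^{\pi,y_0}(t))\big]$ for Borel $Q\subset Y\times\hat U$, and $\Gamma_T(y_0)=\bigcup_{\pi\in\Pi}\{\gamma^{\pi,y_0,T}\}$. Stationary measures. $W=\big\{\gamma\in\mathcal P(Y\times\hat U):\int_{Y\times\hat U}\big(E[\varphi(f(y,u,\sigma))]-\varphi(y)\big)\gamma(dy,du)=0\ \ \forall\varphi\in C(Y)\big\}$. Metrics. $q_1,q_2,\dots$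 is a fixed sequence of Lipschitz continuous functions dense in the unit ball of $C(Y\times\hat U)$. $\rho(\gamma',\gamma'')=\sum_{j\ge1}2^{-j}\big|\int q_j\,d\gamma'-\int q_j\,d\gamma''\big|$; $\rho(\gamma,\Gamma)=\inf_{\gamma'\in\Gamma}\rho(\gamma,\gamma')$; $\rho_H(\Gamma_1,\Gamma_2)=\max\{\sup_{\gamma\in\Gamma_1}\rho(\gamma,\Gamma_2),\sup_{\gamma\in\Gamma_2}\rho(\gamma,\Gamma_1)\}$. $d_H$ is the analogous Hausdorff distance between bounded subsets of $\mathbb R^j$ with the Euclidean norm. For $h=(q_1,\dots,q_j):Y\times\hat U\to\mathbb R^j$ put $V_h(T,y_0)=\big\{\int h\,d\gamma:\gamma\in\Gamma_T(y_0)\big\}\subset\mathbb R^j$. Weak $h$-approximation conditions (for a given $h$): there is a monotone decreasing $\nu_h:[0,\infty)\to[0,\infty)$ with $\lim_{T\to\infty}\nu_h(T)=0$ such that for all $T$, all $y_0',y_0''\in Y$ and every control plan $\pi'$ there is a control plan $\pi''$ with $\Big\|E\big[\frac1T\sum_{t=0}^{T}h(y^{\pi',y_0'}(t),u^{\pi',y_0'}(t))\big]-E\big[\frac1T\sum_{t=0}^{T}h(y^{\pi'',y_0''}(t),u^{\pi'',y_0''}(t))\big]\Big\|\le\nu_h(T)$. *)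

theory Defs
  imports "HOL-Probability.Probability"
begin

section \<open>The controlled stochastic system\<close>

text \<open>
  The spaces are compact subsets \<open>Y\<close>, \<open>U\<close>, \<open>S\<close> of metric types. Since \<open>S\<close> is compact metric (hence
  second countable), the product sigma-algebra on \<open>S\<^sup>t\<close> used below is the Borel sigma-algebra.
  For \<open>t = 0\<close> the product has the single point \<open>\<lambda>_. undefined\<close>, so that the initial component of a
  plan is just an element of \<open>U\<close>.
\<close>

definition control_plans ::
    "'s::metric_space set \<Rightarrow> 'u::metric_space set \<Rightarrow> (nat \<Rightarrow> (nat \<Rightarrow> 's) \<Rightarrow> 'u) set" where
  "control_plans S U =
     {\<pi>. \<forall>t. \<pi> t \<in> (\<Pi>\<^sub>M i\<in>{..<t}. restrict_space borel S) \<rightarrow>\<^sub>M restrict_space borel U}"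

definition control ::
    "(nat \<Rightarrow> 'w \<Rightarrow> 's) \<Rightarrow> (nat \<Rightarrow> (nat \<Rightarrow> 's) \<Rightarrow> 'u) \<Rightarrow> nat \<Rightarrow> 'w \<Rightarrow> 'u" where
  "control \<sigma> \<pi> t \<omega> = \<pi> t (\<lambda>i\<in>{..<t}. \<sigma> i \<omega>)"

primrec state ::
    "('y \<times> 'u \<times> 's \<Rightarrow> 'y) \<Rightarrow> (nat \<Rightarrow> 'w \<Rightarrow> 's) \<Rightarrow> (nat \<Rightarrow> (nat \<Rightarrow> 's) \<Rightarrow> 'u) \<Rightarrow> 'y
      \<Rightarrow> nat \<Rightarrow> 'w \<Rightarrow> 'y" where
  "state f \<sigma> \<pi> y0 0 \<omega> = y0"
| "state f \<sigma> \<pi> y0 (Suc t) \<omega> = f (state f \<sigma> \<pi> y0 t \<omega>, control \<sigma> \<pi> t \<omega>, \<sigma> t \<omega>)"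

definition trajectory ::
    "('y \<times> 'u \<times> 's \<Rightarrow> 'y) \<Rightarrow> (nat \<Rightarrow> 'w \<Rightarrow> 's) \<Rightarrow> (nat \<Rightarrow> (nat \<Rightarrow> 's) \<Rightarrow> 'u) \<Rightarrow> 'y
      \<Rightarrow> nat \<Rightarrow> 'w \<Rightarrow> 'y \<times> 'u" where
  "trajectory f \<sigma> \<pi> y0 t \<omega> = (state f \<sigma> \<pi> y0 t \<omega>, control \<sigma> \<pi> t \<omega>)"

definition iid_random_elements ::
    "'w measure \<Rightarrow> 's::metric_space set \<Rightarrow> (nat \<Rightarrow> 'w \<Rightarrow> 's) \<Rightarrow> bool" where
  "iid_random_elements M S \<sigma> \<longleftrightarrow>
     prob_space M \<and>
     (\<forall>t. \<sigma> t \<in> M \<rightarrow>\<^sub>M restrict_space borel S) \<and>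
     prob_space.indep_vars M (\<lambda>_. restrict_space borel S) \<sigma> UNIV \<and>
     (\<forall>t. distr M (restrict_space borel S) (\<sigma> t) = distr M (restrict_space borel S) (\<sigma> 0))"


section \<open>Occupational and stationary measures\<close>

definition borel_prob_measures :: "'a::topological_space set \<Rightarrow> 'a measure set" where
  "borel_prob_measures X = {\<gamma>. prob_space \<gamma> \<and> sets \<gamma> = sets (restrict_space borel X)}"

definition occupational_measure ::
    "'y::metric_space set \<Rightarrow> 'u::metric_space set \<Rightarrow> ('y \<times> 'u \<times> 's \<Rightarrow> 'y) \<Rightarrow> 'w measure
      \<Rightarrow> (nat \<Rightarrow> 'w \<Rightarrow> 's) \<Rightarrow> (nat \<Rightarrow> (nat \<Rightarrow> 's) \<Rightarrow> 'u) \<Rightarrow> 'y \<Rightarrow> nat \<Rightarrow> ('y \<times> 'u) measure" where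
  "occupational_measure Y U f M \<sigma> \<pi> y0 T =
     measure_of (Y \<times> U) (sets (restrict_space borel (Y \<times> U)))
       (\<lambda>Q. ennreal (1 / real T *
          (LINT \<omega>|M. (\<Sum>t<T. indicator Q (trajectory f \<sigma> \<pi> y0 t \<omega>)))))"

definition occupational_set ::
    "'y::metric_space set \<Rightarrow> 'u::metric_space set \<Rightarrow> 's::metric_space set
      \<Rightarrow> ('y \<times> 'u \<times> 's \<Rightarrow> 'y) \<Rightarrow> 'w measure \<Rightarrow> (nat \<Rightarrow> 'w \<Rightarrow> 's) \<Rightarrow> nat \<Rightarrow> 'y
      \<Rightarrow> ('y \<times> 'u) measure set" where
  "occupational_set Y U S f M \<sigma> T y0 =
     (\<lambda>\<pi>. occupational_measure Y U f M \<sigma> \<pi> y0 T) ` control_plans S U"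

definition stationary_measures ::
    "'y::metric_space set \<Rightarrow> 'u::metric_space set \<Rightarrow> ('y \<times> 'u \<times> 's \<Rightarrow> 'y) \<Rightarrow> 'w measure
      \<Rightarrow> ('w \<Rightarrow> 's) \<Rightarrow> ('y \<times> 'u) measure set" where
  "stationary_measures Y U f M s =
     {\<gamma> \<in> borel_prob_measures (Y \<times> U).
        \<forall>\<phi> :: 'y \<Rightarrow> real. continuous_on Y \<phi> \<longrightarrow>
          (LINT (y, u)|\<gamma>. (LINT \<omega>|M. \<phi> (f (y, u, s \<omega>))) - \<phi> y) = 0}"


section \<open>Metrics\<close>

text \<open>
  Values are taken in \<open>ennreal\<close> so that the infimum over the empty set is infinite and the supremum
  over the empty set is zero.
\<close>

definition hausdorff_distance :: "('a \<Rightarrow> 'a \<Rightarrow> real) \<Rightarrow> 'a set \<Rightarrow> 'a set \<Rightarrow> ennreal" where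
  "hausdorff_distance d A B =
     max (SUP a\<in>A. INF b\<in>B. ennreal (d a b)) (SUP b\<in>B. INF a\<in>A. ennreal (d b a))"

text \<open>Sequences are indexed from \<open>0\<close>, so the function with index \<open>j\<close> has weight \<open>(1/2)^(j+1)\<close>.\<close>

definition dense_lipschitz_sequence ::
    "'a::metric_space set \<Rightarrow> (nat \<Rightarrow> 'a \<Rightarrow> real) \<Rightarrow> bool" where
  "dense_lipschitz_sequence X q \<longleftrightarrow>
     (\<forall>j. \<exists>L. L-lipschitz_on X (q j)) \<and>
     (\<forall>j. \<forall>x\<in>X. \<bar>q j x\<bar> \<le> 1) \<and>
     (\<forall>g :: 'a \<Rightarrow> real. continuous_on X g \<and> (\<forall>x\<in>X. \<bar>g x\<bar> \<le> 1) \<longrightarrow>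
        (\<forall>\<epsilon>>0. \<exists>j. \<forall>x\<in>X. \<bar>g x - q j x\<bar> < \<epsilon>))"

definition measure_dist :: "(nat \<Rightarrow> 'a \<Rightarrow> real) \<Rightarrow> 'a measure \<Rightarrow> 'a measure \<Rightarrow> real" where
  "measure_dist q \<gamma>1 \<gamma>2 =
     (\<Sum>j. (1/2) ^ Suc j * \<bar>(LINT z|\<gamma>1. q j z) - (LINT z|\<gamma>2. q j z)\<bar>)"

text \<open>
  Vectors in \<open>\<real>\<^sup>j\<close>, for varying \<open>j\<close>, are the points of \<^const>\<open>Euclidean_space\<close> \<open>j\<close>, that is, functions on
  the natural numbers vanishing from index \<open>j\<close> on. A vector function with \<open>j\<close> components is given by
  the components \<open>h i\<close> with \<open>i < j\<close>; the remaining ones are irrelevant.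
\<close>

definition eucl_dist :: "nat \<Rightarrow> (nat \<Rightarrow> real) \<Rightarrow> (nat \<Rightarrow> real) \<Rightarrow> real" where
  "eucl_dist j v w = L2_set (\<lambda>i. v i - w i) {..<j}"

definition convex_fun_set :: "(nat \<Rightarrow> real) set \<Rightarrow> bool" where
  "convex_fun_set V \<longleftrightarrow>
     (\<forall>v\<in>V. \<forall>w\<in>V. \<forall>a\<ge>0. \<forall>b\<ge>0. a + b = 1 \<longrightarrow> (\<lambda>i. a * v i + b * w i) \<in> V)"

definition integral_vector ::
    "nat \<Rightarrow> (nat \<Rightarrow> 'a \<Rightarrow> real) \<Rightarrow> 'a measure \<Rightarrow> (nat \<Rightarrow> real)" where
  "integral_vector j h \<gamma> = (\<lambda>i. if i < j then LINT z|\<gamma>. h i z else 0)"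

definition value_set ::
    "'y::metric_space set \<Rightarrow> 'u::metric_space set \<Rightarrow> 's::metric_space set
      \<Rightarrow> ('y \<times> 'u \<times> 's \<Rightarrow> 'y) \<Rightarrow> 'w measure \<Rightarrow> (nat \<Rightarrow> 'w \<Rightarrow> 's)
      \<Rightarrow> nat \<Rightarrow> (nat \<Rightarrow> 'y \<times> 'u \<Rightarrow> real) \<Rightarrow> nat \<Rightarrow> 'y \<Rightarrow> (nat \<Rightarrow> real) set" where
  "value_set Y U S f M \<sigma> j h T y0 = integral_vector j h ` occupational_set Y U S f M \<sigma> T y0"


section \<open>Weak approximation conditions and limit sets\<close>

definition average_vector ::
    "('y \<times> 'u \<times> 's \<Rightarrow> 'y) \<Rightarrow> 'w measure \<Rightarrow> (nat \<Rightarrow> 'w \<Rightarrow> 's) \<Rightarrow> nat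
      \<Rightarrow> (nat \<Rightarrow> 'y \<times> 'u \<Rightarrow> real) \<Rightarrow> (nat \<Rightarrow> (nat \<Rightarrow> 's) \<Rightarrow> 'u) \<Rightarrow> 'y \<Rightarrow> nat \<Rightarrow> (nat \<Rightarrow> real)" where
  "average_vector f M \<sigma> j h \<pi> y0 T =
     (\<lambda>i. if i < j
          then LINT \<omega>|M. 1 / real T * (\<Sum>t=0..T. h i (trajectory f \<sigma> \<pi> y0 t \<omega>))
          else 0)"

definition weak_approximation ::
    "'y::metric_space set \<Rightarrow> 'u::metric_space set \<Rightarrow> 's::metric_space set
      \<Rightarrow> ('y \<times> 'u \<times> 's \<Rightarrow> 'y) \<Rightarrow> 'w measure \<Rightarrow> (nat \<Rightarrow> 'w \<Rightarrow> 's)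
      \<Rightarrow> nat \<Rightarrow> (nat \<Rightarrow> 'y \<times> 'u \<Rightarrow> real) \<Rightarrow> bool" where
  "weak_approximation Y U S f M \<sigma> j h \<longleftrightarrow>
     (\<exists>\<nu> :: real \<Rightarrow> real.
        antimono_on {0..} \<nu> \<and> (\<forall>t\<ge>0. \<nu> t \<ge> 0) \<and> (\<nu> \<longlongrightarrow> 0) at_top \<and>
        (\<forall>T>0. \<forall>y1\<in>Y. \<forall>y2\<in>Y. \<forall>\<pi>1\<in>control_plans S U. \<exists>\<pi>2\<in>control_plans S U.
           eucl_dist j (average_vector f M \<sigma> j h \<pi>1 y1 T) (average_vector f M \<sigma> j h \<pi>2 y2 T)
             \<le> \<nu> (real T)))"

definition is_limit_value_set ::
    "'y::metric_space set \<Rightarrow> 'u::metric_space set \<Rightarrow> 's::metric_space set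
      \<Rightarrow> ('y \<times> 'u \<times> 's \<Rightarrow> 'y) \<Rightarrow> 'w measure \<Rightarrow> (nat \<Rightarrow> 'w \<Rightarrow> 's)
      \<Rightarrow> nat \<Rightarrow> (nat \<Rightarrow> 'y \<times> 'u \<Rightarrow> real) \<Rightarrow> (nat \<Rightarrow> real) set \<Rightarrow> bool" where
  "is_limit_value_set Y U S f M \<sigma> j h V \<longleftrightarrow>
     convex_fun_set V \<and> compactin (Euclidean_space j) V \<and>
     (\<exists>\<nu> :: nat \<Rightarrow> real. \<nu> \<longlonglongrightarrow> 0 \<and>
        (\<forall>T>0. \<forall>y0\<in>Y.
           hausdorff_distance (eucl_dist j) (value_set Y U S f M \<sigma> j h T y0) V \<le> ennreal (\<nu> T)))"

definition limit_measures ::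
    "'y::metric_space set \<Rightarrow> 'u::metric_space set \<Rightarrow> (nat \<Rightarrow> 'y \<times> 'u \<Rightarrow> real)
      \<Rightarrow> (nat \<Rightarrow> (nat \<Rightarrow> real) set) \<Rightarrow> ('y \<times> 'u) measure set" where
  "limit_measures Y U q V =
     {\<gamma> \<in> borel_prob_measures (Y \<times> U). \<forall>j\<ge>1. integral_vector j q \<gamma> \<in> V j}"

end

theory Submission
  imports Defs
begin

text \<open>
  Weak limits of occupational measures over growing horizons are stationary, because the defect of
  stationarity of \<open>\<gamma>\<^bsup>\<pi>,y,T\<^esup>\<close> telescopes and is \<open>O(1/T)\<close>; as the probability measures on a compact metric
  space are sequentially compact, occupational measures are uniformly close to \<open>W\<close>. Conversely, let
  \<open>\<gamma> \<in> W\<close>. Integrating the Bellman inequality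
  \<open>v\<^bsub>N+1\<^esub>(y) \<ge> c(y,u) + E v\<^bsub>N\<^esub>(f(y,u,\<sigma>))\<close> against \<open>\<gamma>\<close> gives \<open>\<integral> v\<^bsub>N\<^esub> d\<gamma> \<ge> N \<integral> c d\<gamma>\<close>, so in every
  direction of \<open>\<real>\<^sup>j\<close> some plan of length \<open>N\<close> does at least as well as \<open>\<gamma>\<close>. Blackwell's approachability
  argument turns this into a sequence of blocks whose averages converge to \<open>\<integral> h d\<gamma>\<close>, and the weak
  approximation conditions allow these blocks to be concatenated from any initial state. Hence the
  limit sets are \<open>V\<^sub>h = {\<integral> h d\<gamma> | \<gamma> \<in> W}\<close>, and they determine \<open>W\<close> because the \<open>q\<^sub>j\<close> are dense.
\<close>

section \<open>Compactness of spaces of probability measures\<close>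

text \<open>Two obstacles shape the argument. The metric types need not be second countable, so
  joint measurability of state and control and the selection of weak limits are derived from
  compactness of the sets alone, through a countable family of balls. Moreover, a plan that
  continues from a random state must depend measurably on that state. No measurable selection is
  made: a plan sees only the noise, so costs over a fixed horizon are equicontinuous in the initial
  state uniformly in the plan, and it suffices to choose one plan for each point of a finite net of
  \<open>Y\<close>. The state from which a block does as well as \<gamma> is found by averaging over
  \<gamma> and cannot be prescribed; the weak condition moves the block to the actual state. It is
  used at a single horizon \<open>N\<close>, chosen from the tolerance before the number of blocks.
  With \<open>k\<close> blocks the deviation of the chosen blocks is of order
  \<open>N * sqrt k\<close>, against a total length \<open>k * N\<close>. All constants depend only
  on \<open>N\<close>, the dimension and the tolerance, hence uniformity in \<gamma> and in the
  initial state.\<close>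

lemma compact_countable_base:
  fixes X :: "'a::metric_space set"
  assumes "compact X"
  obtains B :: "nat \<Rightarrow> 'a set" where "\<And>k. open (B k)"
    "\<And>x e. x \<in> X \<Longrightarrow> 0 < e \<Longrightarrow> \<exists>k. x \<in> B k \<and> B k \<subseteq> ball x e"
proof -
  have "\<forall>n::nat. \<exists>C. finite C \<and> X \<subseteq> (\<Union>c\<in>C. ball c (1 / Suc n))"
    using assms unfolding compact_eq_totally_bounded by auto
  then obtain C where C: "\<And>n::nat. finite (C n)" "\<And>n. X \<subseteq> (\<Union>c\<in>C n. ball c (1 / Suc n))"
    by metis
  define \<B> where "\<B> = insert {} (\<Union>n. (\<lambda>c. ball c (1 / real (Suc n))) ` C n)"
  have cnt: "countable \<B>"
    unfolding \<B>_def by (intro countable_insert countable_UN countable_image)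
      (auto intro: countable_finite C(1))
  have op: "open A" if "A \<in> \<B>" for A
    using that by (auto simp: \<B>_def)
  have "\<exists>A\<in>\<B>. x \<in> A \<and> A \<subseteq> ball x e" if "x \<in> X" "0 < e" for x e
  proof -
    obtain n where n: "1 / Suc n < e / 2"
      using \<open>0 < e\<close> nat_approx_posE[of "e / 2"] by (auto simp: inverse_eq_divide)
    obtain c where c: "c \<in> C n" "dist c x < 1 / Suc n"
      using C(2)[of n] \<open>x \<in> X\<close> by auto
    have "ball c (1 / Suc n) \<subseteq> ball x e"
    proof
      fix z assume "z \<in> ball c (1 / Suc n)"
      then have "dist x z < 1 / Suc n + 1 / Suc n"
        using dist_triangle3[of x z c] c(2) by simp
      then show "z \<in> ball x e"
        using n by simp
    qed
    moreover have "ball c (1 / Suc n) \<in> \<B>"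
      using c(1) by (auto simp: \<B>_def)
    ultimately show ?thesis
      using c(2) by (intro bexI[of _ "ball c (1 / Suc n)"]) auto
  qed
  then have "\<exists>k. x \<in> from_nat_into \<B> k \<and> from_nat_into \<B> k \<subseteq> ball x e" if "x \<in> X" "0 < e" for x e
    using that from_nat_into_surj[OF cnt] by metis
  moreover have "open (from_nat_into \<B> k)" for k
    by (rule op) (rule from_nat_into, auto simp: \<B>_def)
  ultimately show ?thesis
    using that by blast
qed

text \<open>Without second countability an open subset of the product need not be a countable union
  of open rectangles, and the product of the Borel sigma-algebras may be too small. Only points of
  \<open>X\<close> and \<open>Z\<close> occur as values, however, and for these the countable
  families obtained from compactness suffice.\<close>

lemma measurable_Pair_restrict_borel:
  fixes X :: "'a::metric_space set" and Z :: "'b::metric_space set"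
  assumes "compact X" "compact Z"
    and g: "g \<in> N \<rightarrow>\<^sub>M restrict_space borel X" and h: "h \<in> N \<rightarrow>\<^sub>M restrict_space borel Z"
  shows "(\<lambda>\<omega>. (g \<omega>, h \<omega>)) \<in> N \<rightarrow>\<^sub>M restrict_space borel (X \<times> Z)"
proof (rule measurable_restrict_space2)
  have gX: "g \<omega> \<in> X" and hZ: "h \<omega> \<in> Z" if "\<omega> \<in> space N" for \<omega>
    using measurable_space[OF g that] measurable_space[OF h that] by (auto simp: space_restrict_space)
  then show "(\<lambda>\<omega>. (g \<omega>, h \<omega>)) \<in> space N \<rightarrow> X \<times> Z"
    by auto
  have [measurable]: "g \<in> borel_measurable N" "h \<in> borel_measurable N"
    using g h by (simp_all add: measurable_restrict_space2_iff)
  obtain A :: "nat \<Rightarrow> 'a set" where A: "\<And>k. open (A k)"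
    "\<And>x e. x \<in> X \<Longrightarrow> 0 < e \<Longrightarrow> \<exists>k. x \<in> A k \<and> A k \<subseteq> ball x e"
    using compact_countable_base[OF \<open>compact X\<close>] by blast
  obtain B :: "nat \<Rightarrow> 'b set" where B: "\<And>k. open (B k)"
    "\<And>x e. x \<in> Z \<Longrightarrow> 0 < e \<Longrightarrow> \<exists>k. x \<in> B k \<and> B k \<subseteq> ball x e"
    using compact_countable_base[OF \<open>compact Z\<close>] by blast
  show "(\<lambda>\<omega>. (g \<omega>, h \<omega>)) \<in> borel_measurable N"
  proof (rule borel_measurableI)
    fix W :: "('a \<times> 'b) set" assume "open W"
    \<comment> \<open>These countably many rectangles inside \<open>W\<close> catch every value of
      the pair that lies in \<open>W\<close>, although they need not exhaust
      \<open>W\<close>.\<close>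
    define I where "I = {(k, l). A k \<times> B l \<subseteq> W}"
    have "(\<lambda>\<omega>. (g \<omega>, h \<omega>)) -` W \<inter> space N =
        (\<Union>(k, l)\<in>I. (g -` A k \<inter> space N) \<inter> (h -` B l \<inter> space N))"
    proof (intro equalityI subsetI)
      fix \<omega> assume \<omega>: "\<omega> \<in> (\<lambda>\<omega>. (g \<omega>, h \<omega>)) -` W \<inter> space N"
      then obtain P Q where PQ: "open P" "open Q" "g \<omega> \<in> P" "h \<omega> \<in> Q" "P \<times> Q \<subseteq> W"
        using open_prod_elim[OF \<open>open W\<close>, of "(g \<omega>, h \<omega>)"] by (metis IntD1 mem_Sigma_iff vimageD)
      obtain d e where "0 < d" "ball (g \<omega>) d \<subseteq> P" "0 < e" "ball (h \<omega>) e \<subseteq> Q"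
        using PQ by (meson open_contains_ball)
      moreover obtain k where "g \<omega> \<in> A k" "A k \<subseteq> ball (g \<omega>) d"
        using A(2)[OF gX \<open>0 < d\<close>] \<omega> by blast
      moreover obtain l where "h \<omega> \<in> B l" "B l \<subseteq> ball (h \<omega>) e"
        using B(2)[OF hZ \<open>0 < e\<close>] \<omega> by blast
      ultimately have "A k \<times> B l \<subseteq> P \<times> Q" "g \<omega> \<in> A k" "h \<omega> \<in> B l"
        by (blast intro: Sigma_mono)+
      then have "(k, l) \<in> I" "g \<omega> \<in> A k" "h \<omega> \<in> B l"
        using PQ(5) by (auto simp: I_def)
      then show "\<omega> \<in> (\<Union>(k, l)\<in>I. (g -` A k \<inter> space N) \<inter> (h -` B l \<inter> space N))"
        using \<omega> by blast
    qed (auto simp: I_def)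
    also have "\<dots> \<in> sets N"
    proof (intro sets.countable_UN'')
      fix kl :: "nat \<times> nat"
      show "(case kl of (k, l) \<Rightarrow> (g -` A k \<inter> space N) \<inter> (h -` B l \<inter> space N)) \<in> sets N"
        by (cases kl) (simp add: sets.Int measurable_sets[of _ N borel] A(1) B(1))
    qed auto
    finally show "(\<lambda>\<omega>. (g \<omega>, h \<omega>)) -` W \<inter> space N \<in> sets N" .
  qed
qed

text \<open>The first nonzero term has modulus \<open>(1/3)^k\<close>, and all later ones together
  have at most half of that. Base 3 leaves this gap; in base 2 the tail could cancel the leading
  term. The coefficients will be differences of the digits of two codes.\<close>

lemma ternary_digits:
  fixes a :: "nat \<Rightarrow> real"
  assumes a: "\<And>i. \<bar>a i\<bar> \<le> 1" and k: "\<bar>a k\<bar> = 1" and z: "\<And>i. i < k \<Longrightarrow> a i = 0"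
  shows "(1/3)^k / 2 \<le> \<bar>\<Sum>i. a i * (1/3)^i\<bar>"
proof -
  have g: "summable (\<lambda>i. (1/3::real)^i)"
    by (simp add: summable_geometric)
  have s: "summable (\<lambda>i. a i * (1/3)^i)"
    by (rule summable_comparison_test'[OF g, of 0])
      (simp add: abs_mult mult_left_le_one_le a)
  have s2: "summable (\<lambda>i. a (i + Suc k) * (1/3)^(i + Suc k))"
    using s by (subst summable_iff_shift)
  have g2: "summable (\<lambda>i. (1/3::real)^(i + Suc k))"
    using g by (subst summable_iff_shift)
  have "(\<Sum>i<Suc k. a i * (1/3)^i) = a k * (1/3)^k"
    by (simp add: z)
  then have split: "(\<Sum>i. a i * (1/3)^i) = a k * (1/3)^k + (\<Sum>i. a (i + Suc k) * (1/3)^(i + Suc k))"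
    using suminf_split_initial_segment[OF s, of "Suc k"] by linarith
  have le: "norm (a (i + Suc k) * (1/3)^(i + Suc k)) \<le> (1/3)^(i + Suc k)" for i
    unfolding norm_mult using mult_right_mono[OF a[of "i + Suc k"], of "norm ((1/3::real)^(i + Suc k))"]
    by simp
  have "\<bar>\<Sum>i. a (i + Suc k) * (1/3)^(i + Suc k)\<bar> \<le> (\<Sum>i. (1/3::real)^(i + Suc k))"
    using norm_suminf_le[OF le g2] by simp
  also have "\<dots> = (1/3)^k / 2"
  proof -
    have "(\<lambda>i. (1/3::real)^i * (1/3)^Suc k) sums (1 / (1 - 1/3) * (1/3)^Suc k)"
      by (intro sums_mult2 geometric_sums) simp
    then show ?thesis
      by (simp add: power_add sums_iff mult.assoc)
  qed
  finally have "\<bar>\<Sum>i. a (i + Suc k) * (1/3)^(i + Suc k)\<bar> \<le> (1/3)^k / 2" .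
  moreover have "\<bar>a k * (1/3)^k\<bar> = (1/3)^k"
    using k by (simp add: abs_mult)
  ultimately show ?thesis
    unfolding split by linarith
qed

text \<open>
  A countable base codes the points of \<open>X\<close> by reals, with ternary digits \<open>0\<close> and \<open>1\<close> only. Nearby codes
  share an initial segment of digits, hence a small basic set: decoding is uniformly continuous, so
  that Helly's selection theorem on the real line can be transferred to \<open>X\<close>.
\<close>

lemma separating_coding:
  fixes X :: "'a::metric_space set"
  assumes "compact X"
  obtains s :: "'a \<Rightarrow> real" where "s \<in> borel_measurable borel"
    "\<And>x. 0 \<le> s x" "\<And>x. s x \<le> 3/2"
    "\<And>e. 0 < e \<Longrightarrow> \<exists>\<delta>>0. \<forall>x\<in>X. \<forall>x'\<in>X. \<bar>s x - s x'\<bar> < \<delta> \<longrightarrow> dist x x' < e"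
proof -
  obtain B :: "nat \<Rightarrow> 'a set" where B: "\<And>k. open (B k)"
    "\<And>x e. x \<in> X \<Longrightarrow> 0 < e \<Longrightarrow> \<exists>k. x \<in> B k \<and> B k \<subseteq> ball x e"
    using compact_countable_base[OF \<open>compact X\<close>] by blast
  define d :: "nat \<Rightarrow> 'a \<Rightarrow> real" where "d k x = indicator (B k) x" for k x
  define s where "s x = (\<Sum>k. d k x * (1/3)^k)" for x
  have d01: "0 \<le> d k x" "d k x \<le> 1" for k x
    by (auto simp: d_def indicator_def)
  have g: "summable (\<lambda>k. (1/3::real)^k)"
    by (simp add: summable_geometric)
  have le: "d k x * (1/3)^k \<le> (1/3)^k" for k x
    using mult_right_mono[OF d01(2)[of k x], of "(1/3)^k"] by simp
  have sm: "summable (\<lambda>k. d k x * (1/3)^k)" for x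
    by (rule summable_comparison_test'[OF g, of 0]) (use le d01 in \<open>simp add: abs_mult\<close>)
  show ?thesis
  proof
    have [measurable]: "B k \<in> sets borel" for k
      using B(1) by simp
    show "s \<in> borel_measurable borel"
      unfolding s_def d_def by measurable
    show "0 \<le> s x" for x
      unfolding s_def using d01 by (intro suminf_nonneg sm) simp
    have "s x \<le> (\<Sum>k. (1/3::real)^k)" for x
      unfolding s_def by (intro suminf_le le sm g)
    then show "s x \<le> 3/2" for x
      by (simp add: suminf_geometric)
    fix e :: real assume "0 < e"
    \<comment> \<open>Finitely many of these small basic sets cover \<open>X\<close>, and
      \<open>N\<close> bounds their indices. Agreement of the digits up to \<open>N\<close> then
      puts both points into one common small set, which explains the radius
      \<open>(1/3)^N / 2\<close>.\<close>
    define K where "K = {k. \<exists>c. B k \<subseteq> ball c (e/2)}"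
    have cover: "X \<subseteq> (\<Union>k\<in>K. B k)"
      using B(2)[of _ "e/2"] \<open>0 < e\<close> by (fastforce simp: K_def)
    obtain F where F: "F \<subseteq> K" "finite F" "X \<subseteq> (\<Union>k\<in>F. B k)"
      by (rule compactE_image[OF \<open>compact X\<close> B(1) cover])
    obtain N where N: "\<And>k. k \<in> F \<Longrightarrow> k \<le> N"
      using F(2) unfolding finite_nat_set_iff_bounded_le by blast
    have "dist x x' < e" if x: "x \<in> X" "x' \<in> X" and lt: "\<bar>s x - s x'\<bar> < (1/3)^N / 2" for x x'
    proof -
      have same: "d k x = d k x'" if "k \<le> N" for k
      proof (rule ccontr)
        assume "d k x \<noteq> d k x'"
        define k0 where "k0 = (LEAST k. d k x \<noteq> d k x')"
        have k0: "d k0 x \<noteq> d k0 x'" "k0 \<le> k"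
          unfolding k0_def using LeastI[of "\<lambda>k. d k x \<noteq> d k x'" k] \<open>d k x \<noteq> d k x'\<close>
          by (simp_all add: Least_le)
        have "(1/3)^k0 / 2 \<le> \<bar>\<Sum>i. (d i x - d i x') * (1/3)^i\<bar>"
        proof (rule ternary_digits)
          show "\<bar>d i x - d i x'\<bar> \<le> 1" for i
            by (auto simp: d_def indicator_def)
          show "\<bar>d k0 x - d k0 x'\<bar> = 1"
            using k0(1) by (auto simp: d_def indicator_def split: if_splits)
          show "d i x - d i x' = 0" if "i < k0" for i
            using not_less_Least[of i "\<lambda>k. d k x \<noteq> d k x'"] that by (simp add: k0_def)
        qed
        also have "(\<Sum>i. (d i x - d i x') * (1/3)^i) = s x - s x'"
          unfolding s_def by (simp add: suminf_diff[OF sm sm] left_diff_distrib)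
        finally have "(1/3)^k0 / 2 \<le> \<bar>s x - s x'\<bar>" .
        moreover have "(1/3::real)^N \<le> (1/3)^k0"
          using k0(2) \<open>k \<le> N\<close> by (intro power_decreasing) auto
        ultimately show False
          using lt by simp
      qed
      obtain k where k: "k \<in> F" "x \<in> B k"
        using F(3) x by auto
      then have "x' \<in> B k"
        using same[OF N[OF k(1)]] by (simp add: d_def indicator_def split: if_splits)
      moreover obtain c where "B k \<subseteq> ball c (e/2)"
        using F(1) k(1) by (auto simp: K_def)
      ultimately have "dist c x < e/2" "dist c x' < e/2"
        using k(2) by auto
      then show ?thesis
        using dist_triangle3[of x x' c] by simp
    qed
    then show "\<exists>\<delta>>0. \<forall>x\<in>X. \<forall>x'\<in>X. \<bar>s x - s x'\<bar> < \<delta> \<longrightarrow> dist x x' < e"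
      by (intro exI[of _ "(1/3)^N / 2"]) auto
  qed
qed

lemma continuous_on_borel_measurable_restrict:
  fixes \<phi> :: "'a::topological_space \<Rightarrow> real"
  assumes "continuous_on X \<phi>" "sets \<gamma> = sets (restrict_space borel X)"
  shows "\<phi> \<in> borel_measurable \<gamma>"
  using borel_measurable_continuous_on_restrict[OF assms(1)] measurable_cong_sets[OF assms(2) refl]
  by blast

text \<open>The codes are bounded, so the image measures on the real line are tight and have a
  weakly convergent subsequence with limit \<open>\<mu>'\<close>. The code \<open>s\<close> is built
  from indicators and need not be continuous; what carries the convergence back is the continuous
  decoding \<open>G\<close>. It has to be defined on the closure of the set of codes, since
  \<open>\<mu>'\<close> may charge limits of codes that are not codes themselves.\<close>

theorem borel_prob_measures_seq_compact:
  fixes X :: "'a::metric_space set"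
  assumes "compact X" and \<gamma>: "\<And>n. \<gamma> n \<in> borel_prob_measures X"
  obtains r :: "nat \<Rightarrow> nat" and \<gamma>' where "strict_mono r" "\<gamma>' \<in> borel_prob_measures X"
    "\<forall>\<phi> :: 'a \<Rightarrow> real. continuous_on X \<phi> \<longrightarrow>
       (\<lambda>n. LINT x|\<gamma> (r n). \<phi> x) \<longlonglongrightarrow> (LINT x|\<gamma>'. \<phi> x)"
proof -
  obtain s :: "'a \<Rightarrow> real" where s[measurable]: "s \<in> borel_measurable borel"
    and s0: "\<And>x. 0 \<le> s x" and s2: "\<And>x. s x \<le> 3/2"
    and sd: "\<And>e. 0 < e \<Longrightarrow> \<exists>\<delta>>0. \<forall>x\<in>X. \<forall>x'\<in>X. \<bar>s x - s x'\<bar> < \<delta> \<longrightarrow> dist x x' < e"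
    using separating_coding[OF \<open>compact X\<close>] by metis
  interpret \<gamma>: prob_space "\<gamma> n" for n
    using \<gamma> by (simp add: borel_prob_measures_def)
  have sets_\<gamma>: "sets (\<gamma> n) = sets (restrict_space borel X)" for n
    using \<gamma> by (simp add: borel_prob_measures_def)
  have space_\<gamma>: "space (\<gamma> n) = X" for n
    using sets_eq_imp_space_eq[OF sets_\<gamma>[of n]] by (simp add: space_restrict_space)
  have s\<gamma>[measurable]: "s \<in> borel_measurable (\<gamma> n)" for n
    using measurable_restrict_space1[OF s, of X] measurable_cong_sets[OF sets_\<gamma> refl] by blast
  define C where "C = closure (s ` X)"
  \<comment> \<open>The decoded value at \<open>r\<close> is the limit of a convergent subsequence
    of points whose codes tend to \<open>r\<close>; uniform continuity of the decoding then brings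
    all points with codes near \<open>r\<close> close to it.\<close>
  have "\<exists>l\<in>X. \<forall>e>0. \<exists>\<delta>>0. \<forall>x\<in>X. \<bar>s x - r\<bar> < \<delta> \<longrightarrow> dist x l < e" if "r \<in> C" for r
  proof -
    obtain y where y: "\<And>n. y n \<in> s ` X" "y \<longlonglongrightarrow> r"
      using \<open>r \<in> C\<close> unfolding C_def closure_sequential by blast
    define x where "x n = (SOME z. z \<in> X \<and> y n = s z)" for n
    have "\<exists>z. z \<in> X \<and> y n = s z" for n
      using y(1)[of n] by blast
    then have x: "x n \<in> X" "y n = s (x n)" for n
      unfolding x_def by (metis (mono_tags, lifting) someI_ex)+
    obtain l and k :: "nat \<Rightarrow> nat" where l: "l \<in> X" "strict_mono k" "(x \<circ> k) \<longlonglongrightarrow> l"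
      by (rule seq_compactE[OF compact_imp_seq_compact[OF \<open>compact X\<close>], of x]) (use x(1) in auto)
    have "\<exists>\<delta>>0. \<forall>x\<in>X. \<bar>s x - r\<bar> < \<delta> \<longrightarrow> dist x l < e" if "0 < e" for e
    proof -
      obtain \<delta> where \<delta>: "0 < \<delta>" "\<forall>x\<in>X. \<forall>x'\<in>X. \<bar>s x - s x'\<bar> < \<delta> \<longrightarrow> dist x x' < e/2"
        using sd[of "e/2"] \<open>0 < e\<close> by auto
      have "(\<lambda>n. y (k n)) \<longlonglongrightarrow> r"
        using LIMSEQ_subseq_LIMSEQ[OF y(2) l(2)] by (simp add: o_def)
      then have "eventually (\<lambda>n. dist (y (k n)) r < \<delta>/2) sequentially"
        by (rule tendstoD) (use \<delta> in simp)
      moreover have "eventually (\<lambda>n. dist (x (k n)) l < e/2) sequentially"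
        using tendstoD[OF l(3), of "e/2"] \<open>0 < e\<close> by (simp add: o_def)
      ultimately have "eventually (\<lambda>n. dist (y (k n)) r < \<delta>/2 \<and> dist (x (k n)) l < e/2) sequentially"
        by (rule eventually_conj)
      then obtain n where n: "dist (y (k n)) r < \<delta>/2" "dist (x (k n)) l < e/2"
        using eventually_happens by force
      have "dist z l < e" if "z \<in> X" "\<bar>s z - r\<bar> < \<delta>/2" for z
      proof -
        have "\<bar>s z - s (x (k n))\<bar> < \<delta>"
          using that(2) n(1) unfolding x(2)[of "k n"] dist_real_def by linarith
        then have "dist z (x (k n)) < e/2"
          using \<delta>(2) that(1) x(1) by blast
        then show ?thesis
          using n(2) dist_triangle[of z l "x (k n)"] by linarith
      qed
      then show ?thesis
        using \<delta>(1) by (intro exI[of _ "\<delta>/2"]) auto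
    qed
    then show ?thesis
      using l(1) by blast
  qed
  then obtain G where GX: "\<And>r. r \<in> C \<Longrightarrow> G r \<in> X"
    and G: "\<And>r e. r \<in> C \<Longrightarrow> 0 < e \<Longrightarrow> \<exists>\<delta>>0. \<forall>x\<in>X. \<bar>s x - r\<bar> < \<delta> \<longrightarrow> dist x (G r) < e"
    by metis
  have sC: "s x \<in> C" if "x \<in> X" for x
    using that closure_subset[of "s ` X"] by (auto simp: C_def)
  have Gs: "G (s x) = x" if "x \<in> X" for x
  proof (rule ccontr)
    assume "G (s x) \<noteq> x"
    then have "0 < dist x (G (s x))"
      by (simp add: eq_commute)
    from G[OF sC[OF that] this] show False
      using that by force
  qed
  have contG: "continuous_on C G"
    unfolding continuous_on_iff
  proof (intro ballI allI impI)
    fix r e :: real assume "r \<in> C" "0 < e"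
    obtain \<delta> where \<delta>: "0 < \<delta>" "\<forall>x\<in>X. \<bar>s x - r\<bar> < \<delta> \<longrightarrow> dist x (G r) < e/2"
      using G[OF \<open>r \<in> C\<close>, of "e/2"] \<open>0 < e\<close> by auto
    have "dist (G r') (G r) < e" if "r' \<in> C" "dist r' r < \<delta>/2" for r'
    proof -
      obtain \<delta>' where \<delta>': "0 < \<delta>'" "\<forall>x\<in>X. \<bar>s x - r'\<bar> < \<delta>' \<longrightarrow> dist x (G r') < e/2"
        using G[OF \<open>r' \<in> C\<close>, of "e/2"] \<open>0 < e\<close> by auto
      have pos: "0 < min (\<delta>/2) \<delta>'"
        using \<delta>(1) \<delta>'(1) by simp
      obtain z where z: "z \<in> s ` X" "dist z r' < min (\<delta>/2) \<delta>'"
        using \<open>r' \<in> C\<close> pos unfolding C_def closure_approachable by blast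
      then obtain x where x: "x \<in> X" "z = s x"
        by auto
      have "dist x (G r') < e/2" "dist x (G r) < e/2"
      proof -
        have "\<bar>s x - r'\<bar> < \<delta>'" "\<bar>s x - r\<bar> < \<delta>"
          using z(2) that(2) unfolding x(2) dist_real_def by linarith+
        then show "dist x (G r') < e/2" "dist x (G r) < e/2"
          using \<delta>(2) \<delta>'(2) x(1) by blast+
      qed
      then show ?thesis
        using dist_triangle3[of "G r'" "G r" x] by simp
    qed
    then show "\<exists>d>0. \<forall>x'\<in>C. dist x' r < d \<longrightarrow> dist (G x') (G r) < e"
      using \<delta>(1) by (intro exI[of _ "\<delta>/2"]) auto
  qed
  define \<mu> where "\<mu> n = distr (\<gamma> n) borel s" for n
  have rd: "real_distribution (\<mu> n)" for n
    unfolding \<mu>_def by (rule \<gamma>.real_distribution_distr) simp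
  have "tight \<mu>"
    unfolding tight_def
  proof (intro conjI allI impI rd)
    fix \<epsilon> :: real assume "0 < \<epsilon>"
    have pre: "s -` {-1<..2} \<inter> space (\<gamma> n) = space (\<gamma> n)" for n
      using s0 s2 by (fastforce intro: order_trans[OF s2] less_le_trans[OF _ s0])
    have "measure (\<mu> n) {-1<..2} = 1" for n
      unfolding \<mu>_def by (subst measure_distr) (simp_all add: \<gamma>.prob_space pre)
    then show "\<exists>a b::real. a < b \<and> (\<forall>n. 1 - \<epsilon> < measure (\<mu> n) {a<..b})"
      using \<open>0 < \<epsilon>\<close> by (intro exI[of _ "-1"] exI[of _ 2]) simp
  qed
  then obtain r \<mu>' where r: "strict_mono (r :: nat \<Rightarrow> nat)" and \<mu>': "real_distribution \<mu>'"
    and "weak_conv_m (\<mu> \<circ> id \<circ> r) \<mu>'"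
    using tight_imp_convergent_subsubsequence[OF _ strict_mono_id] by blast
  then have wc: "weak_conv_m (\<lambda>n. \<mu> (r n)) \<mu>'"
    by (simp add: o_def)
  interpret \<mu>': real_distribution \<mu>'
    by (rule \<mu>')
  have conv: "(\<lambda>n. LINT x|\<gamma> (r n). \<psi> (s x)) \<longlonglongrightarrow> (LINT x|\<mu>'. \<psi> x)"
    if \<psi>: "continuous_on UNIV \<psi>" "\<And>x. \<bar>\<psi> x\<bar> \<le> B" for \<psi> :: "real \<Rightarrow> real" and B
  proof -
    have [measurable]: "\<psi> \<in> borel_measurable borel"
      using \<psi>(1) by (rule borel_measurable_continuous_onI)
    have "(\<lambda>n. integral\<^sup>L (\<mu> (r n)) \<psi>) \<longlonglongrightarrow> integral\<^sup>L \<mu>' \<psi>"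
      by (rule weak_conv_imp_integral_bdd_continuous_conv[OF rd \<mu>' wc])
        (use \<psi> in \<open>auto simp: continuous_on_eq_continuous_at\<close>)
    moreover have "integral\<^sup>L (\<mu> n) \<psi> = (LINT x|\<gamma> n. \<psi> (s x))" for n
      unfolding \<mu>_def by (rule integral_distr) simp_all
    ultimately show ?thesis
      by simp
  qed
  obtain x0 where x0: "x0 \<in> X"
    using \<gamma>.not_empty[of 0] by (auto simp: space_\<gamma>)
  then have C: "C \<noteq> {}" "closed C"
    using sC by (auto simp: C_def)
  have inC: "AE x in \<mu>'. x \<in> C"
  proof -
    \<comment> \<open>A bounded continuous function that vanishes exactly on the closed set
      \<open>C\<close>. It integrates to 0 before the limit, hence also in the limit, which confines
      \<open>\<mu>'\<close> to \<open>C\<close>.\<close>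
    define \<psi> where "\<psi> x = min 1 (infdist x C)" for x :: real
    have \<psi>: "continuous_on UNIV \<psi>" "\<And>x. \<bar>\<psi> x\<bar> \<le> 1" "\<And>x. 0 \<le> \<psi> x"
      unfolding \<psi>_def by (auto intro!: continuous_intros simp: infdist_nonneg)
    have [measurable]: "\<psi> \<in> borel_measurable borel"
      using \<psi>(1) by (rule borel_measurable_continuous_onI)
    have "(LINT x|\<gamma> n. \<psi> (s x)) = (LINT x|\<gamma> n. 0)" for n
      by (rule Bochner_Integration.integral_cong) (auto simp: \<psi>_def space_\<gamma> sC)
    then have "(LINT x|\<mu>'. \<psi> x) = 0"
      using conv[OF \<psi>(1,2)] by (simp add: LIMSEQ_const_iff)
    moreover have "integrable \<mu>' \<psi>"
      by (rule \<mu>'.integrable_const_bound[where B=1]) (use \<psi> in auto)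
    ultimately have "AE x in \<mu>'. \<psi> x = 0"
      using integral_nonneg_eq_0_iff_AE[of \<mu>' \<psi>] \<psi>(3) by auto
    then show ?thesis
      by eventually_elim (use C in \<open>auto simp: \<psi>_def in_closed_iff_infdist_zero min_def split: if_splits\<close>)
  qed
  \<comment> \<open>Off \<open>C\<close> the value is the arbitrary point \<open>x0\<close> of
    \<open>X\<close>, on a null set of \<open>\<mu>'\<close>.\<close>
  define H where "H x = (if x \<in> C then G x else x0)" for x
  have H: "H \<in> \<mu>' \<rightarrow>\<^sub>M restrict_space borel X"
  proof (rule measurable_restrict_space2)
    show "H \<in> space \<mu>' \<rightarrow> X"
      using GX x0 by (auto simp: H_def)
    have "H \<in> borel_measurable borel"
      unfolding H_def using C(2) contG
      by (intro borel_measurable_continuous_on_if) auto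
    then show "H \<in> borel_measurable \<mu>'"
      by (simp add: measurable_cong_sets[OF \<mu>'.events_eq_borel refl])
  qed
  define \<gamma>' where "\<gamma>' = distr \<mu>' (restrict_space borel X) H"
  have "\<gamma>' \<in> borel_prob_measures X"
    unfolding borel_prob_measures_def \<gamma>'_def by (simp add: \<mu>'.prob_space_distr[OF H])
  moreover have "(\<lambda>n. LINT x|\<gamma> (r n). \<phi> x) \<longlonglongrightarrow> (LINT x|\<gamma>'. \<phi> x)"
    if \<phi>: "continuous_on X \<phi>" for \<phi> :: "'a \<Rightarrow> real"
  proof -
    have "bounded (\<phi> ` X)"
      using \<phi> \<open>compact X\<close> compact_continuous_image compact_imp_bounded by blast
    then obtain B where B: "0 < B" "\<And>x. x \<in> X \<Longrightarrow> norm (\<phi> x) \<le> B"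
      unfolding bounded_pos by auto
    have c: "continuous_on C (\<phi> \<circ> G)"
      by (rule continuous_on_compose[OF contG continuous_on_subset[OF \<phi>]]) (use GX in auto)
    \<comment> \<open>Weak convergence tests continuous functions on the whole line, whereas
      \<open>\<phi> \<circ> G\<close> is continuous on \<open>C\<close> only. Tietze extends it with
      the same bound, and at the code of a point the extension returns the value of
      \<open>\<phi>\<close> at that point.\<close>
    obtain \<psi> where \<psi>: "continuous_on UNIV \<psi>" "\<And>x. x \<in> C \<Longrightarrow> \<psi> x = (\<phi> \<circ> G) x"
      "\<And>x. norm (\<psi> x) \<le> B"
      using Tietze[OF c, of UNIV B] C(2) B GX by auto
    have "(LINT x|\<gamma> n. \<psi> (s x)) = (LINT x|\<gamma> n. \<phi> x)" for n
      by (rule Bochner_Integration.integral_cong) (auto simp: space_\<gamma> \<psi>(2) sC Gs)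
    moreover have "(LINT x|\<gamma>'. \<phi> x) = (LINT x|\<mu>'. \<psi> x)"
    proof -
      have "(LINT x|\<gamma>'. \<phi> x) = (LINT x|\<mu>'. \<phi> (H x))"
        unfolding \<gamma>'_def by (rule integral_distr[OF H borel_measurable_continuous_on_restrict[OF \<phi>]])
      also have "\<dots> = (LINT x|\<mu>'. \<psi> x)"
      proof (rule integral_cong_AE)
        show "(\<lambda>x. \<phi> (H x)) \<in> borel_measurable \<mu>'"
          by (rule measurable_compose[OF H borel_measurable_continuous_on_restrict[OF \<phi>]])
        show "\<psi> \<in> borel_measurable \<mu>'"
          using borel_measurable_continuous_onI[OF \<psi>(1)]
          by (simp add: measurable_cong_sets[OF \<mu>'.events_eq_borel refl])
        show "AE x in \<mu>'. \<phi> (H x) = \<psi> x"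
          using inC by eventually_elim (simp add: H_def \<psi>(2))
      qed
      finally show ?thesis .
    qed
    ultimately show ?thesis
      using conv[OF \<psi>(1), of B] \<psi>(3) by simp
  qed
  ultimately show ?thesis
    using that r by blast
qed

section \<open>Hausdorff distances and mixtures\<close>

lemma hausdorff_distance_le:
  assumes "\<And>a. a \<in> A \<Longrightarrow> \<exists>b\<in>B. d a b \<le> e" "\<And>b. b \<in> B \<Longrightarrow> \<exists>a\<in>A. d b a \<le> e"
  shows "hausdorff_distance d A B \<le> ennreal e"
  unfolding hausdorff_distance_def
proof (intro max.boundedI SUP_least)
  fix a assume "a \<in> A"
  then obtain b where "b \<in> B" "d a b \<le> e"
    using assms(1) by blast
  then show "(INF b\<in>B. ennreal (d a b)) \<le> ennreal e"
    by (intro INF_lower2[of b] ennreal_leI)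
next
  fix b assume "b \<in> B"
  then obtain a where "a \<in> A" "d b a \<le> e"
    using assms(2) by blast
  then show "(INF a\<in>A. ennreal (d b a)) \<le> ennreal e"
    by (intro INF_lower2[of a] ennreal_leI)
qed

text \<open>Infima need not be attained; the strict bound in the premise is what yields actual
  points.\<close>

lemma hausdorff_distance_lessD:
  assumes "hausdorff_distance d A B < ennreal e"
  shows "a \<in> A \<Longrightarrow> \<exists>b\<in>B. d a b < e" "b \<in> B \<Longrightarrow> \<exists>a\<in>A. d b a < e"
proof -
  have *: "x < e" if "ennreal x < ennreal e" for x
    using that by (meson ennreal_leI leD leI)
  show "\<exists>b\<in>B. d a b < e" if "a \<in> A"
  proof -
    have "(INF b\<in>B. ennreal (d a b)) \<le> hausdorff_distance d A B"
      unfolding hausdorff_distance_def using \<open>a \<in> A\<close> by (intro max.coboundedI1 SUP_upper)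
    then have "(INF b\<in>B. ennreal (d a b)) < ennreal e"
      using assms by (rule le_less_trans)
    then show ?thesis
      unfolding INF_less_iff using * by blast
  qed
  show "\<exists>a\<in>A. d b a < e" if "b \<in> B"
  proof -
    have "(INF a\<in>A. ennreal (d b a)) \<le> hausdorff_distance d A B"
      unfolding hausdorff_distance_def using \<open>b \<in> B\<close> by (intro max.coboundedI2 SUP_upper)
    then have "(INF a\<in>A. ennreal (d b a)) < ennreal e"
      using assms by (rule le_less_trans)
    then show ?thesis
      unfolding INF_less_iff using * by blast
  qed
qed

text \<open>The rate is the supremum over \<open>Y\<close>, and the bound \<open>B\<close> keeps it
  finite, so that its conversion to a real loses nothing. In the applications horizon 0 gives no
  probability measure, hence the restriction to \<open>0 < T\<close>.\<close>

lemma uniform_rate: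
  fixes H :: "nat \<Rightarrow> 'y \<Rightarrow> ennreal"
  assumes bnd: "\<And>T y. 0 < T \<Longrightarrow> y \<in> Y \<Longrightarrow> H T y \<le> ennreal B"
    and lim: "\<And>e. 0 < e \<Longrightarrow> \<exists>T0. \<forall>T\<ge>T0. \<forall>y\<in>Y. H T y \<le> ennreal e"
  shows "\<exists>\<nu>::nat \<Rightarrow> real. \<nu> \<longlonglongrightarrow> 0 \<and> (\<forall>T>0. \<forall>y\<in>Y. H T y \<le> ennreal (\<nu> T))"
proof -
  define \<nu> where "\<nu> T = enn2real (SUP y\<in>Y. H T y)" for T
  have "H T y \<le> ennreal (\<nu> T)" if "0 < T" "y \<in> Y" for T y
  proof -
    have "(SUP y\<in>Y. H T y) \<le> ennreal B"
      using bnd[OF \<open>0 < T\<close>] by (intro SUP_least)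
    then have "(SUP y\<in>Y. H T y) < top"
      by (simp add: le_less_trans)
    then have "ennreal (\<nu> T) = (SUP y\<in>Y. H T y)"
      unfolding \<nu>_def by simp
    then show ?thesis
      using \<open>y \<in> Y\<close> by (simp add: SUP_upper)
  qed
  moreover have "\<nu> \<longlonglongrightarrow> 0"
  proof (rule LIMSEQ_I)
    fix e :: real assume "0 < e"
    obtain T0 where T0: "\<forall>T\<ge>T0. \<forall>y\<in>Y. H T y \<le> ennreal (e/2)"
      using lim[of "e/2"] \<open>0 < e\<close> by auto
    have "norm (\<nu> T - 0) < e" if "T0 \<le> T" for T
    proof -
      have "(SUP y\<in>Y. H T y) \<le> ennreal (e/2)"
        using T0 that by (intro SUP_least) auto
      then have "\<nu> T \<le> e/2"
        unfolding \<nu>_def using \<open>0 < e\<close> by (intro enn2real_leI) auto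
      moreover have "0 \<le> \<nu> T"
        by (simp add: \<nu>_def)
      ultimately show ?thesis
        using \<open>0 < e\<close> by simp
    qed
    then show "\<exists>T0. \<forall>T\<ge>T0. norm (\<nu> T - 0) < e"
      by blast
  qed
  ultimately show ?thesis
    by blast
qed

lemma borel_prob_measures_iff_prob_algebra:
  "\<gamma> \<in> borel_prob_measures X \<longleftrightarrow> prob_space \<gamma> \<and> \<gamma> \<in> space (subprob_algebra (restrict_space borel X))"
  by (auto simp: borel_prob_measures_def space_subprob_algebra prob_space_imp_subprob_space)

lemma space_borel_prob_measures: "\<gamma> \<in> borel_prob_measures X \<Longrightarrow> space \<gamma> = X"
  using sets_eq_imp_space_eq[of \<gamma> "restrict_space borel X"]
  by (simp add: borel_prob_measures_def space_restrict_space)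

text \<open>Used with the uniform distribution on \<open>{..<T}\<close>, which yields occupational
  measures, and with a Bernoulli distribution, which yields convex combinations.\<close>

lemma mixture_of_borel_prob_measures:
  fixes p :: "'i pmf" and \<kappa> :: "'i \<Rightarrow> 'a::topological_space measure" and \<phi> :: "'a \<Rightarrow> real" and B :: real
  assumes \<kappa>: "\<And>i. \<kappa> i \<in> borel_prob_measures X"
  shows "measure_pmf p \<bind> \<kappa> \<in> borel_prob_measures X"
    and "A \<in> sets (restrict_space borel X) \<Longrightarrow>
      measure (measure_pmf p \<bind> \<kappa>) A = (LINT i|measure_pmf p. measure (\<kappa> i) A)"
    and "\<phi> \<in> borel_measurable (restrict_space borel X) \<Longrightarrow> (\<And>x. x \<in> X \<Longrightarrow> \<bar>\<phi> x\<bar> \<le> B) \<Longrightarrow>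
      (LINT x|(measure_pmf p \<bind> \<kappa>). \<phi> x) = (LINT i|measure_pmf p. LINT x|\<kappa> i. \<phi> x)"
proof -
  have m: "\<kappa> \<in> measure_pmf p \<rightarrow>\<^sub>M subprob_algebra (restrict_space borel X)"
    using \<kappa> by (simp add: borel_prob_measures_iff_prob_algebra)
  have pr: "prob_space (\<kappa> i)" for i
    using \<kappa> by (simp add: borel_prob_measures_def)
  have "prob_space (measure_pmf p \<bind> \<kappa>)"
    by (rule measure_pmf.prob_space_bind[OF _ m]) (use pr in simp)
  then show "measure_pmf p \<bind> \<kappa> \<in> borel_prob_measures X"
    using sets_bind[of "measure_pmf p" \<kappa> "restrict_space borel X"] \<kappa>
    by (simp add: borel_prob_measures_def)
  show "measure (measure_pmf p \<bind> \<kappa>) A = (LINT i|measure_pmf p. measure (\<kappa> i) A)"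
    if "A \<in> sets (restrict_space borel X)"
    by (rule measure_pmf.measure_bind[OF m that])
  show "(LINT x|(measure_pmf p \<bind> \<kappa>). \<phi> x) = (LINT i|measure_pmf p. LINT x|\<kappa> i. \<phi> x)"
    if "\<phi> \<in> borel_measurable (restrict_space borel X)" "\<And>x. x \<in> X \<Longrightarrow> \<bar>\<phi> x\<bar> \<le> B"
    by (rule integral_bind[OF that(1) _ m, of B 1])
      (use that(2) pr in \<open>auto simp: space_restrict_space prob_space.emeasure_space_1 measure_pmf.finite_measure_axioms\<close>)
qed

section \<open>Laws of trajectories\<close>

lemma continuous_on_compact_bounded:
  fixes c :: "'a::topological_space \<Rightarrow> real"
  assumes "compact X" "continuous_on X c"
  obtains B where "0 < B" "\<And>x. x \<in> X \<Longrightarrow> \<bar>c x\<bar> \<le> B"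
proof -
  have "bounded (c ` X)"
    using assms compact_continuous_image compact_imp_bounded by blast
  then show ?thesis
    using that unfolding bounded_pos by auto
qed

text \<open>The last two assumptions ensure that plans and trajectories exist; the degenerate case
  is split off in the final theorem.\<close>

locale controlled_system =
  fixes Y :: "'y::metric_space set" and U :: "'u::metric_space set" and S :: "'s::metric_space set"
    and f :: "'y \<times> 'u \<times> 's \<Rightarrow> 'y" and M :: "'w measure" and \<sigma> :: "nat \<Rightarrow> 'w \<Rightarrow> 's"
  assumes compact_Y: "compact Y" and compact_U: "compact U" and compact_S: "compact S"
    and cont_f: "continuous_on (Y \<times> U \<times> S) f"
    and f_in: "\<And>y u s. y \<in> Y \<Longrightarrow> u \<in> U \<Longrightarrow> s \<in> S \<Longrightarrow> f (y, u, s) \<in> Y"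
    and iid: "iid_random_elements M S \<sigma>"
    and Y_nonempty: "Y \<noteq> {}" and U_nonempty: "U \<noteq> {}"
begin

section \<open>Canonical path space of the noise\<close>

definition law where "law = distr M (restrict_space borel S) (\<sigma> 0)"

text \<open>A plan sees the noise only through the sequence of its values, so expectations over
  \<open>M\<close> can be computed under this product law. There a path can be cut at any time and
  its tail replaced by an independent copy.\<close>

definition seqlaw where "seqlaw = PiM (UNIV :: nat set) (\<lambda>_. law)"

abbreviation "plans \<equiv> control_plans S U"

abbreviation "traj \<equiv> trajectory f (\<lambda>i x. x i)"

abbreviation "path_state \<equiv> state f (\<lambda>i x. x i)"

sublocale M: prob_space M
  using iid by (simp add: iid_random_elements_def)

lemma \<sigma>_measurable: "\<sigma> t \<in> M \<rightarrow>\<^sub>M restrict_space borel S"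
  using iid by (simp add: iid_random_elements_def)

lemma sets_law [measurable_cong]: "sets law = sets (restrict_space borel S)"
  by (simp add: law_def)

lemma space_law: "space law = S"
  by (simp add: law_def space_restrict_space)

sublocale law: prob_space law
  unfolding law_def by (rule M.prob_space_distr[OF \<sigma>_measurable])

sublocale seq: sequence_space law
  by unfold_locales

sublocale seqlaw: prob_space seqlaw
  unfolding seqlaw_def by (rule prob_space_PiM) (rule law.prob_space_axioms)

sublocale seqpair: pair_prob_space seqlaw seqlaw
  by unfold_locales

lemma sets_seqlaw: "sets seqlaw = sets (PiM (UNIV :: nat set) (\<lambda>_. restrict_space borel S))"
  unfolding seqlaw_def by (rule sets_PiM_cong) (simp_all add: sets_law)

lemma space_seqlaw: "space seqlaw = {x. \<forall>i. x i \<in> S}"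
  unfolding seqlaw_def by (auto simp: space_PiM space_law PiE_def Pi_def)

lemma measurable_seqlaw_component: "(\<lambda>x. x i) \<in> seqlaw \<rightarrow>\<^sub>M law"
  unfolding seqlaw_def by (rule measurable_component_singleton) simp

text \<open>Independence says that the joint law is the product of the marginal laws, and these
  coincide.\<close>

lemma distr_noise: "distr M seqlaw (\<lambda>\<omega> i. \<sigma> i \<omega>) = seqlaw"
proof -
  have "distr M (PiM UNIV (\<lambda>_. restrict_space borel S)) (\<lambda>\<omega>. \<lambda>i\<in>UNIV. \<sigma> i \<omega>) =
      PiM UNIV (\<lambda>i. distr M (restrict_space borel S) (\<sigma> i))"
    using M.indep_vars_iff_distr_eq_PiM[where I="UNIV :: nat set" and M'="\<lambda>_. restrict_space borel S" and X=\<sigma>] iid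
    by (simp add: iid_random_elements_def)
  also have "(\<lambda>i. distr M (restrict_space borel S) (\<sigma> i)) = (\<lambda>_. law)"
    using iid by (auto simp: iid_random_elements_def law_def)
  also have "distr M (PiM UNIV (\<lambda>_. restrict_space borel S)) (\<lambda>\<omega>. \<lambda>i\<in>UNIV. \<sigma> i \<omega>) =
      distr M seqlaw (\<lambda>\<omega> i. \<sigma> i \<omega>)"
    by (rule distr_cong) (auto simp: sets_seqlaw restrict_def)
  finally show ?thesis
    by (simp add: seqlaw_def)
qed

lemma measurable_noise: "(\<lambda>\<omega> i. \<sigma> i \<omega>) \<in> M \<rightarrow>\<^sub>M seqlaw"
proof -
  have "(\<lambda>\<omega>. \<lambda>i\<in>UNIV. \<sigma> i \<omega>) \<in> M \<rightarrow>\<^sub>M PiM UNIV (\<lambda>_. restrict_space borel S)"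
    by (intro measurable_restrict \<sigma>_measurable)
  then show ?thesis
    by (simp add: measurable_cong_sets[OF refl sets_seqlaw] restrict_def)
qed

lemma integral_noise:
  fixes g :: "(nat \<Rightarrow> 's) \<Rightarrow> real"
  assumes "g \<in> borel_measurable seqlaw"
  shows "(LINT \<omega>|M. g (\<lambda>i. \<sigma> i \<omega>)) = (LINT x|seqlaw. g x)"
  using integral_distr[OF measurable_noise assms] by (simp add: distr_noise)

lemma integral_law:
  fixes g :: "'s \<Rightarrow> real"
  assumes "g \<in> borel_measurable law"
  shows "(LINT \<omega>|M. g (\<sigma> 0 \<omega>)) = (LINT s|law. g s)" "(LINT x|seqlaw. g (x i)) = (LINT s|law. g s)"
proof -
  have "g \<in> borel_measurable (restrict_space borel S)"
    using assms by (simp add: measurable_cong_sets[OF sets_law refl])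
  then show "(LINT \<omega>|M. g (\<sigma> 0 \<omega>)) = (LINT s|law. g s)"
    unfolding law_def using \<sigma>_measurable by (intro integral_distr[symmetric])
  have "distr seqlaw law (\<lambda>x. x i) = law"
    unfolding seqlaw_def by (rule seq.PiM_component) simp
  then show "(LINT x|seqlaw. g (x i)) = (LINT s|law. g s)"
    using integral_distr[OF measurable_seqlaw_component assms, of i] by simp
qed

text \<open>Independence of past and future enters in this form: \<open>comb_seq n x x'\<close>
  follows \<open>x\<close> before time \<open>n\<close> and then starts \<open>x'\<close> afresh,
  and it has the law of a single path. The inner integral is the conditional expectation given the
  noise before time \<open>n\<close>.\<close>

lemma
  fixes g :: "(nat \<Rightarrow> 's) \<Rightarrow> real"
  assumes g[measurable]: "g \<in> borel_measurable seqlaw" and B: "\<And>x. x \<in> space seqlaw \<Longrightarrow> \<bar>g x\<bar> \<le> B"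
  shows integral_comb_seq:
      "(LINT x|seqlaw. g x) = (LINT x|seqlaw. LINT x'|seqlaw. g (comb_seq n x x'))"
    and integrable_comb_seq: "integrable seqlaw (\<lambda>x. LINT x'|seqlaw. g (comb_seq n x x'))"
proof -
  have m: "(\<lambda>(x, x'). comb_seq n x x') \<in> seqlaw \<Otimes>\<^sub>M seqlaw \<rightarrow>\<^sub>M seqlaw"
    unfolding seqlaw_def by (rule measurable_comb_seq)
  have d: "distr (seqlaw \<Otimes>\<^sub>M seqlaw) seqlaw (\<lambda>(x, x'). comb_seq n x x') = seqlaw"
    unfolding seqlaw_def by (rule seq.PiM_comb_seq)
  have mg: "(\<lambda>z. g (case z of (x, x') \<Rightarrow> comb_seq n x x')) \<in> borel_measurable (seqlaw \<Otimes>\<^sub>M seqlaw)"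
    by (rule measurable_compose[OF m g])
  have i: "integrable (seqlaw \<Otimes>\<^sub>M seqlaw) (\<lambda>z. g (case z of (x, x') \<Rightarrow> comb_seq n x x'))"
    by (rule seqpair.P.integrable_const_bound[where B=B, OF _ mg])
      (use measurable_space[OF m] B in auto)
  have "(LINT x|seqlaw. g x) = (LINT z|(seqlaw \<Otimes>\<^sub>M seqlaw). g (case z of (x, x') \<Rightarrow> comb_seq n x x'))"
    using integral_distr[OF m g] by (simp add: d)
  then show "(LINT x|seqlaw. g x) = (LINT x|seqlaw. LINT x'|seqlaw. g (comb_seq n x x'))"
    using seqpair.integral_fst'[OF i] by simp
  show "integrable seqlaw (\<lambda>x. LINT x'|seqlaw. g (comb_seq n x x'))"
    using seqpair.integrable_fst'[OF i] by simp
qed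

section \<open>Measurability and integrability along trajectories\<close>

lemma trajectory_noise: "trajectory f \<sigma> \<pi> y t \<omega> = traj \<pi> y t (\<lambda>i. \<sigma> i \<omega>)"
proof -
  have "state f \<sigma> \<pi> y t \<omega> = path_state \<pi> y t (\<lambda>i. \<sigma> i \<omega>)"
    by (induction t) (simp_all add: control_def)
  then show ?thesis
    by (simp add: trajectory_def control_def)
qed

lemma control_measurable:
  assumes "\<pi> \<in> plans" "{..<t} \<subseteq> I"
  shows "control (\<lambda>i x. x i) \<pi> t \<in> PiM I (\<lambda>_. restrict_space borel S) \<rightarrow>\<^sub>M restrict_space borel U"
proof -
  have "\<pi> t \<in> PiM {..<t} (\<lambda>_. restrict_space borel S) \<rightarrow>\<^sub>M restrict_space borel U"
    using assms(1) by (simp add: control_plans_def)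
  then have "(\<lambda>x. \<pi> t (restrict x {..<t})) \<in> PiM I (\<lambda>_. restrict_space borel S) \<rightarrow>\<^sub>M restrict_space borel U"
    by (rule measurable_compose[OF measurable_restrict_subset[OF assms(2)]])
  then show ?thesis
    by (simp add: control_def[abs_def])
qed

lemma f_measurable: "f \<in> restrict_space borel (Y \<times> U \<times> S) \<rightarrow>\<^sub>M restrict_space borel Y"
  by (rule measurable_restrict_space2)
    (auto simp: space_restrict_space f_in intro: borel_measurable_continuous_on_restrict cont_f)

text \<open>The index set \<open>I\<close> is left open because states are read on full paths and,
  when plans are concatenated, also on the finite noise prefix that a control may use.\<close>

lemma state_measurable:
  assumes "\<pi> \<in> plans" "y \<in> Y" "{..<t} \<subseteq> I"
  shows "path_state \<pi> y t \<in> PiM I (\<lambda>_. restrict_space borel S) \<rightarrow>\<^sub>M restrict_space borel Y"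
  using assms(3)
proof (induction t)
  case 0
  then show ?case
    using assms(2) by (simp add: space_restrict_space)
next
  case (Suc t)
  then have I: "{..<t} \<subseteq> I" "t \<in> I"
    by auto
  have "(\<lambda>x. (control (\<lambda>i x. x i) \<pi> t x, x t)) \<in>
      PiM I (\<lambda>_. restrict_space borel S) \<rightarrow>\<^sub>M restrict_space borel (U \<times> S)"
    by (rule measurable_Pair_restrict_borel[OF compact_U compact_S control_measurable[OF assms(1) I(1)]
          measurable_component_singleton[OF I(2)]])
  then have "(\<lambda>x. (path_state \<pi> y t x, control (\<lambda>i x. x i) \<pi> t x, x t)) \<in>
      PiM I (\<lambda>_. restrict_space borel S) \<rightarrow>\<^sub>M restrict_space borel (Y \<times> U \<times> S)"
    by (rule measurable_Pair_restrict_borel[OF compact_Y compact_Times[OF compact_U compact_S] Suc.IH[OF I(1)]])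
  then show ?case
    unfolding state.simps[abs_def] by (rule measurable_compose[OF _ f_measurable])
qed

lemma traj_measurable:
  assumes "\<pi> \<in> plans" "y \<in> Y"
  shows "traj \<pi> y t \<in> seqlaw \<rightarrow>\<^sub>M restrict_space borel (Y \<times> U)"
  unfolding trajectory_def[abs_def] measurable_cong_sets[OF sets_seqlaw refl]
  by (rule measurable_Pair_restrict_borel[OF compact_Y compact_U
        state_measurable[OF assms subset_UNIV] control_measurable[OF assms(1) subset_UNIV]])

lemma path_state_measurable:
  assumes "\<pi> \<in> plans" "y \<in> Y"
  shows "path_state \<pi> y t \<in> seqlaw \<rightarrow>\<^sub>M restrict_space borel Y"
  unfolding measurable_cong_sets[OF sets_seqlaw refl]
  by (rule state_measurable[OF assms subset_UNIV])

lemma path_state_in: "\<pi> \<in> plans \<Longrightarrow> y \<in> Y \<Longrightarrow> x \<in> space seqlaw \<Longrightarrow> path_state \<pi> y t x \<in> Y"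
  using measurable_space[OF path_state_measurable] by (simp add: space_restrict_space)

lemma traj_in: "\<pi> \<in> plans \<Longrightarrow> y \<in> Y \<Longrightarrow> x \<in> space seqlaw \<Longrightarrow> traj \<pi> y t x \<in> Y \<times> U"
  using measurable_space[OF traj_measurable] by (simp add: space_restrict_space)

lemma control_in:
  "\<pi> \<in> plans \<Longrightarrow> x \<in> space seqlaw \<Longrightarrow> control (\<lambda>i x. x i) \<pi> t x \<in> U"
  using traj_in[of \<pi> _ x t] Y_nonempty by (auto simp: trajectory_def)

lemma compact_YU: "compact (Y \<times> U)"
  by (rule compact_Times[OF compact_Y compact_U])

lemma traj_borel:
  fixes c :: "'y \<times> 'u \<Rightarrow> real"
  assumes "\<pi> \<in> plans" "y \<in> Y" "continuous_on (Y \<times> U) c"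
  shows "(\<lambda>x. c (traj \<pi> y t x)) \<in> borel_measurable seqlaw"
  by (rule measurable_compose[OF traj_measurable[OF assms(1,2)] borel_measurable_continuous_on_restrict[OF assms(3)]])

lemma traj_integrable:
  fixes c :: "'y \<times> 'u \<Rightarrow> real"
  assumes "\<pi> \<in> plans" "y \<in> Y" "continuous_on (Y \<times> U) c"
  shows "integrable seqlaw (\<lambda>x. c (traj \<pi> y t x))"
proof -
  obtain B where "\<And>x. x \<in> Y \<times> U \<Longrightarrow> \<bar>c x\<bar> \<le> B"
    using continuous_on_compact_bounded[OF compact_YU assms(3)] by metis
  then show ?thesis
    by (intro seqlaw.integrable_const_bound[where B=B] traj_borel assms) (use traj_in assms in auto)
qed

lemma state_integrable:
  fixes \<phi> :: "'y \<Rightarrow> real"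
  assumes "\<pi> \<in> plans" "y \<in> Y" "continuous_on Y \<phi>"
  shows "integrable seqlaw (\<lambda>x. \<phi> (path_state \<pi> y t x))"
proof -
  obtain B where "\<And>x. x \<in> Y \<Longrightarrow> \<bar>\<phi> x\<bar> \<le> B"
    using continuous_on_compact_bounded[OF compact_Y assms(3)] by metis
  then show ?thesis
    by (intro seqlaw.integrable_const_bound[where B=B]
        measurable_compose[OF path_state_measurable[OF assms(1,2)] borel_measurable_continuous_on_restrict[OF assms(3)]])
      (use path_state_in assms in auto)
qed

section \<open>Occupational measures as time averages of laws\<close>

definition total_cost :: "('y \<times> 'u \<Rightarrow> real) \<Rightarrow> (nat \<Rightarrow> (nat \<Rightarrow> 's) \<Rightarrow> 'u) \<Rightarrow> 'y \<Rightarrow> nat \<Rightarrow> real" where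
  "total_cost c \<pi> y T = (LINT x|seqlaw. (\<Sum>t<T. c (traj \<pi> y t x)))"

text \<open>The mixture \<open>N\<close> is the law of state and control at a time drawn uniformly
  from \<open>{..<T}\<close>. The set function in the definition agrees with \<open>N\<close> on all
  measurable sets, so \<open>measure_of\<close> returns \<open>N\<close>. For \<open>T = 0\<close>
  the factor \<open>1 / real T\<close> is 0 and no probability measure results.\<close>

lemma
  assumes \<pi>: "\<pi> \<in> plans" and y: "y \<in> Y" and T: "0 < T"
  shows occupational_measure_in: "occupational_measure Y U f M \<sigma> \<pi> y T \<in> borel_prob_measures (Y \<times> U)"
    and integral_occupational_measure: "continuous_on (Y \<times> U) c \<Longrightarrow>
      (LINT z|occupational_measure Y U f M \<sigma> \<pi> y T. c z) = total_cost c \<pi> y T / real T"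
proof -
  let ?X = "Y \<times> U"
  define \<kappa> where "\<kappa> t = distr seqlaw (restrict_space borel ?X) (traj \<pi> y t)" for t
  define p where "p = pmf_of_set {..<T}"
  have ne: "{..<T} \<noteq> {}"
    using T by auto
  have \<kappa>: "\<kappa> t \<in> borel_prob_measures ?X" for t
    unfolding borel_prob_measures_def \<kappa>_def
    using seqlaw.prob_space_distr[OF traj_measurable[OF \<pi> y]] by simp
  note mix = mixture_of_borel_prob_measures[of \<kappa> ?X, OF \<kappa>]
  define N where "N = measure_pmf p \<bind> \<kappa>"
  have N: "N \<in> borel_prob_measures ?X"
    unfolding N_def by (rule mix)
  then interpret N: prob_space N
    by (simp add: borel_prob_measures_def)
  have sN: "sets N = sets (restrict_space borel ?X)" and spN: "space N = ?X"
    using N space_borel_prob_measures by (auto simp: borel_prob_measures_def)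
  have em: "ennreal (1 / real T * (LINT \<omega>|M. (\<Sum>t<T. indicator Q (trajectory f \<sigma> \<pi> y t \<omega>)))) = emeasure N Q"
    if Q: "Q \<in> sets (restrict_space borel ?X)" for Q
  proof -
    have ind: "(indicator Q :: _ \<Rightarrow> real) \<in> borel_measurable (restrict_space borel ?X)"
      using Q by (rule borel_measurable_indicator)
    have it: "(\<lambda>x. indicator Q (traj \<pi> y t x) :: real) \<in> borel_measurable seqlaw" for t
      by (rule measurable_compose[OF traj_measurable[OF \<pi> y] ind])
    have ii: "integrable seqlaw (\<lambda>x. indicator Q (traj \<pi> y t x) :: real)" for t
      by (rule seqlaw.integrable_const_bound[where B=1, OF _ it]) (auto simp: indicator_def)
    have "measure (\<kappa> t) Q = (LINT x|\<kappa> t. indicator Q x)" for t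
      using Q sets.sets_into_space[OF Q] by (simp add: \<kappa>_def space_restrict_space Int_absorb2)
    moreover have "(LINT x|\<kappa> t. indicator Q x :: real) = (LINT x|seqlaw. indicator Q (traj \<pi> y t x))" for t
      unfolding \<kappa>_def by (rule integral_distr[OF traj_measurable[OF \<pi> y] ind])
    ultimately have mk: "measure (\<kappa> t) Q = (LINT x|seqlaw. indicator Q (traj \<pi> y t x))" for t
      by metis
    have "(LINT \<omega>|M. (\<Sum>t<T. indicator Q (trajectory f \<sigma> \<pi> y t \<omega>) :: real)) =
        (LINT x|seqlaw. (\<Sum>t<T. indicator Q (traj \<pi> y t x)))"
      unfolding trajectory_noise
      by (rule integral_noise[of "\<lambda>x. \<Sum>t<T. indicator Q (traj \<pi> y t x)"]) (intro borel_measurable_sum it)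
    also have "\<dots> = (\<Sum>t<T. measure (\<kappa> t) Q)"
      unfolding mk by (rule Bochner_Integration.integral_sum) (rule ii)
    also have "\<dots> = real T * measure N Q"
      unfolding N_def mix(2)[OF Q] p_def integral_pmf_of_set[OF ne finite_lessThan] using T by simp
    finally show ?thesis
      using T by (simp add: N.emeasure_eq_measure)
  qed
  have "occupational_measure Y U f M \<sigma> \<pi> y T = measure_of (space N) (sets N) (emeasure N)"
    unfolding occupational_measure_def sN spN
  proof (rule measure_of_eq)
    show "sets (restrict_space borel ?X) \<subseteq> Pow ?X"
      using sets.space_closed[of N] by (simp add: sN spN)
    fix a assume "a \<in> sigma_sets ?X (sets (restrict_space borel ?X))"
    then have "a \<in> sets (restrict_space borel ?X)"
      using sets.sigma_sets_eq[of N] by (simp add: sN spN)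
    then show "ennreal (1 / real T * (LINT \<omega>|M. (\<Sum>t<T. indicator a (trajectory f \<sigma> \<pi> y t \<omega>)))) = emeasure N a"
      by (rule em)
  qed
  then have occ: "occupational_measure Y U f M \<sigma> \<pi> y T = N"
    by (simp add: measure_of_of_measure)
  then show "occupational_measure Y U f M \<sigma> \<pi> y T \<in> borel_prob_measures ?X"
    using N by simp
  assume c: "continuous_on ?X c"
  note mc = borel_measurable_continuous_on_restrict[OF c]
  obtain B where B: "\<And>x. x \<in> ?X \<Longrightarrow> \<bar>c x\<bar> \<le> B"
    using continuous_on_compact_bounded[OF compact_YU c] by metis
  have "(LINT z|N. c z) = (LINT t|measure_pmf p. LINT z|\<kappa> t. c z)"
    unfolding N_def by (rule mix(3)[OF mc B])
  also have "\<dots> = (\<Sum>t<T. LINT z|\<kappa> t. c z) / real T"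
    unfolding p_def integral_pmf_of_set[OF ne finite_lessThan] by simp
  also have "(\<Sum>t<T. LINT z|\<kappa> t. c z) = total_cost c \<pi> y T"
    unfolding total_cost_def \<kappa>_def integral_distr[OF traj_measurable[OF \<pi> y] mc]
    by (rule Bochner_Integration.integral_sum[symmetric]) (rule traj_integrable[OF \<pi> y c])
  finally show "(LINT z|occupational_measure Y U f M \<sigma> \<pi> y T. c z) = total_cost c \<pi> y T / real T"
    by (simp add: occ)
qed

end

context controlled_system
begin

section \<open>Transition operator, stationarity and equicontinuity\<close>

lemma f_uniformly_continuous:
  assumes "0 < e"
  obtains d where "0 < d"
    "\<And>y y' u s. y \<in> Y \<Longrightarrow> y' \<in> Y \<Longrightarrow> u \<in> U \<Longrightarrow> s \<in> S \<Longrightarrow> dist y y' < d \<Longrightarrow>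
      dist (f (y, u, s)) (f (y', u, s)) < e"
proof -
  have "uniformly_continuous_on (Y \<times> U \<times> S) f"
    by (rule compact_uniformly_continuous[OF cont_f])
      (rule compact_Times[OF compact_Y compact_Times[OF compact_U compact_S]])
  then obtain d where d: "0 < d" "\<forall>p\<in>Y \<times> U \<times> S. \<forall>p'\<in>Y \<times> U \<times> S. dist p' p < d \<longrightarrow> dist (f p') (f p) < e"
    using \<open>0 < e\<close> unfolding uniformly_continuous_on_def by metis
  have "dist (f (y, u, s)) (f (y', u, s)) < e"
    if "y \<in> Y" "y' \<in> Y" "u \<in> U" "s \<in> S" "dist y y' < d" for y y' u s
    using d(2)[rule_format, of "(y', u, s)" "(y, u, s)"] that by (simp add: dist_Pair_Pair)
  then show ?thesis
    using that d(1) by blast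
qed

text \<open>The one-step transition operator of the controlled chain. A measure \<gamma> is
  stationary when it annihilates \<open>noise_mean \<phi> z - \<phi> (fst z)\<close> for all
  continuous \<phi>.\<close>

definition noise_mean :: "('y \<Rightarrow> real) \<Rightarrow> 'y \<times> 'u \<Rightarrow> real" where
  "noise_mean \<phi> z = (LINT s|law. \<phi> (f (fst z, snd z, s)))"

lemma noise_measurable:
  fixes \<phi> :: "'y \<Rightarrow> real"
  assumes "continuous_on Y \<phi>" "z \<in> Y \<times> U"
  shows "(\<lambda>s. \<phi> (f (fst z, snd z, s))) \<in> borel_measurable law"
proof -
  have "continuous_on S (\<lambda>s. f (fst z, snd z, s))"
    by (rule continuous_on_compose2[OF cont_f]) (use assms in \<open>auto intro!: continuous_intros\<close>)
  then have "continuous_on S (\<lambda>s. \<phi> (f (fst z, snd z, s)))"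
    by (rule continuous_on_compose2[OF assms(1)]) (use assms f_in in auto)
  then show ?thesis
    by (rule continuous_on_borel_measurable_restrict) (rule sets_law)
qed

lemma noise_integrable:
  fixes \<phi> :: "'y \<Rightarrow> real"
  assumes "continuous_on Y \<phi>" "z \<in> Y \<times> U"
  shows "integrable law (\<lambda>s. \<phi> (f (fst z, snd z, s)))"
proof -
  obtain B where B: "\<And>x. x \<in> Y \<Longrightarrow> \<bar>\<phi> x\<bar> \<le> B"
    using continuous_on_compact_bounded[OF compact_Y assms(1)] by metis
  show ?thesis
    by (rule law.integrable_const_bound[where B=B, OF _ noise_measurable[OF assms]])
      (use assms B f_in in \<open>auto simp: space_law\<close>)
qed

text \<open>The Feller property: \<phi> composed with \<open>f\<close> is uniformly continuous on a
  compact set, so one modulus serves all noise values and survives the integration.\<close>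

lemma noise_mean_continuous:
  assumes \<phi>: "continuous_on Y \<phi>"
  shows "continuous_on (Y \<times> U) (noise_mean \<phi>)"
  unfolding continuous_on_iff
proof (intro ballI allI impI)
  fix z e assume z: "z \<in> Y \<times> U" and "(0::real) < e"
  have "continuous_on (Y \<times> U \<times> S) (\<lambda>p. \<phi> (f p))"
    by (rule continuous_on_compose2[OF \<phi> cont_f]) (use f_in in auto)
  then have "uniformly_continuous_on (Y \<times> U \<times> S) (\<lambda>p. \<phi> (f p))"
    by (rule compact_uniformly_continuous) (rule compact_Times[OF compact_Y compact_Times[OF compact_U compact_S]])
  then obtain d where d: "0 < d"
    "\<forall>p\<in>Y \<times> U \<times> S. \<forall>p'\<in>Y \<times> U \<times> S. dist p' p < d \<longrightarrow> dist (\<phi> (f p')) (\<phi> (f p)) < e/2"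
    using half_gt_zero[OF \<open>0 < e\<close>] unfolding uniformly_continuous_on_def by metis
  have "dist (noise_mean \<phi> z') (noise_mean \<phi> z) < e" if z': "z' \<in> Y \<times> U" "dist z' z < d" for z'
  proof -
    have le: "\<bar>\<phi> (f (fst z', snd z', s)) - \<phi> (f (fst z, snd z, s))\<bar> \<le> e/2" if "s \<in> S" for s
    proof -
      have "dist (fst z', snd z', s) (fst z, snd z, s) = dist z' z"
        by (cases z; cases z') (simp add: dist_Pair_Pair)
      then have "dist (\<phi> (f (fst z', snd z', s))) (\<phi> (f (fst z, snd z, s))) < e/2"
        using d(2) z z' that by (auto simp: mem_Times_iff)
      then show ?thesis
        by (simp add: dist_real_def)
    qed
    have "noise_mean \<phi> z' - noise_mean \<phi> z =
        (LINT s|law. \<phi> (f (fst z', snd z', s)) - \<phi> (f (fst z, snd z, s)))"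
      unfolding noise_mean_def
      by (rule Bochner_Integration.integral_diff[symmetric]) (intro noise_integrable \<phi> z z')+
    also have "\<bar>\<dots>\<bar> \<le> (LINT s|law. \<bar>\<phi> (f (fst z', snd z', s)) - \<phi> (f (fst z, snd z, s))\<bar>)"
      by (rule integral_abs_bound)
    also have "\<dots> \<le> (LINT s|law. e/2)"
      by (rule integral_mono_AE)
        (use le noise_integrable[OF \<phi> z] noise_integrable[OF \<phi> z'(1)] in \<open>auto simp: space_law\<close>)
    also have "\<dots> = e/2"
      using law.prob_space by simp
    finally show ?thesis
      using \<open>0 < e\<close> by (simp add: dist_real_def)
  qed
  then show "\<exists>d>0. \<forall>x'\<in>Y \<times> U. dist x' z < d \<longrightarrow> dist (noise_mean \<phi> x') (noise_mean \<phi> z) < e"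
    using d(1) by blast
qed

lemma control_cong:
  "(\<And>i. i < t \<Longrightarrow> x i = x' i) \<Longrightarrow> control (\<lambda>i x. x i) \<pi> t x = control (\<lambda>i x. x i) \<pi> t x'"
  unfolding control_def by (rule arg_cong[where f="\<pi> t"]) (auto simp: restrict_def)

lemma path_state_cong:
  "(\<And>i. i < t \<Longrightarrow> x i = x' i) \<Longrightarrow> path_state \<pi> y t x = path_state \<pi> y t x'"
proof (induction t)
  case (Suc t)
  then have "path_state \<pi> y t x = path_state \<pi> y t x'"
    "control (\<lambda>i x. x i) \<pi> t x = control (\<lambda>i x. x i) \<pi> t x'" "x t = x' t"
    by (auto intro: control_cong)
  then show ?case
    by simp
qed simp

text \<open>State and control at time \<open>t\<close> are determined by the noise before
  \<open>t\<close>. Cutting the path there turns the next noise value into the first coordinate of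
  the independent tail.\<close>

lemma integral_state_Suc:
  assumes \<pi>: "\<pi> \<in> plans" and y: "y \<in> Y" and \<phi>: "continuous_on Y \<phi>"
  shows "(LINT x|seqlaw. \<phi> (path_state \<pi> y (Suc t) x)) = (LINT x|seqlaw. noise_mean \<phi> (traj \<pi> y t x))"
proof -
  obtain B where B: "\<And>x. x \<in> Y \<Longrightarrow> \<bar>\<phi> x\<bar> \<le> B"
    using continuous_on_compact_bounded[OF compact_Y \<phi>] by metis
  have "(LINT x|seqlaw. \<phi> (path_state \<pi> y (Suc t) x)) =
      (LINT x|seqlaw. LINT x'|seqlaw. \<phi> (path_state \<pi> y (Suc t) (comb_seq t x x')))"
    by (rule integral_comb_seq[where B=B])
      (use B path_state_in[OF \<pi> y] borel_measurable_integrable[OF state_integrable[OF \<pi> y \<phi>]] in blast)+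
  also have "\<dots> = (LINT x|seqlaw. noise_mean \<phi> (traj \<pi> y t x))"
  proof (rule Bochner_Integration.integral_cong[OF refl])
    fix x assume x: "x \<in> space seqlaw"
    have z: "traj \<pi> y t x \<in> Y \<times> U"
      by (rule traj_in[OF \<pi> y x])
    have "path_state \<pi> y (Suc t) (comb_seq t x x') = f (fst (traj \<pi> y t x), snd (traj \<pi> y t x), x' 0)" for x'
      using path_state_cong[of t "comb_seq t x x'" x \<pi> y] control_cong[of t "comb_seq t x x'" x \<pi>]
      by (simp add: comb_seq_def trajectory_def)
    then have "(LINT x'|seqlaw. \<phi> (path_state \<pi> y (Suc t) (comb_seq t x x'))) =
        (LINT x'|seqlaw. \<phi> (f (fst (traj \<pi> y t x), snd (traj \<pi> y t x), x' 0)))"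
      by simp
    also have "\<dots> = noise_mean \<phi> (traj \<pi> y t x)"
      unfolding noise_mean_def by (rule integral_law(2)[OF noise_measurable[OF \<phi> z]])
    finally show "(LINT x'|seqlaw. \<phi> (path_state \<pi> y (Suc t) (comb_seq t x x'))) = noise_mean \<phi> (traj \<pi> y t x)" .
  qed
  finally show ?thesis .
qed

lemma total_cost_altdef:
  assumes "\<pi> \<in> plans" "y \<in> Y" "continuous_on (Y \<times> U) c"
  shows "total_cost c \<pi> y T = (\<Sum>t<T. LINT x|seqlaw. c (traj \<pi> y t x))"
  unfolding total_cost_def by (rule Bochner_Integration.integral_sum) (rule traj_integrable[OF assms])

lemma total_cost_bound:
  assumes "\<pi> \<in> plans" "y \<in> Y" "continuous_on (Y \<times> U) c" and B: "\<And>z. z \<in> Y \<times> U \<Longrightarrow> \<bar>c z\<bar> \<le> B"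
  shows "\<bar>LINT x|seqlaw. c (traj \<pi> y t x)\<bar> \<le> B" "\<bar>total_cost c \<pi> y T\<bar> \<le> real T * B"
proof -
  have *: "\<bar>LINT x|seqlaw. c (traj \<pi> y t x)\<bar> \<le> B" for t
  proof -
    have "\<bar>LINT x|seqlaw. c (traj \<pi> y t x)\<bar> \<le> (LINT x|seqlaw. \<bar>c (traj \<pi> y t x)\<bar>)"
      by (rule integral_abs_bound)
    also have "\<dots> \<le> (LINT x|seqlaw. B)"
      by (rule integral_mono_AE) (use traj_integrable[OF assms(1-3)] B traj_in[OF assms(1,2)] in auto)
    finally show ?thesis
      using seqlaw.prob_space by simp
  qed
  then show "\<bar>LINT x|seqlaw. c (traj \<pi> y t x)\<bar> \<le> B" .
  have "\<bar>total_cost c \<pi> y T\<bar> \<le> (\<Sum>t<T. \<bar>LINT x|seqlaw. c (traj \<pi> y t x)\<bar>)"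
    unfolding total_cost_altdef[OF assms(1-3)] by (rule sum_abs)
  also have "\<dots> \<le> (\<Sum>t<T. B)"
    by (rule sum_mono) (rule *)
  finally show "\<bar>total_cost c \<pi> y T\<bar> \<le> real T * B"
    by simp
qed

lemma total_cost_stationarity_defect:
  assumes \<pi>: "\<pi> \<in> plans" and y: "y \<in> Y" and \<phi>: "continuous_on Y \<phi>"
  shows "total_cost (\<lambda>z. noise_mean \<phi> z - \<phi> (fst z)) \<pi> y T = (LINT x|seqlaw. \<phi> (path_state \<pi> y T x)) - \<phi> y"
proof -
  have c1: "continuous_on (Y \<times> U) (\<lambda>z. \<phi> (fst z))"
    by (rule continuous_on_compose2[OF \<phi> continuous_on_fst[OF continuous_on_id]]) auto
  have c: "continuous_on (Y \<times> U) (\<lambda>z. noise_mean \<phi> z - \<phi> (fst z))"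
    by (intro continuous_intros noise_mean_continuous \<phi> c1)
  have "(LINT x|seqlaw. noise_mean \<phi> (traj \<pi> y t x) - \<phi> (fst (traj \<pi> y t x))) =
      (LINT x|seqlaw. \<phi> (path_state \<pi> y (Suc t) x)) - (LINT x|seqlaw. \<phi> (path_state \<pi> y t x))" for t
    unfolding integral_state_Suc[OF assms]
    by (subst Bochner_Integration.integral_diff)
      (use traj_integrable[OF \<pi> y] state_integrable[OF assms] noise_mean_continuous[OF \<phi>] c1 in \<open>simp_all add: trajectory_def\<close>)
  then have "total_cost (\<lambda>z. noise_mean \<phi> z - \<phi> (fst z)) \<pi> y T =
      (\<Sum>t<T. (LINT x|seqlaw. \<phi> (path_state \<pi> y (Suc t) x)) - (LINT x|seqlaw. \<phi> (path_state \<pi> y t x)))"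
    unfolding total_cost_altdef[OF \<pi> y c] by simp
  also have "\<dots> = (LINT x|seqlaw. \<phi> (path_state \<pi> y T x)) - (LINT x|seqlaw. \<phi> (path_state \<pi> y 0 x))"
    by (rule sum_lessThan_telescope)
  finally show ?thesis
    using seqlaw.prob_space by simp
qed

lemma stationary_measures_iff:
  "\<gamma> \<in> stationary_measures Y U f M (\<sigma> 0) \<longleftrightarrow> \<gamma> \<in> borel_prob_measures (Y \<times> U) \<and>
    (\<forall>\<phi>. continuous_on Y \<phi> \<longrightarrow> (LINT z|\<gamma>. noise_mean \<phi> z - \<phi> (fst z)) = 0)"
proof -
  have "(LINT (y, u)|\<gamma>. (LINT \<omega>|M. \<phi> (f (y, u, \<sigma> 0 \<omega>))) - \<phi> y) =
      (LINT z|\<gamma>. noise_mean \<phi> z - \<phi> (fst z))"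
    if "\<gamma> \<in> borel_prob_measures (Y \<times> U)" "continuous_on Y \<phi>" for \<phi> :: "'y \<Rightarrow> real"
  proof (rule Bochner_Integration.integral_cong[OF refl])
    fix z assume "z \<in> space \<gamma>"
    then have "z \<in> Y \<times> U"
      using space_borel_prob_measures[OF that(1)] by simp
    then show "(case z of (y, u) \<Rightarrow> (LINT \<omega>|M. \<phi> (f (y, u, \<sigma> 0 \<omega>))) - \<phi> y) = noise_mean \<phi> z - \<phi> (fst z)"
      unfolding noise_mean_def using integral_law(1)[OF noise_measurable[OF that(2)], of z]
      by (simp add: case_prod_beta)
  qed
  then show ?thesis
    unfolding stationary_measures_def by auto
qed

text \<open>Controls are functions of the noise alone. Under one plan and one noise path,
  trajectories from two initial states therefore receive identical controls, and only the modulus of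
  continuity of \<open>f\<close> in the state has to be iterated. This makes \<open>d\<close>
  independent of the plan and of the path.\<close>

lemma state_equicontinuous:
  assumes "0 < e"
  shows "\<exists>d>0. \<forall>\<pi>\<in>plans. \<forall>x\<in>space seqlaw. \<forall>y\<in>Y. \<forall>y'\<in>Y. dist y y' < d \<longrightarrow>
    dist (path_state \<pi> y t x) (path_state \<pi> y' t x) < e"
  using assms
proof (induction t arbitrary: e)
  case 0
  then show ?case
    by (intro exI[of _ e]) auto
next
  case (Suc t)
  obtain d where d: "0 < d"
    "\<And>y y' u s. y \<in> Y \<Longrightarrow> y' \<in> Y \<Longrightarrow> u \<in> U \<Longrightarrow> s \<in> S \<Longrightarrow> dist y y' < d \<Longrightarrow>
      dist (f (y, u, s)) (f (y', u, s)) < e"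
    using f_uniformly_continuous[OF Suc.prems] by metis
  obtain d' where d': "0 < d'" "\<forall>\<pi>\<in>plans. \<forall>x\<in>space seqlaw. \<forall>y\<in>Y. \<forall>y'\<in>Y. dist y y' < d' \<longrightarrow>
    dist (path_state \<pi> y t x) (path_state \<pi> y' t x) < d"
    using Suc.IH[OF d(1)] by blast
  have "dist (path_state \<pi> y (Suc t) x) (path_state \<pi> y' (Suc t) x) < e"
    if "\<pi> \<in> plans" "x \<in> space seqlaw" "y \<in> Y" "y' \<in> Y" "dist y y' < d'" for \<pi> x y y'
  proof -
    have "dist (path_state \<pi> y t x) (path_state \<pi> y' t x) < d"
      using d'(2) that by blast
    moreover have "x t \<in> S"
      using that(2) by (simp add: space_seqlaw)
    ultimately show ?thesis
      using d(2) path_state_in that(1-4) control_in[OF that(1,2)] by simp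
  qed
  then show ?case
    using d'(1) by blast
qed

text \<open>The radius depends on the horizon but not on the plan, as suprema over plans and choices
  on a finite net of states require.\<close>

lemma total_cost_equicontinuous:
  assumes c: "continuous_on (Y \<times> U) c" and "0 < e"
  shows "\<exists>d>0. \<forall>\<pi>\<in>plans. \<forall>y\<in>Y. \<forall>y'\<in>Y. dist y y' < d \<longrightarrow>
    \<bar>total_cost c \<pi> y N - total_cost c \<pi> y' N\<bar> \<le> e"
  using assms(2)
proof (induction N arbitrary: e)
  case 0
  then show ?case
    by (intro exI[of _ 1]) (auto simp: total_cost_def)
next
  case (Suc N)
  obtain d where d: "0 < d" "\<forall>\<pi>\<in>plans. \<forall>y\<in>Y. \<forall>y'\<in>Y. dist y y' < d \<longrightarrow>
    \<bar>total_cost c \<pi> y N - total_cost c \<pi> y' N\<bar> \<le> e/2"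
    using Suc.IH[of "e/2"] Suc.prems by auto
  have "uniformly_continuous_on (Y \<times> U) c"
    by (rule compact_uniformly_continuous[OF c compact_YU])
  then obtain d1 where d1: "0 < d1" "\<forall>z\<in>Y \<times> U. \<forall>z'\<in>Y \<times> U. dist z' z < d1 \<longrightarrow> dist (c z') (c z) < e/2"
    using half_gt_zero[OF Suc.prems] unfolding uniformly_continuous_on_def by metis
  obtain d2 where d2: "0 < d2" "\<forall>\<pi>\<in>plans. \<forall>x\<in>space seqlaw. \<forall>y\<in>Y. \<forall>y'\<in>Y. dist y y' < d2 \<longrightarrow>
    dist (path_state \<pi> y N x) (path_state \<pi> y' N x) < d1"
    using state_equicontinuous[OF d1(1)] by blast
  have "\<bar>total_cost c \<pi> y (Suc N) - total_cost c \<pi> y' (Suc N)\<bar> \<le> e"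
    if \<pi>: "\<pi> \<in> plans" and y: "y \<in> Y" "y' \<in> Y" and lt: "dist y y' < min d d2" for \<pi> y y'
  proof -
    have le: "\<bar>c (traj \<pi> y N x) - c (traj \<pi> y' N x)\<bar> \<le> e/2" if x: "x \<in> space seqlaw" for x
    proof -
      have "dist (path_state \<pi> y N x) (path_state \<pi> y' N x) < d1"
        using d2(2) \<pi> x y lt by auto
      then have "dist (traj \<pi> y N x) (traj \<pi> y' N x) < d1"
        by (simp add: trajectory_def dist_Pair_Pair)
      then have "dist (c (traj \<pi> y N x)) (c (traj \<pi> y' N x)) < e/2"
        using d1(2) traj_in[OF \<pi> _ x] y by blast
      then show ?thesis
        by (simp add: dist_real_def)
    qed
    have "\<bar>LINT x|seqlaw. c (traj \<pi> y N x) - c (traj \<pi> y' N x)\<bar> \<le>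
        (LINT x|seqlaw. \<bar>c (traj \<pi> y N x) - c (traj \<pi> y' N x)\<bar>)"
      by (rule integral_abs_bound)
    also have "\<dots> \<le> (LINT x|seqlaw. e/2)"
      by (rule integral_mono_AE) (use traj_integrable[OF \<pi> _ c] y le in auto)
    also have "\<dots> = e/2"
      using seqlaw.prob_space by simp
    finally have "\<bar>(LINT x|seqlaw. c (traj \<pi> y N x)) - (LINT x|seqlaw. c (traj \<pi> y' N x))\<bar> \<le> e/2"
      using traj_integrable[OF \<pi> _ c] y by (subst (asm) Bochner_Integration.integral_diff) auto
    moreover have "\<bar>total_cost c \<pi> y N - total_cost c \<pi> y' N\<bar> \<le> e/2"
      using d(2) \<pi> y lt by auto
    ultimately show ?thesis
      unfolding total_cost_altdef[OF \<pi> y(1) c] total_cost_altdef[OF \<pi> y(2) c] sum.lessThan_Suc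
      by linarith
  qed
  then show ?case
    using d(1) d2(1) by (intro exI[of _ "min d d2"]) auto
qed

end

section \<open>Concatenation of plans\<close>

lemma ex_uniform_radius:
  fixes P :: "nat \<Rightarrow> real \<Rightarrow> bool"
  assumes "\<And>i. i < j \<Longrightarrow> \<exists>d>0. P i d" "\<And>i d d'. P i d \<Longrightarrow> d' \<le> d \<Longrightarrow> P i d'"
  shows "\<exists>d>0. \<forall>i<j. P i d"
  using assms(1)
proof (induction j)
  case 0
  then show ?case
    by (intro exI[of _ 1]) auto
next
  case (Suc j)
  then obtain d where d: "0 < d" "\<forall>i<j. P i d"
    by (meson less_SucI)
  obtain d' where d': "0 < d'" "P j d'"
    using Suc.prems by blast
  have "P i (min d d')" if "i < Suc j" for i
    using that d(2) d'(2) assms(2)[of i d "min d d'"] assms(2)[of j d' "min d d'"]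
    by (auto simp: less_Suc_eq)
  then show ?case
    using d(1) d'(1) by (intro exI[of _ "min d d'"]) auto
qed

context controlled_system
begin

text \<open>A plan may use the state at time \<open>n\<close>, because the known initial state and
  the past noise determine it. The state enters only through the integer \<open>idx\<close>, so
  measurability reduces to a countable case distinction. From time \<open>n\<close> on, the selected
  plan runs on the shifted noise.\<close>

definition concat_plan ::
    "nat \<Rightarrow> (nat \<Rightarrow> (nat \<Rightarrow> 's) \<Rightarrow> 'u) \<Rightarrow> 'y \<Rightarrow> ('y \<Rightarrow> nat) \<Rightarrow> (nat \<Rightarrow> nat \<Rightarrow> (nat \<Rightarrow> 's) \<Rightarrow> 'u)
      \<Rightarrow> nat \<Rightarrow> (nat \<Rightarrow> 's) \<Rightarrow> 'u" where
  "concat_plan n \<pi> y idx sel t s =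
     (if t < n then \<pi> t s
      else sel (idx (path_state \<pi> y n s)) (t - n) (\<lambda>i\<in>{..<t - n}. s (n + i)))"

lemma concat_plan_in:
  assumes \<pi>: "\<pi> \<in> plans" and y: "y \<in> Y" and sel: "\<And>k. sel k \<in> plans"
    and idx: "idx \<in> restrict_space borel Y \<rightarrow>\<^sub>M count_space UNIV"
  shows "concat_plan n \<pi> y idx sel \<in> plans"
  unfolding control_plans_def
proof (intro CollectI allI)
  fix t
  let ?P = "\<lambda>t. PiM {..<t} (\<lambda>_. restrict_space borel S)"
  show "concat_plan n \<pi> y idx sel t \<in> ?P t \<rightarrow>\<^sub>M restrict_space borel U"
  proof (cases "t < n")
    case True
    then show ?thesis
      using \<pi> by (simp add: concat_plan_def[abs_def] control_plans_def)
  next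
    case False
    have "(\<lambda>s. idx (path_state \<pi> y n s)) \<in> ?P t \<rightarrow>\<^sub>M count_space UNIV"
      by (rule measurable_compose[OF state_measurable[OF \<pi> y] idx]) (use False in auto)
    moreover have "(\<lambda>s. sel k (t - n) (\<lambda>i\<in>{..<t - n}. s (n + i))) \<in> ?P t \<rightarrow>\<^sub>M restrict_space borel U" for k
    proof -
      have "(\<lambda>s. \<lambda>i\<in>{..<t - n}. s (n + i)) \<in> ?P t \<rightarrow>\<^sub>M ?P (t - n)"
        by (intro measurable_restrict measurable_component_singleton) auto
      moreover have "sel k (t - n) \<in> ?P (t - n) \<rightarrow>\<^sub>M restrict_space borel U"
        using sel by (simp add: control_plans_def)
      ultimately show ?thesis
        by (rule measurable_compose)
    qed
    ultimately have "(\<lambda>s. sel (idx (path_state \<pi> y n s)) (t - n) (\<lambda>i\<in>{..<t - n}. s (n + i)))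
        \<in> ?P t \<rightarrow>\<^sub>M restrict_space borel U"
      by (rule measurable_compose_countable[where
            f="\<lambda>k s. sel k (t - n) (\<lambda>i\<in>{..<t - n}. s (n + i))", rotated])
    then show ?thesis
      using False by (simp add: concat_plan_def[abs_def])
  qed
qed

lemma concat_plan_control:
  "t < n \<Longrightarrow> control (\<lambda>i x. x i) (concat_plan n \<pi> y idx sel) t x = control (\<lambda>i x. x i) \<pi> t x"
  by (simp add: control_def concat_plan_def)

lemma concat_plan_state:
  "t \<le> n \<Longrightarrow> path_state (concat_plan n \<pi> y idx sel) y t x = path_state \<pi> y t x"
  by (induction t) (simp_all add: concat_plan_control)

lemma concat_plan_traj:
  "t < n \<Longrightarrow> traj (concat_plan n \<pi> y idx sel) y t x = traj \<pi> y t x"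
  by (simp add: trajectory_def concat_plan_control concat_plan_state)

lemma concat_plan_traj_add:
  fixes x x' :: "nat \<Rightarrow> 's"
  assumes y'_def: "y' = path_state \<pi> y n x"
  shows "traj (concat_plan n \<pi> y idx sel) y (n + t) (comb_seq n x x') = traj (sel (idx y')) y' t x'"
proof -
  let ?x = "comb_seq n x x'" and ?\<pi> = "concat_plan n \<pi> y idx sel"
  have y': "path_state \<pi> y n z = y'" if "\<And>i. i < n \<Longrightarrow> z i = x i" for z
    unfolding y'_def by (rule path_state_cong) (rule that)
  have c: "control (\<lambda>i x. x i) ?\<pi> (n + t) ?x = control (\<lambda>i x. x i) (sel (idx y')) t x'" for t
  proof -
    have "path_state \<pi> y n (\<lambda>i\<in>{..<n + t}. ?x i) = y'"
      by (rule y') (simp add: comb_seq_def)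
    moreover have "(\<lambda>i\<in>{..<t}. (\<lambda>i\<in>{..<n + t}. ?x i) (n + i)) = (\<lambda>i\<in>{..<t}. x' i)"
      by (auto simp: comb_seq_def restrict_def)
    ultimately show ?thesis
      by (simp add: control_def concat_plan_def)
  qed
  have "path_state ?\<pi> y (n + t) ?x = path_state (sel (idx y')) y' t x'" for t
  proof (induction t)
    case 0
    then show ?case
      using y'[of ?x, OF comb_seq_less] by (simp add: concat_plan_state)
  next
    case (Suc t)
    then show ?case
      using c[of t] comb_seq_add[of n x x' t] by (simp add: add.commute)
  qed
  with c show ?thesis
    by (simp add: trajectory_def)
qed

text \<open>This takes the place of a measurable selection: a state is rounded to the first point of
  an enumerated finite net within distance \<open>d\<close>. As a least index among Borel
  conditions, the rounding is Borel.\<close>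

lemma finite_resolution:
  assumes "0 < d"
  obtains idx :: "'y \<Rightarrow> nat" and cen where "idx \<in> restrict_space borel Y \<rightarrow>\<^sub>M count_space UNIV"
    "\<And>k. cen k \<in> Y" "\<And>y. y \<in> Y \<Longrightarrow> dist y (cen (idx y)) < d"
proof -
  have "Y \<subseteq> (\<Union>c\<in>Y. ball c d)"
    using \<open>0 < d\<close> by auto
  then obtain C where C: "C \<subseteq> Y" "finite C" "Y \<subseteq> (\<Union>c\<in>C. ball c d)"
    using compactE_image[OF compact_Y, of Y "\<lambda>c. ball c d"] by (metis open_ball)
  have "C \<noteq> {}"
    using C(3) Y_nonempty by auto
  define cen where "cen = from_nat_into C"
  define idx where "idx y = (LEAST k. dist (cen k) y < d)" for y
  show ?thesis
  proof
    have "Measurable.pred borel (\<lambda>y. dist (cen k) y < d)" for k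
    proof -
      have "{y. dist (cen k) y < d} = ball (cen k) d"
        by auto
      then have "{y. dist (cen k) y < d} \<in> sets borel"
        by simp
      then show ?thesis
        by (simp add: pred_def)
    qed
    then have "idx \<in> borel \<rightarrow>\<^sub>M count_space UNIV"
      unfolding idx_def by (rule measurable_Least)
    then show "idx \<in> restrict_space borel Y \<rightarrow>\<^sub>M count_space UNIV"
      by (rule measurable_restrict_space1)
    show "cen k \<in> Y" for k
      using from_nat_into[OF \<open>C \<noteq> {}\<close>] C(1) by (auto simp: cen_def)
    fix y assume "y \<in> Y"
    then obtain c where c: "c \<in> C" "dist c y < d"
      using C(3) by auto
    then obtain k where "cen k = c"
      using from_nat_into_surj[OF countable_finite[OF C(2)]] by (auto simp: cen_def)
    then have "dist (cen (idx y)) y < d"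
      unfolding idx_def using c(2) by (intro LeastI[of "\<lambda>k. dist (cen k) y < d" k]) simp
    then show "dist y (cen (idx y)) < d"
      by (simp add: dist_commute)
  qed
qed

text \<open>Continuations are given at every state, but only those at the centres of a finite net
  are used, each from all states rounded to its centre. The extra \<open>\<epsilon>\<close> pays for
  the displacement, half in the cost and half in \<open>G\<close>. The target \<open>G\<close> will
  be a value function in the Bellman inequality and a constant when blocks are joined.\<close>

lemma continue_plan:
  fixes h :: "nat \<Rightarrow> 'y \<times> 'u \<Rightarrow> real" and G :: "nat \<Rightarrow> 'y \<Rightarrow> real"
  assumes \<pi>: "\<pi> \<in> plans" and y: "y \<in> Y" and h: "\<And>i. i < j \<Longrightarrow> continuous_on (Y \<times> U) (h i)"
    and G: "\<And>i. i < j \<Longrightarrow> continuous_on Y (G i)" and \<epsilon>: "0 < \<epsilon>"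
    and ex: "\<And>y'. y' \<in> Y \<Longrightarrow> \<exists>\<pi>'\<in>plans. \<forall>i<j. \<bar>total_cost (h i) \<pi>' y' N - G i y'\<bar> \<le> \<eta>"
  shows "\<exists>\<pi>'\<in>plans. \<forall>i<j.
    \<bar>total_cost (h i) \<pi>' y (n + N) - (total_cost (h i) \<pi> y n + (LINT x|seqlaw. G i (path_state \<pi> y n x)))\<bar>
      \<le> \<eta> + \<epsilon>"
proof -
  \<comment> \<open>One radius has to serve the costs and the targets of all \<open>j\<close>
    components. The property passes to smaller radii, so finitely many can be replaced by their
    minimum.\<close>
  define near where "near i d \<longleftrightarrow> (\<forall>\<pi>\<in>plans. \<forall>y\<in>Y. \<forall>y'\<in>Y. dist y y' < d \<longrightarrow>
    \<bar>total_cost (h i) \<pi> y N - total_cost (h i) \<pi> y' N\<bar> \<le> \<epsilon>/2 \<and> \<bar>G i y' - G i y\<bar> \<le> \<epsilon>/2)" for i d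
  have "\<exists>d>0. near i d" if i: "i < j" for i
  proof -
    obtain d1 where d1: "0 < d1" "\<forall>\<pi>\<in>plans. \<forall>y\<in>Y. \<forall>y'\<in>Y. dist y y' < d1 \<longrightarrow>
        \<bar>total_cost (h i) \<pi> y N - total_cost (h i) \<pi> y' N\<bar> \<le> \<epsilon>/2"
      using total_cost_equicontinuous[OF h[OF i], of "\<epsilon>/2" N] \<epsilon> by auto
    have "uniformly_continuous_on Y (G i)"
      by (rule compact_uniformly_continuous[OF G[OF i] compact_Y])
    then obtain d2 where d2: "0 < d2" "\<forall>y\<in>Y. \<forall>y'\<in>Y. dist y' y < d2 \<longrightarrow> dist (G i y') (G i y) < \<epsilon>/2"
      using half_gt_zero[OF \<epsilon>] unfolding uniformly_continuous_on_def by metis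
    have "near i (min d1 d2)"
      unfolding near_def
    proof (intro ballI impI conjI)
      fix \<pi> y y' assume *: "\<pi> \<in> plans" "y \<in> Y" "y' \<in> Y" "dist y y' < min d1 d2"
      show "\<bar>total_cost (h i) \<pi> y N - total_cost (h i) \<pi> y' N\<bar> \<le> \<epsilon>/2"
        using d1(2) * by simp
      have "dist (G i y') (G i y) < \<epsilon>/2"
        using d2(2) * by (simp add: dist_commute)
      then show "\<bar>G i y' - G i y\<bar> \<le> \<epsilon>/2"
        by (simp add: dist_real_def)
    qed
    then show ?thesis
      using d1(1) d2(1) by (intro exI[of _ "min d1 d2"]) simp
  qed
  moreover have "near i d'" if "near i d" "d' \<le> d" for i d d'
    using that unfolding near_def by (meson less_le_trans)
  ultimately obtain d where d: "0 < d" "\<forall>i<j. near i d"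
    using ex_uniform_radius[of j near] by blast
  obtain idx :: "'y \<Rightarrow> nat" and cen where idx: "idx \<in> restrict_space borel Y \<rightarrow>\<^sub>M count_space UNIV"
    and cen: "\<And>k. cen k \<in> Y" and close: "\<And>y. y \<in> Y \<Longrightarrow> dist y (cen (idx y)) < d"
    using finite_resolution[OF d(1)] by metis
  obtain sel where sel: "\<And>k. sel k \<in> plans"
    and sel_le: "\<And>k i. i < j \<Longrightarrow> \<bar>total_cost (h i) (sel k) (cen k) N - G i (cen k)\<bar> \<le> \<eta>"
    using ex[OF cen] by metis
  define \<pi>' where "\<pi>' = concat_plan n \<pi> y idx sel"
  have \<pi>': "\<pi>' \<in> plans"
    unfolding \<pi>'_def by (rule concat_plan_in[OF \<pi> y sel idx])
  have "\<bar>total_cost (h i) \<pi>' y (n + N) - (total_cost (h i) \<pi> y n + (LINT x|seqlaw. G i (path_state \<pi> y n x)))\<bar>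
      \<le> \<eta> + \<epsilon>" if i: "i < j" for i
  proof -
    note hi = h[OF i] and Gi = G[OF i]
    \<comment> \<open>The expected cost after time \<open>n\<close>, given the noise before
      \<open>n\<close>: the tail \<open>x'\<close> is a fresh path for the selected plan.\<close>
    define F where "F x = (LINT x'|seqlaw. (\<Sum>t<N. h i (traj \<pi>' y (n + t) (comb_seq n x x'))))" for x
    have F: "F x = total_cost (h i) (sel (idx (path_state \<pi> y n x))) (path_state \<pi> y n x) N" for x
      unfolding F_def \<pi>'_def concat_plan_traj_add[OF refl] total_cost_def ..
    define g where "g x = (\<Sum>t<N. h i (traj \<pi>' y (n + t) x))" for x
    have gm: "g \<in> borel_measurable seqlaw"
      unfolding g_def by (intro borel_measurable_sum traj_borel \<pi>' y hi)
    obtain B where B: "\<And>z. z \<in> Y \<times> U \<Longrightarrow> \<bar>h i z\<bar> \<le> B"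
      using continuous_on_compact_bounded[OF compact_YU hi] by metis
    have gB: "\<bar>g x\<bar> \<le> real N * B" if x: "x \<in> space seqlaw" for x
    proof -
      have "\<bar>g x\<bar> \<le> (\<Sum>t<N. \<bar>h i (traj \<pi>' y (n + t) x)\<bar>)"
        unfolding g_def by (rule sum_abs)
      also have "\<dots> \<le> (\<Sum>t<N. B)"
        by (intro sum_mono B traj_in \<pi>' y x)
      finally show ?thesis
        by simp
    qed
    have "total_cost (h i) \<pi>' y (n + N) =
        (LINT x|seqlaw. (\<Sum>t<n. h i (traj \<pi> y t x)) + g x)"
      unfolding total_cost_def
    proof (rule Bochner_Integration.integral_cong[OF refl])
      fix x
      have "(\<Sum>t<n + N. h i (traj \<pi>' y t x)) =
          (\<Sum>t<n. h i (traj \<pi>' y t x)) + (\<Sum>t<N. h i (traj \<pi>' y (n + t) x))"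
        by (induction N) auto
      also have "(\<Sum>t<n. h i (traj \<pi>' y t x)) = (\<Sum>t<n. h i (traj \<pi> y t x))"
        by (simp add: \<pi>'_def concat_plan_traj)
      finally show "(\<Sum>t<n + N. h i (traj \<pi>' y t x)) = (\<Sum>t<n. h i (traj \<pi> y t x)) + g x"
        by (simp add: g_def)
    qed
    also have "\<dots> = total_cost (h i) \<pi> y n + (LINT x|seqlaw. g x)"
      unfolding total_cost_def
      by (intro Bochner_Integration.integral_add Bochner_Integration.integrable_sum
          traj_integrable[OF \<pi> y hi] seqlaw.integrable_const_bound[where B="real N * B", OF _ gm])
        (use gB in simp)
    also have "(LINT x|seqlaw. g x) = (LINT x|seqlaw. F x)"
      unfolding F_def using integral_comb_seq[OF gm gB, of n] by (simp add: g_def)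
    finally have J: "total_cost (h i) \<pi>' y (n + N) = total_cost (h i) \<pi> y n + (LINT x|seqlaw. F x)" .
    have Fint: "integrable seqlaw F"
      unfolding F_def[abs_def] using integrable_comb_seq[OF gm gB, of n] by (simp add: g_def)
    note Gint = state_integrable[OF \<pi> y Gi, of n]
    have le: "\<bar>F x - G i (path_state \<pi> y n x)\<bar> \<le> \<eta> + \<epsilon>" if x: "x \<in> space seqlaw" for x
    proof -
      define y' k where "y' = path_state \<pi> y n x" and "k = idx y'"
      have y': "y' \<in> Y"
        unfolding y'_def by (rule path_state_in[OF \<pi> y x])
      have "\<bar>total_cost (h i) (sel k) y' N - total_cost (h i) (sel k) (cen k) N\<bar> \<le> \<epsilon>/2 \<and>
          \<bar>G i (cen k) - G i y'\<bar> \<le> \<epsilon>/2"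
        using d(2) i sel y' cen close[OF y'] unfolding near_def k_def by blast
      moreover have "F x = total_cost (h i) (sel k) y' N"
        by (simp add: F y'_def k_def)
      ultimately show ?thesis
        using sel_le[OF i, of k] unfolding y'_def[symmetric] by linarith
    qed
    have "\<bar>(LINT x|seqlaw. F x) - (LINT x|seqlaw. G i (path_state \<pi> y n x))\<bar> =
        \<bar>LINT x|seqlaw. F x - G i (path_state \<pi> y n x)\<bar>"
      by (simp add: Bochner_Integration.integral_diff[OF Fint Gint])
    also have "\<dots> \<le> (LINT x|seqlaw. \<bar>F x - G i (path_state \<pi> y n x)\<bar>)"
      by (rule integral_abs_bound)
    also have "\<dots> \<le> (LINT x|seqlaw. \<eta> + \<epsilon>)"
      by (rule integral_mono_AE) (use Fint Gint le in auto)
    also have "\<dots> = \<eta> + \<epsilon>"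
      using seqlaw.prob_space by simp
    finally show ?thesis
      unfolding J by simp
  qed
  then show ?thesis
    using \<pi>' by blast
qed

end

section \<open>Approaching stationary measures\<close>

lemma integrable_borel_prob_measure:
  fixes c :: "'a::topological_space \<Rightarrow> real"
  assumes "compact X" "\<gamma> \<in> borel_prob_measures X" "continuous_on X c"
  shows "integrable \<gamma> c"
proof -
  interpret prob_space \<gamma>
    using assms(2) by (simp add: borel_prob_measures_def)
  obtain B where "\<And>x. x \<in> X \<Longrightarrow> \<bar>c x\<bar> \<le> B"
    using continuous_on_compact_bounded[OF assms(1,3)] by metis
  moreover have "c \<in> borel_measurable \<gamma>"
    using assms(2) by (intro continuous_on_borel_measurable_restrict[OF assms(3)])
      (simp add: borel_prob_measures_def)
  ultimately show ?thesis
    by (intro integrable_const_bound[where B=B]) (auto simp: space_borel_prob_measures[OF assms(2)])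
qed

context controlled_system
begin

abbreviation "stationary \<equiv> stationary_measures Y U f M (\<sigma> 0)"

lemma constant_plan: "u \<in> U \<Longrightarrow> (\<lambda>_ _. u) \<in> plans"
  by (simp add: control_plans_def space_restrict_space)

lemma plans_nonempty: "plans \<noteq> {}"
  using constant_plan U_nonempty by auto

section \<open>Finite-horizon values and the Bellman inequality\<close>

definition opt_value :: "('y \<times> 'u \<Rightarrow> real) \<Rightarrow> nat \<Rightarrow> 'y \<Rightarrow> real" where
  "opt_value c N y = (SUP \<pi>\<in>plans. total_cost c \<pi> y N)"

lemma total_cost_le_opt_value:
  assumes c: "continuous_on (Y \<times> U) c" and "\<pi> \<in> plans" "y \<in> Y"
  shows "total_cost c \<pi> y N \<le> opt_value c N y"
proof -
  obtain B where B: "\<And>z. z \<in> Y \<times> U \<Longrightarrow> \<bar>c z\<bar> \<le> B"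
    using continuous_on_compact_bounded[OF compact_YU c] by metis
  have "total_cost c \<pi> y N \<le> real N * B" if "\<pi> \<in> plans" for \<pi>
    using total_cost_bound(2)[OF that \<open>y \<in> Y\<close> c B, of N] by simp
  then have "bdd_above ((\<lambda>\<pi>. total_cost c \<pi> y N) ` plans)"
    by (auto simp: bdd_above_def)
  then show ?thesis
    unfolding opt_value_def by (rule cSUP_upper[OF \<open>\<pi> \<in> plans\<close>])
qed

lemma opt_value_approx:
  assumes "0 < e"
  shows "\<exists>\<pi>\<in>plans. opt_value c N y - e < total_cost c \<pi> y N"
proof (rule ccontr)
  assume "\<not> ?thesis"
  then have "total_cost c \<pi> y N \<le> opt_value c N y - e" if "\<pi> \<in> plans" for \<pi>
    using that by (simp add: not_less)
  then have "(SUP \<pi>\<in>plans. total_cost c \<pi> y N) \<le> opt_value c N y - e"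
    by (rule cSUP_least[OF plans_nonempty])
  then show False
    using assms by (simp add: opt_value_def[symmetric])
qed

text \<open>A supremum over plans inherits a modulus that does not depend on the plan. Continuity
  admits the value function as a test function for stationarity and as a target in
  \<open>continue_plan\<close>.\<close>

lemma opt_value_continuous:
  assumes c: "continuous_on (Y \<times> U) c"
  shows "continuous_on Y (opt_value c N)"
  unfolding continuous_on_iff
proof (intro ballI allI impI)
  fix y e assume "y \<in> Y" "(0::real) < e"
  obtain d where d: "0 < d" "\<forall>\<pi>\<in>plans. \<forall>y\<in>Y. \<forall>y'\<in>Y. dist y y' < d \<longrightarrow>
      \<bar>total_cost c \<pi> y N - total_cost c \<pi> y' N\<bar> \<le> e/2"
    using total_cost_equicontinuous[OF c, of "e/2" N] \<open>0 < e\<close> by auto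
  have le: "opt_value c N y1 \<le> opt_value c N y2 + e/2" if "y1 \<in> Y" "y2 \<in> Y" "dist y1 y2 < d" for y1 y2
    unfolding opt_value_def[of c N y1]
  proof (rule cSUP_least[OF plans_nonempty])
    fix \<pi> assume \<pi>: "\<pi> \<in> plans"
    have "\<bar>total_cost c \<pi> y1 N - total_cost c \<pi> y2 N\<bar> \<le> e/2"
      using d(2) \<pi> that by blast
    then show "total_cost c \<pi> y1 N \<le> opt_value c N y2 + e/2"
      using total_cost_le_opt_value[OF c \<pi> that(2), of N] by linarith
  qed
  have "dist (opt_value c N y') (opt_value c N y) < e" if "y' \<in> Y" "dist y' y < d" for y'
    using le[of y y'] le[of y' y] that \<open>y \<in> Y\<close> \<open>0 < e\<close> by (simp add: dist_real_def dist_commute)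
  then show "\<exists>d>0. \<forall>y'\<in>Y. dist y' y < d \<longrightarrow> dist (opt_value c N y') (opt_value c N y) < e"
    using d(1) by blast
qed

text \<open>Playing the control of \<open>z\<close> once and continuing almost optimally from the
  random next state is one admissible plan for \<open>Suc N\<close> steps. Suprema need not be
  attained, hence the detour through an arbitrary \<open>e\<close>.\<close>

lemma bellman_inequality:
  assumes c: "continuous_on (Y \<times> U) c" and z: "z \<in> Y \<times> U"
  shows "c z + noise_mean (opt_value c N) z \<le> opt_value c (Suc N) (fst z)"
proof (rule field_le_epsilon)
  fix e :: real assume "0 < e"
  obtain y u where yu: "z = (y, u)" "y \<in> Y" "u \<in> U"
    using z by auto
  \<comment> \<open>The constant plan only fixes the control at time 0; the concatenation replaces
    it from time 1 on.\<close>
  define \<pi> :: "nat \<Rightarrow> (nat \<Rightarrow> 's) \<Rightarrow> 'u" where "\<pi> = (\<lambda>_ _. u)"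
  have \<pi>: "\<pi> \<in> plans"
    unfolding \<pi>_def by (rule constant_plan[OF yu(3)])
  have t0: "traj \<pi> y 0 x = z" for x
    by (simp add: trajectory_def control_def \<pi>_def yu(1))
  have "\<exists>\<pi>'\<in>plans. \<forall>i<(1::nat).
    \<bar>total_cost c \<pi>' y (1 + N) - (total_cost c \<pi> y 1 + (LINT x|seqlaw. opt_value c N (path_state \<pi> y 1 x)))\<bar>
      \<le> e/2 + e/2"
  proof (rule continue_plan[OF \<pi> yu(2)])
    fix y' assume y': "y' \<in> Y"
    obtain \<pi>' where "\<pi>' \<in> plans" "opt_value c N y' - e/2 < total_cost c \<pi>' y' N"
      using opt_value_approx[of "e/2" c N y'] \<open>0 < e\<close> by auto
    moreover have "total_cost c \<pi>' y' N \<le> opt_value c N y'"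
      by (rule total_cost_le_opt_value[OF c \<open>\<pi>' \<in> plans\<close> y'])
    ultimately show "\<exists>\<pi>'\<in>plans. \<forall>i<(1::nat). \<bar>total_cost c \<pi>' y' N - opt_value c N y'\<bar> \<le> e/2"
      by (intro bexI[of _ \<pi>']) auto
  qed (use c opt_value_continuous \<open>0 < e\<close> in auto)
  then obtain \<pi>' where \<pi>': "\<pi>' \<in> plans"
    "\<bar>total_cost c \<pi>' y (1 + N) - (total_cost c \<pi> y 1 + (LINT x|seqlaw. opt_value c N (path_state \<pi> y 1 x)))\<bar> \<le> e"
    by auto
  moreover have "total_cost c \<pi> y 1 = c z"
    using seqlaw.prob_space by (simp add: total_cost_def t0)
  moreover have "(LINT x|seqlaw. opt_value c N (path_state \<pi> y 1 x)) = noise_mean (opt_value c N) z"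
    using integral_state_Suc[OF \<pi> yu(2) opt_value_continuous[OF c], of N 0] seqlaw.prob_space
    by (simp add: t0 del: state.simps)
  moreover have "total_cost c \<pi>' y (1 + N) \<le> opt_value c (Suc N) y"
    using total_cost_le_opt_value[OF c \<pi>'(1) yu(2), of "Suc N"] by simp
  ultimately show "c z + noise_mean (opt_value c N) z \<le> opt_value c (Suc N) (fst z) + e"
    unfolding yu(1) fst_conv by linarith
qed

lemma stationary_le_integral_value:
  assumes \<gamma>: "\<gamma> \<in> stationary" and c: "continuous_on (Y \<times> U) c"
  shows "real N * (LINT z|\<gamma>. c z) \<le> (LINT z|\<gamma>. opt_value c N (fst z))"
proof -
  have \<gamma>p: "\<gamma> \<in> borel_prob_measures (Y \<times> U)"
    using \<gamma> by (simp add: stationary_measures_iff)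
  note int = integrable_borel_prob_measure[OF compact_YU \<gamma>p]
  have v: "continuous_on (Y \<times> U) (\<lambda>z. opt_value c N (fst z))" for N
    by (rule continuous_on_compose2[OF opt_value_continuous[OF c] continuous_on_fst[OF continuous_on_id]]) auto
  note K = noise_mean_continuous[OF opt_value_continuous[OF c]]
  show ?thesis
  proof (induction N)
    case 0
    have "opt_value c 0 y = 0" for y
      using plans_nonempty by (simp add: opt_value_def total_cost_def)
    then show ?case
      by simp
  next
    case (Suc N)
    \<comment> \<open>Stationarity is tested on the value function itself: its mean over the next
      state equals its mean over the present one.\<close>
    have "(LINT z|\<gamma>. noise_mean (opt_value c N) z - opt_value c N (fst z)) = 0"
      using \<gamma> opt_value_continuous[OF c] by (simp add: stationary_measures_iff)
    then have "(LINT z|\<gamma>. noise_mean (opt_value c N) z) = (LINT z|\<gamma>. opt_value c N (fst z))"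
      by (simp add: Bochner_Integration.integral_diff[OF int[OF K] int[OF v]])
    then have "real (Suc N) * (LINT z|\<gamma>. c z) \<le> (LINT z|\<gamma>. c z) + (LINT z|\<gamma>. noise_mean (opt_value c N) z)"
      using Suc.IH by (simp add: algebra_simps)
    also have "\<dots> = (LINT z|\<gamma>. c z + noise_mean (opt_value c N) z)"
      by (simp add: Bochner_Integration.integral_add[OF int[OF c] int[OF K]])
    also have "\<dots> \<le> (LINT z|\<gamma>. opt_value c (Suc N) (fst z))"
      by (rule integral_mono)
        (use int[OF c] int[OF K] int[OF v] bellman_inequality[OF c] space_borel_prob_measures[OF \<gamma>p] in auto)
    finally show ?case .
  qed
qed

text \<open>A mean against the probability measure \<gamma> cannot exceed all values by a fixed
  amount, so some state does nearly as well as the mean. This state depends on \<open>c\<close> and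
  cannot be prescribed. Half of \<open>\<delta>\<close> is spent on the state and half on a nearly
  optimal plan.\<close>

lemma stationary_value_attained:
  assumes \<gamma>: "\<gamma> \<in> stationary" and c: "continuous_on (Y \<times> U) c" and "0 < \<delta>"
  obtains y \<pi> where "y \<in> Y" "\<pi> \<in> plans" "real N * (LINT z|\<gamma>. c z) - \<delta> \<le> total_cost c \<pi> y N"
proof -
  have \<gamma>p: "\<gamma> \<in> borel_prob_measures (Y \<times> U)"
    using \<gamma> by (simp add: stationary_measures_iff)
  interpret \<gamma>: prob_space \<gamma>
    using \<gamma>p by (simp add: borel_prob_measures_def)
  let ?I = "real N * (LINT z|\<gamma>. c z)"
  have v: "continuous_on (Y \<times> U) (\<lambda>z. opt_value c N (fst z))"
    by (rule continuous_on_compose2[OF opt_value_continuous[OF c] continuous_on_fst[OF continuous_on_id]]) auto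
  have "\<exists>y\<in>Y. ?I - \<delta>/2 \<le> opt_value c N y"
  proof (rule ccontr)
    assume "\<not> ?thesis"
    then have "opt_value c N y \<le> ?I - \<delta>/2" if "y \<in> Y" for y
      using that by force
    then have "(LINT z|\<gamma>. opt_value c N (fst z)) \<le> (LINT z|\<gamma>. ?I - \<delta>/2)"
      by (intro integral_mono integrable_borel_prob_measure[OF compact_YU \<gamma>p v])
        (use space_borel_prob_measures[OF \<gamma>p] in auto)
    then show False
      using stationary_le_integral_value[OF \<gamma> c, of N] \<gamma>.prob_space \<open>0 < \<delta>\<close> by simp
  qed
  then obtain y where "y \<in> Y" "?I - \<delta>/2 \<le> opt_value c N y"
    by blast
  moreover obtain \<pi> where "\<pi> \<in> plans" "opt_value c N y - \<delta>/2 < total_cost c \<pi> y N"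
    using opt_value_approx[of "\<delta>/2" c N y] \<open>0 < \<delta>\<close> by auto
  ultimately show ?thesis
    by (intro that[of y \<pi>]) auto
qed

lemma total_cost_linear:
  assumes "\<pi> \<in> plans" "y \<in> Y" and h: "\<And>i. i \<in> I \<Longrightarrow> continuous_on (Y \<times> U) (h i)"
  shows "total_cost (\<lambda>z. \<Sum>i\<in>I. w i * h i z) \<pi> y N = (\<Sum>i\<in>I. w i * total_cost (h i) \<pi> y N)"
proof -
  have c: "continuous_on (Y \<times> U) (\<lambda>z. \<Sum>i\<in>I. w i * h i z)"
    by (intro continuous_on_sum continuous_on_mult continuous_on_const h)
  have "total_cost (\<lambda>z. \<Sum>i\<in>I. w i * h i z) \<pi> y N =
      (\<Sum>t<N. \<Sum>i\<in>I. w i * (LINT x|seqlaw. h i (traj \<pi> y t x)))"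
    unfolding total_cost_altdef[OF assms(1,2) c]
    using traj_integrable[OF assms(1,2) h] by (simp add: Bochner_Integration.integral_sum)
  also have "\<dots> = (\<Sum>i\<in>I. w i * total_cost (h i) \<pi> y N)"
    unfolding sum.swap[of _ I]
    by (intro sum.cong refl) (simp add: total_cost_altdef[OF assms(1,2) h] sum_distrib_left)
  finally show ?thesis .
qed

text \<open>Blackwell's approachability argument: every new block is chosen so that its deviation from
  the target has almost nonpositive inner product with the accumulated deviation \<open>D\<close>, hence the
  squared length of \<open>D\<close> grows only linearly in the number of blocks.\<close>

lemma approachability:
  fixes h :: "nat \<Rightarrow> 'y \<times> 'u \<Rightarrow> real"
  assumes \<gamma>: "\<gamma> \<in> stationary"
    and h: "\<And>i. i < j \<Longrightarrow> continuous_on (Y \<times> U) (h i)"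
    and h1: "\<And>i z. i < j \<Longrightarrow> z \<in> Y \<times> U \<Longrightarrow> \<bar>h i z\<bar> \<le> 1"
  shows "\<exists>a. (\<forall>l<k. \<exists>y\<in>Y. \<exists>\<pi>\<in>plans. \<forall>i<j. a l i = total_cost (h i) \<pi> y N) \<and>
    (\<Sum>i<j. (\<Sum>l<k. a l i - real N * (LINT z|\<gamma>. h i z))\<^sup>2) \<le> real k * (4 * (real N)\<^sup>2 * real j + 2)"
proof (induction k)
  case 0
  then show ?case
    by simp
next
  case (Suc k)
  have \<gamma>p: "\<gamma> \<in> borel_prob_measures (Y \<times> U)"
    using \<gamma> by (simp add: stationary_measures_iff)
  interpret \<gamma>: prob_space \<gamma>
    using \<gamma>p by (simp add: borel_prob_measures_def)
  note int = integrable_borel_prob_measure[OF compact_YU \<gamma>p h]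
  define p where "p i = (LINT z|\<gamma>. h i z)" for i
  have p1: "\<bar>p i\<bar> \<le> 1" if "i < j" for i
  proof -
    have "\<bar>p i\<bar> \<le> (LINT z|\<gamma>. \<bar>h i z\<bar>)"
      unfolding p_def by (rule integral_abs_bound)
    also have "\<dots> \<le> (LINT z|\<gamma>. 1)"
      by (rule integral_mono) (use int that h1 space_borel_prob_measures[OF \<gamma>p] in auto)
    finally show ?thesis
      using \<gamma>.prob_space by simp
  qed
  obtain a where a: "\<forall>l<k. \<exists>y\<in>Y. \<exists>\<pi>\<in>plans. \<forall>i<j. a l i = total_cost (h i) \<pi> y N"
    "(\<Sum>i<j. (\<Sum>l<k. a l i - real N * p i)\<^sup>2) \<le> real k * (4 * (real N)\<^sup>2 * real j + 2)"
    using Suc.IH unfolding p_def by blast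
  define D where "D i = (\<Sum>l<k. a l i - real N * p i)" for i
  \<comment> \<open>Maximising this scalar cost pushes the next block against the accumulated
    deviation.\<close>
  define c where "c z = (\<Sum>i<j. - D i * h i z)" for z
  have c: "continuous_on (Y \<times> U) c"
    unfolding c_def by (intro continuous_on_sum continuous_on_mult continuous_on_const h) simp
  obtain y \<pi> where y\<pi>: "y \<in> Y" "\<pi> \<in> plans" "real N * (LINT z|\<gamma>. c z) - 1 \<le> total_cost c \<pi> y N"
    using stationary_value_attained[OF \<gamma> c, of 1 N] by auto
  define b where "b i = total_cost (h i) \<pi> y N" for i
  have "(LINT z|\<gamma>. c z) = (\<Sum>i<j. - D i * p i)"
    unfolding c_def p_def using int by (subst Bochner_Integration.integral_sum) auto
  moreover have "total_cost c \<pi> y N = (\<Sum>i<j. - D i * b i)"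
    unfolding c_def b_def by (rule total_cost_linear[OF y\<pi>(2,1)]) (simp add: h)
  ultimately have inner: "(\<Sum>i<j. D i * (b i - real N * p i)) \<le> 1"
    using y\<pi>(3) by (simp add: right_diff_distrib sum_subtractf sum_negf sum_distrib_left algebra_simps)
  \<comment> \<open>Both \<open>b i\<close> and \<open>real N * p i\<close> have modulus at most
    \<open>real N\<close>, hence \<open>4 * (real N)^2\<close> for each coordinate. The remaining
    \<open>2\<close> in the claim is the cross term: twice the slack \<open>1\<close> of
    \<open>inner\<close>.\<close>
  have sq: "(b i - real N * p i)\<^sup>2 \<le> 4 * (real N)\<^sup>2" if i: "i < j" for i
  proof -
    have "\<bar>b i\<bar> \<le> real N * 1"
      unfolding b_def by (rule total_cost_bound(2)[OF y\<pi>(2,1) h[OF i] h1[OF i]])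
    moreover have "\<bar>real N * p i\<bar> \<le> real N * 1"
      unfolding abs_mult using p1[OF i] by (intro mult_mono) auto
    ultimately have "\<bar>b i - real N * p i\<bar> \<le> 2 * real N"
      by linarith
    then have "(b i - real N * p i)\<^sup>2 \<le> (2 * real N)\<^sup>2"
      by (metis abs_ge_zero power2_abs power_mono)
    then show ?thesis
      by (simp add: power_mult_distrib)
  qed
  have "(\<Sum>i<j. (D i + d i)\<^sup>2) =
      (\<Sum>i<j. (D i)\<^sup>2) + 2 * (\<Sum>i<j. D i * d i) + (\<Sum>i<j. (d i)\<^sup>2)" for d :: "nat \<Rightarrow> real"
    by (simp add: power2_sum sum.distrib sum_distrib_left algebra_simps)
  then have "(\<Sum>i<j. (D i + (b i - real N * p i))\<^sup>2) =
      (\<Sum>i<j. (D i)\<^sup>2) + 2 * (\<Sum>i<j. D i * (b i - real N * p i)) + (\<Sum>i<j. (b i - real N * p i)\<^sup>2)"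
    .
  also have "\<dots> \<le> real k * (4 * (real N)\<^sup>2 * real j + 2) + 2 * 1 + (\<Sum>i<j. 4 * (real N)\<^sup>2)"
    using a(2) inner unfolding D_def[symmetric] by (intro add_mono mult_left_mono sum_mono sq) auto
  also have "\<dots> = real (Suc k) * (4 * (real N)\<^sup>2 * real j + 2)"
    by (simp add: algebra_simps)
  finally have "(\<Sum>i<j. (D i + (b i - real N * p i))\<^sup>2) \<le> real (Suc k) * (4 * (real N)\<^sup>2 * real j + 2)" .
  moreover have "(\<Sum>l<Suc k. (a(k := b)) l i - real N * p i) = D i + (b i - real N * p i)" for i
    by (simp add: D_def)
  ultimately have "(\<Sum>i<j. (\<Sum>l<Suc k. (a(k := b)) l i - real N * p i)\<^sup>2) \<le>
      real (Suc k) * (4 * (real N)\<^sup>2 * real j + 2)"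
    by presburger
  moreover have "\<forall>l<Suc k. \<exists>y\<in>Y. \<exists>\<pi>\<in>plans. \<forall>i<j. (a(k := b)) l i = total_cost (h i) \<pi> y N"
    using a(1) y\<pi>(1,2) by (auto simp: less_Suc_eq b_def)
  ultimately show ?case
    unfolding p_def by blast
qed

text \<open>The state at the beginning of a block is random, so each block must be realisable from
  every state. Every block adds its own tolerance \<open>\<eta>\<close> and the rounding error
  \<open>\<epsilon>\<close>; the total error thus stays proportional to the number of
  blocks.\<close>

lemma concatenated_blocks:
  fixes h :: "nat \<Rightarrow> 'y \<times> 'u \<Rightarrow> real"
  assumes h: "\<And>i. i < j \<Longrightarrow> continuous_on (Y \<times> U) (h i)" and "0 < \<epsilon>"
    and block: "\<And>l y. l < k \<Longrightarrow> y \<in> Y \<Longrightarrow> \<exists>\<pi>\<in>plans. \<forall>i<j. \<bar>total_cost (h i) \<pi> y N - a l i\<bar> \<le> \<eta>"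
    and y: "y \<in> Y"
  shows "\<exists>\<pi>\<in>plans. \<forall>i<j. \<bar>total_cost (h i) \<pi> y (k * N) - (\<Sum>l<k. a l i)\<bar> \<le> real k * (\<eta> + \<epsilon>)"
  using block
proof (induction k)
  case 0
  then show ?case
    using plans_nonempty by (auto simp: total_cost_def)
next
  case (Suc k)
  then obtain \<pi> where \<pi>: "\<pi> \<in> plans"
    "\<forall>i<j. \<bar>total_cost (h i) \<pi> y (k * N) - (\<Sum>l<k. a l i)\<bar> \<le> real k * (\<eta> + \<epsilon>)"
    by (meson less_SucI)
  have "\<exists>\<pi>'\<in>plans. \<forall>i<j.
    \<bar>total_cost (h i) \<pi>' y (k * N + N) - (total_cost (h i) \<pi> y (k * N) + (LINT x|seqlaw. a k i))\<bar> \<le> \<eta> + \<epsilon>"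
    by (rule continue_plan[OF \<pi>(1) y h _ \<open>0 < \<epsilon>\<close> Suc.prems[OF lessI]]) auto
  then obtain \<pi>' where \<pi>': "\<pi>' \<in> plans"
    "\<forall>i<j. \<bar>total_cost (h i) \<pi>' y (k * N + N) - (total_cost (h i) \<pi> y (k * N) + a k i)\<bar> \<le> \<eta> + \<epsilon>"
    using seqlaw.prob_space by auto
  have "\<bar>total_cost (h i) \<pi>' y (Suc k * N) - (\<Sum>l<Suc k. a l i)\<bar> \<le> real (Suc k) * (\<eta> + \<epsilon>)" if "i < j" for i
  proof -
    have "real (Suc k) * (\<eta> + \<epsilon>) = real k * (\<eta> + \<epsilon>) + (\<eta> + \<epsilon>)"
      by (simp add: algebra_simps)
    then show ?thesis
      using \<pi>(2)[rule_format, OF that] \<pi>'(2)[rule_format, OF that]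
      unfolding mult_Suc add.commute[of N] sum.lessThan_Suc by linarith
  qed
  then show ?case
    using \<pi>'(1) by blast
qed

lemma total_cost_add_bound:
  assumes "\<pi> \<in> plans" "y \<in> Y" "continuous_on (Y \<times> U) c" and B: "\<And>z. z \<in> Y \<times> U \<Longrightarrow> \<bar>c z\<bar> \<le> B"
  shows "\<bar>total_cost c \<pi> y (n + r) - total_cost c \<pi> y n\<bar> \<le> real r * B"
proof (induction r)
  case (Suc r)
  have "total_cost c \<pi> y (n + Suc r) = total_cost c \<pi> y (n + r) + (LINT x|seqlaw. c (traj \<pi> y (n + r) x))"
    by (simp add: total_cost_altdef[OF assms(1-3)])
  moreover have "real (Suc r) * B = real r * B + B"
    by (simp add: algebra_simps)
  ultimately show ?case
    using Suc.IH total_cost_bound(1)[OF assms, of "n + r"] by linarith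
qed simp

text \<open>The order of choices gives the uniformity: \<open>N\<close> comes from the tolerance,
  then \<open>T0\<close> from \<open>N\<close>, \<open>j\<close> and \<open>e\<close>, and only
  afterwards do \<open>y\<close> and \<gamma> enter. The horizon is filled with
  \<open>T div N\<close> blocks, and the fewer than \<open>N\<close> steps left over are
  negligible.\<close>

lemma stationary_reachable:
  fixes h :: "nat \<Rightarrow> 'y \<times> 'u \<Rightarrow> real"
  assumes h: "\<And>i. i < j \<Longrightarrow> continuous_on (Y \<times> U) (h i)"
    and h1: "\<And>i z. i < j \<Longrightarrow> z \<in> Y \<times> U \<Longrightarrow> \<bar>h i z\<bar> \<le> 1"
    and transfer: "\<And>e. 0 < e \<Longrightarrow> \<exists>N>0. \<forall>\<pi>1\<in>plans. \<forall>y1\<in>Y. \<forall>y2\<in>Y. \<exists>\<pi>2\<in>plans. \<forall>i<j.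
      \<bar>total_cost (h i) \<pi>1 y1 N - total_cost (h i) \<pi>2 y2 N\<bar> \<le> real N * e"
    and "0 < e"
  shows "\<exists>T0. \<forall>T\<ge>T0. \<forall>y\<in>Y. \<forall>\<gamma>\<in>stationary. \<exists>\<pi>\<in>plans. \<forall>i<j.
    \<bar>total_cost (h i) \<pi> y T / real T - (LINT z|\<gamma>. h i z)\<bar> \<le> e"
proof -
  obtain N where N: "0 < N" and tr: "\<forall>\<pi>1\<in>plans. \<forall>y1\<in>Y. \<forall>y2\<in>Y. \<exists>\<pi>2\<in>plans. \<forall>i<j.
      \<bar>total_cost (h i) \<pi>1 y1 N - total_cost (h i) \<pi>2 y2 N\<bar> \<le> real N * (e/4)"
    using transfer[of "e/4"] \<open>0 < e\<close> by auto
  define C where "C = 4 * (real N)\<^sup>2 * real j + 2"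
  have C: "0 < C"
    unfolding C_def by (intro add_nonneg_pos) auto
  \<comment> \<open>The first summand brings the deviation \<open>sqrt (T * C)\<close> below
    \<open>T * e / 4\<close>, the second does the same for the leftover steps, counted twice, and
    the last one keeps \<open>T\<close> positive.\<close>
  define T0 where "T0 = nat \<lceil>16 * C / e\<^sup>2\<rceil> + nat \<lceil>8 * real N / e\<rceil> + 1"
  have "\<exists>\<pi>\<in>plans. \<forall>i<j. \<bar>total_cost (h i) \<pi> y T / real T - (LINT z|\<gamma>. h i z)\<bar> \<le> e"
    if T: "T0 \<le> T" and y: "y \<in> Y" and \<gamma>: "\<gamma> \<in> stationary" for T y \<gamma>
  proof -
    have \<gamma>p: "\<gamma> \<in> borel_prob_measures (Y \<times> U)"
      using \<gamma> by (simp add: stationary_measures_iff)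
    interpret \<gamma>: prob_space \<gamma>
      using \<gamma>p by (simp add: borel_prob_measures_def)
    define p where "p i = (LINT z|\<gamma>. h i z)" for i
    have p1: "\<bar>p i\<bar> \<le> 1" if "i < j" for i
    proof -
      have "\<bar>p i\<bar> \<le> (LINT z|\<gamma>. \<bar>h i z\<bar>)"
        unfolding p_def by (rule integral_abs_bound)
      also have "\<dots> \<le> (LINT z|\<gamma>. 1)"
        by (rule integral_mono)
          (use integrable_borel_prob_measure[OF compact_YU \<gamma>p h] that h1 space_borel_prob_measures[OF \<gamma>p] in auto)
      finally show ?thesis
        using \<gamma>.prob_space by simp
    qed
    have "real T0 \<ge> 16 * C / e\<^sup>2" "real T0 \<ge> 8 * real N / e"
      unfolding T0_def by linarith+
    then have "real T \<ge> 16 * C / e\<^sup>2" "real T \<ge> 8 * real N / e"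
      using T by linarith+
    then have TC: "16 * C \<le> real T * e\<^sup>2" and TN: "8 * real N \<le> real T * e"
      using \<open>0 < e\<close> by (simp_all add: field_simps)
    have T_pos: "0 < T"
      using T by (simp add: T0_def)
    define k r where "k = T div N" and "r = T mod N"
    have kr: "T = k * N + r" "r < N"
      using N by (simp_all add: k_def r_def)
    have kT: "real k \<le> real T"
      by (simp add: k_def)
    obtain a where a: "\<forall>l<k. \<exists>y\<in>Y. \<exists>\<pi>\<in>plans. \<forall>i<j. a l i = total_cost (h i) \<pi> y N"
      "(\<Sum>i<j. (\<Sum>l<k. a l i - real N * p i)\<^sup>2) \<le> real k * C"
      using approachability[where j=j and h=h and k=k and N=N, OF \<gamma> h h1] unfolding p_def C_def by blast
    \<comment> \<open>Per unit of time, one \<open>e/4\<close> comes from moving a block to another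
      initial state and the other from rounding states in the concatenation. Together with the two
      quarters provided by \<open>T0\<close> this makes up \<open>e\<close>.\<close>
    have "\<exists>\<pi>\<in>plans. \<forall>i<j. \<bar>total_cost (h i) \<pi> y (k * N) - (\<Sum>l<k. a l i)\<bar> \<le>
        real k * (real N * (e/4) + real N * (e/4))"
    proof (rule concatenated_blocks[OF h])
      show "0 < real N * (e/4)"
        using N \<open>0 < e\<close> by simp
      fix l y assume "l < k" "y \<in> Y"
      obtain y1 \<pi>1 where 1: "y1 \<in> Y" "\<pi>1 \<in> plans" "\<forall>i<j. a l i = total_cost (h i) \<pi>1 y1 N"
        using a(1) \<open>l < k\<close> by blast
      then obtain \<pi>2 where "\<pi>2 \<in> plans"
        "\<forall>i<j. \<bar>total_cost (h i) \<pi>1 y1 N - total_cost (h i) \<pi>2 y N\<bar> \<le> real N * (e/4)"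
        using tr \<open>y \<in> Y\<close> by blast
      then show "\<exists>\<pi>\<in>plans. \<forall>i<j. \<bar>total_cost (h i) \<pi> y N - a l i\<bar> \<le> real N * (e/4)"
        using 1(3) by (intro bexI[of _ \<pi>2]) (auto simp: abs_minus_commute)
    qed (use y in auto)
    then obtain \<pi> where \<pi>: "\<pi> \<in> plans" "\<forall>i<j. \<bar>total_cost (h i) \<pi> y (k * N) - (\<Sum>l<k. a l i)\<bar> \<le>
        real k * (real N * (e/4) + real N * (e/4))"
      by blast
    have "\<bar>total_cost (h i) \<pi> y T / real T - p i\<bar> \<le> e" if i: "i < j" for i
    proof -
      have "(\<Sum>l<k. a l i - real N * p i)\<^sup>2 \<le> (\<Sum>i<j. (\<Sum>l<k. a l i - real N * p i)\<^sup>2)"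
        using i by (intro member_le_sum) auto
      also have "\<dots> \<le> real T * C"
        using a(2) mult_right_mono[OF kT, of C] C by linarith
      also have "16 * (real T * C) \<le> (real T * e)\<^sup>2"
        using mult_left_mono[OF TC, of "real T"] by (simp add: power2_eq_square algebra_simps)
      then have "real T * C \<le> (real T * e / 4)\<^sup>2"
        by (simp add: power_divide)
      finally have "\<bar>\<Sum>l<k. a l i - real N * p i\<bar> \<le> real T * e / 4"
        using \<open>0 < e\<close> by (simp add: abs_le_square_iff[symmetric])
      moreover have "(\<Sum>l<k. a l i - real N * p i) = (\<Sum>l<k. a l i) - real (k * N) * p i"
        by (simp add: sum_subtractf)
      ultimately have 1: "\<bar>(\<Sum>l<k. a l i) - real (k * N) * p i\<bar> \<le> real T * e / 4"
        by simp
      have 2: "\<bar>total_cost (h i) \<pi> y T - total_cost (h i) \<pi> y (k * N)\<bar> \<le> real r"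
        using total_cost_add_bound[OF \<pi>(1) y h[OF i] h1[OF i], of "k * N" r] by (simp add: kr(1))
      have "\<bar>real r * p i\<bar> \<le> real r * 1"
        unfolding abs_mult using p1[OF i] by (intro mult_mono) auto
      moreover have "real T * p i = real (k * N) * p i + real r * p i"
        by (simp add: kr(1) algebra_simps)
      ultimately have 3: "\<bar>real (k * N) * p i - real T * p i\<bar> \<le> real r"
        by simp
      have "real k * (real N * (e/4) + real N * (e/4)) = real (k * N) * e / 2"
        by (simp add: algebra_simps)
      also have "\<dots> \<le> real T * e / 2"
        using \<open>0 < e\<close> kr(1) by (intro divide_right_mono mult_right_mono) auto
      finally have 4: "\<bar>total_cost (h i) \<pi> y (k * N) - (\<Sum>l<k. a l i)\<bar> \<le> real T * e / 2"
        using \<pi>(2) i by force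
      have "real r \<le> real N"
        using kr(2) by simp
      then have "\<bar>total_cost (h i) \<pi> y T - real T * p i\<bar> \<le> real T * e"
        using 1 2 3 4 TN by linarith
      moreover have "total_cost (h i) \<pi> y T / real T - p i = (total_cost (h i) \<pi> y T - real T * p i) / real T"
        using T_pos by (simp add: field_simps)
      ultimately show ?thesis
        using T_pos by (simp add: abs_divide divide_le_eq mult.commute)
    qed
    then show ?thesis
      using \<pi>(1) unfolding p_def by blast
  qed
  then show ?thesis
    by blast
qed

end

section \<open>Limits of occupational measures\<close>

text \<open>The weights from index \<open>j\<close> on sum to \<open>(1/2)^j\<close> and the terms
  are at most 2, so the tail costs at most \<open>e/2\<close> whatever its values. Closeness in
  \<open>measure_dist\<close> thereby reduces to finitely many integrals.\<close>

lemma weighted_series_small: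
  assumes "(0::real) < e"
  shows "\<exists>j\<ge>1. \<forall>a. (\<forall>i. 0 \<le> a i \<and> a i \<le> 2) \<and> (\<forall>i<j. a i \<le> e/2) \<longrightarrow> (\<Sum>i. (1/2)^Suc i * a i) \<le> e"
proof -
  obtain j0 where j0: "(1/2::real)^j0 < e/4"
    using real_arch_pow_inv[of "e/4" "1/2"] assms by auto
  define j where "j = Suc j0"
  have j: "2 * (1/2::real)^j \<le> e/2"
    using j0 assms by (simp add: j_def)
  have "(\<Sum>i. (1/2)^Suc i * a i) \<le> e" if a: "\<And>i. 0 \<le> a i" "\<And>i. a i \<le> 2" "\<And>i. i < j \<Longrightarrow> a i \<le> e/2" for a
  proof -
    note half = power_half_series[THEN sums_summable]
    have s: "summable (\<lambda>i. (1/2)^Suc i * a i)"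
      by (rule summable_comparison_test'[OF summable_mult2[OF half, of 2], of 0])
        (use a in \<open>auto simp: abs_mult intro!: mult_mono\<close>)
    have shift: "(\<lambda>i. (1/2::real)^Suc i * (1/2)^j * 2) sums (1 * (1/2)^j * 2)"
      by (intro sums_mult2 power_half_series)
    have "(\<Sum>i. (1/2)^Suc (i + j) * a (i + j)) \<le> (\<Sum>i. (1/2::real)^Suc i * (1/2)^j * 2)"
    proof (rule suminf_le)
      show "(1/2)^Suc (i + j) * a (i + j) \<le> (1/2)^Suc i * (1/2)^j * 2" for i
        using mult_left_mono[OF a(2)[of "i + j"], of "(1/2)^Suc (i + j)"] by (simp add: power_add)
      show "summable (\<lambda>i. (1/2)^Suc (i + j) * a (i + j))"
        using s summable_iff_shift[of "\<lambda>i. (1/2)^Suc i * a i" j] by simp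
    qed (rule sums_summable[OF shift])
    also have "\<dots> = 2 * (1/2)^j"
      using sums_unique[OF shift] by simp
    finally have 1: "(\<Sum>i. (1/2)^Suc (i + j) * a (i + j)) \<le> e/2"
      using j by linarith
    have "(\<Sum>i<j. (1/2)^Suc i * a i) \<le> (\<Sum>i<j. (1/2)^Suc i * (e/2))"
      using a by (intro sum_mono mult_left_mono) auto
    also have "\<dots> = (\<Sum>i<j. (1/2)^Suc i) * (e/2)"
      by (rule sum_distrib_right[symmetric])
    also have "\<dots> \<le> 1 * (e/2)"
      using sum_le_suminf[OF half, of "{..<j}"] sums_unique[OF power_half_series] assms
      by (intro mult_right_mono) auto
    finally show ?thesis
      using 1 suminf_split_initial_segment[OF s, of j] by linarith
  qed
  then show ?thesis
    by (intro exI[of _ j]) (auto simp: j_def)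
qed

lemma eucl_dist_le:
  assumes "\<And>i. i < j \<Longrightarrow> \<bar>v i - w i\<bar> \<le> e"
  shows "eucl_dist j v w \<le> real j * e"
proof -
  have "eucl_dist j v w \<le> (\<Sum>i<j. \<bar>v i - w i\<bar>)"
    unfolding eucl_dist_def by (rule L2_set_le_sum_abs)
  also have "\<dots> \<le> (\<Sum>i<j. e)"
    using assms by (intro sum_mono) simp
  finally show ?thesis
    by simp
qed

lemma component_le_eucl_dist: "i < j \<Longrightarrow> \<bar>v i - w i\<bar> \<le> eucl_dist j v w"
  unfolding eucl_dist_def L2_set_def
  by (rule real_le_rsqrt) (use member_le_sum[of i "{..<j}" "\<lambda>i. (v i - w i)\<^sup>2"] in simp)

lemma tendsto_fun_iff:
  fixes F :: "nat \<Rightarrow> nat \<Rightarrow> real"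
  shows "F \<longlonglongrightarrow> v \<longleftrightarrow> (\<forall>i. (\<lambda>n. F n i) \<longlonglongrightarrow> v i)"
  using limitin_componentwise[of "\<lambda>_. euclideanreal" UNIV F v sequentially]
  by (simp add: euclidean_product_topology)

text \<open>Opens compactness of the limit sets to sequences: the topology is that of coordinatewise
  convergence, with the coordinates from \<open>j\<close> on fixed at 0.\<close>

lemma compactin_Euclidean_space_iff:
  "compactin (Euclidean_space j) V \<longleftrightarrow> compact V \<and> V \<subseteq> {v. \<forall>i\<ge>j. v i = 0}"
  by (simp add: Euclidean_space_def compactin_subtopology euclidean_product_topology)

context controlled_system
begin

abbreviation "occ \<equiv> occupational_measure Y U f M \<sigma>"

text \<open>Plans and initial states may vary along the sequence; this freedom is what later yields
  bounds that are uniform in both.\<close>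

lemma limit_of_occupational_measures:
  assumes \<pi>: "\<And>n. \<pi> n \<in> plans" and y: "\<And>n. y n \<in> Y" and T: "\<And>n. n < T n"
  obtains r :: "nat \<Rightarrow> nat" and \<gamma> where "strict_mono r" "\<gamma> \<in> stationary"
    "\<forall>c :: 'y \<times> 'u \<Rightarrow> real. continuous_on (Y \<times> U) c \<longrightarrow>
      (\<lambda>n. LINT z|occ (\<pi> (r n)) (y (r n)) (T (r n)). c z) \<longlonglongrightarrow> (LINT z|\<gamma>. c z)"
proof -
  have T0: "0 < T n" for n
    using T[of n] by simp
  obtain r :: "nat \<Rightarrow> nat" and \<gamma> where r: "strict_mono r" "\<gamma> \<in> borel_prob_measures (Y \<times> U)"
    and lim: "\<forall>c :: 'y \<times> 'u \<Rightarrow> real. continuous_on (Y \<times> U) c \<longrightarrow>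
      (\<lambda>n. LINT z|occ (\<pi> (r n)) (y (r n)) (T (r n)). c z) \<longlonglongrightarrow> (LINT z|\<gamma>. c z)"
    by (rule borel_prob_measures_seq_compact[where \<gamma>="\<lambda>n. occ (\<pi> n) (y n) (T n)",
          OF compact_YU occupational_measure_in[OF \<pi> y T0]])
  have "(LINT z|\<gamma>. noise_mean \<phi> z - \<phi> (fst z)) = 0" if \<phi>: "continuous_on Y \<phi>" for \<phi> :: "'y \<Rightarrow> real"
  proof -
    let ?c = "\<lambda>z. noise_mean \<phi> z - \<phi> (fst z)"
    have c: "continuous_on (Y \<times> U) ?c"
      by (intro continuous_on_diff noise_mean_continuous[OF \<phi>]
          continuous_on_compose2[OF \<phi> continuous_on_fst[OF continuous_on_id]]) auto
    obtain B where B: "\<And>x. x \<in> Y \<Longrightarrow> \<bar>\<phi> x\<bar> \<le> B"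
      using continuous_on_compact_bounded[OF compact_Y \<phi>] by metis
    have small: "\<bar>LINT z|occ (\<pi> n) (y n) (T n). ?c z\<bar> \<le> 2 * B * inverse (real (Suc n))" for n
    proof -
      have B0: "0 \<le> B"
        using B[OF y[of n]] by linarith
      have "\<bar>LINT x|seqlaw. \<phi> (path_state (\<pi> n) (y n) (T n) x)\<bar> \<le>
          (LINT x|seqlaw. \<bar>\<phi> (path_state (\<pi> n) (y n) (T n) x)\<bar>)"
        by (rule integral_abs_bound)
      also have "\<dots> \<le> (LINT x|seqlaw. B)"
        by (rule integral_mono) (use state_integrable[OF \<pi> y \<phi>] B path_state_in[OF \<pi> y] in auto)
      finally have "\<bar>LINT x|seqlaw. \<phi> (path_state (\<pi> n) (y n) (T n) x)\<bar> \<le> B"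
        using seqlaw.prob_space by simp
      then have "\<bar>total_cost ?c (\<pi> n) (y n) (T n)\<bar> \<le> 2 * B"
        using B[OF y[of n]] unfolding total_cost_stationarity_defect[OF \<pi> y \<phi>] by linarith
      moreover have "1 / real (T n) \<le> inverse (real (Suc n))"
        using T[of n] by (simp add: inverse_eq_divide frac_le)
      ultimately have "\<bar>total_cost ?c (\<pi> n) (y n) (T n)\<bar> * (1 / real (T n)) \<le> 2 * B * inverse (real (Suc n))"
        using B0 by (intro mult_mono) auto
      then show ?thesis
        by (simp add: integral_occupational_measure[OF \<pi> y T0 c] abs_divide)
    qed
    have lim0: "(\<lambda>n. LINT z|occ (\<pi> n) (y n) (T n). ?c z) \<longlonglongrightarrow> 0"
    proof (rule Lim_null_comparison)
      show "eventually (\<lambda>n. norm (LINT z|occ (\<pi> n) (y n) (T n). ?c z) \<le> 2 * B * inverse (real (Suc n))) sequentially"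
        using small by (simp only: real_norm_def eventually_True)
      show "(\<lambda>n. 2 * B * inverse (real (Suc n))) \<longlonglongrightarrow> 0"
        by (rule tendsto_mult_right_zero[OF LIMSEQ_inverse_real_of_nat])
    qed
    have "(\<lambda>n. LINT z|occ (\<pi> (r n)) (y (r n)) (T (r n)). ?c z) \<longlonglongrightarrow> 0"
      using LIMSEQ_subseq_LIMSEQ[OF lim0 r(1)] by (simp add: o_def)
    then show ?thesis
      by (rule LIMSEQ_unique[OF lim[rule_format, OF c]])
  qed
  then have "\<gamma> \<in> stationary"
    using r(2) by (simp add: stationary_measures_iff)
  then show ?thesis
    using that r(1) lim by blast
qed

text \<open>The Krylov-Bogoliubov argument, for one fixed plan and initial state. Nonemptiness
  matters because the Hausdorff distance between a nonempty set and the empty set is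
  infinite.\<close>

lemma stationary_nonempty: "stationary \<noteq> {}"
proof -
  obtain \<pi> y where "\<pi> \<in> plans" "y \<in> Y"
    using plans_nonempty Y_nonempty by blast
  then show ?thesis
    using limit_of_occupational_measures[of "\<lambda>_. \<pi>" "\<lambda>_. y" Suc] by blast
qed

lemma stationary_seq_compact:
  assumes \<gamma>: "\<And>n. \<gamma> n \<in> stationary"
  obtains r :: "nat \<Rightarrow> nat" and \<gamma>' where "strict_mono r" "\<gamma>' \<in> stationary"
    "\<forall>c :: 'y \<times> 'u \<Rightarrow> real. continuous_on (Y \<times> U) c \<longrightarrow>
      (\<lambda>n. LINT z|\<gamma> (r n). c z) \<longlonglongrightarrow> (LINT z|\<gamma>'. c z)"
proof -
  have \<gamma>p: "\<gamma> n \<in> borel_prob_measures (Y \<times> U)" for n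
    using \<gamma> by (simp add: stationary_measures_iff)
  obtain r :: "nat \<Rightarrow> nat" and \<gamma>' where r: "strict_mono r" "\<gamma>' \<in> borel_prob_measures (Y \<times> U)"
    and lim: "\<forall>c :: 'y \<times> 'u \<Rightarrow> real. continuous_on (Y \<times> U) c \<longrightarrow>
      (\<lambda>n. LINT z|\<gamma> (r n). c z) \<longlonglongrightarrow> (LINT z|\<gamma>'. c z)"
    by (rule borel_prob_measures_seq_compact[where \<gamma>=\<gamma>, OF compact_YU \<gamma>p])
  have "(LINT z|\<gamma>'. noise_mean \<phi> z - \<phi> (fst z)) = 0" if \<phi>: "continuous_on Y \<phi>" for \<phi> :: "'y \<Rightarrow> real"
  proof -
    have c: "continuous_on (Y \<times> U) (\<lambda>z. noise_mean \<phi> z - \<phi> (fst z))"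
      by (intro continuous_on_diff noise_mean_continuous[OF \<phi>]
          continuous_on_compose2[OF \<phi> continuous_on_fst[OF continuous_on_id]]) auto
    have "(LINT z|\<gamma> n. noise_mean \<phi> z - \<phi> (fst z)) = 0" for n
      using \<gamma>[of n] \<phi> by (simp add: stationary_measures_iff)
    then show ?thesis
      using lim[rule_format, OF c] by (simp add: LIMSEQ_const_iff)
  qed
  then have "\<gamma>' \<in> stationary"
    using r(2) by (simp add: stationary_measures_iff)
  then show ?thesis
    using that r(1) lim by blast
qed

lemma stationary_convex:
  assumes \<gamma>: "\<gamma>1 \<in> stationary" "\<gamma>2 \<in> stationary" and a: "0 \<le> a" "0 \<le> b" "a + b = 1"
  obtains \<gamma> where "\<gamma> \<in> stationary"
    "\<And>c :: 'y \<times> 'u \<Rightarrow> real. continuous_on (Y \<times> U) c \<Longrightarrow>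
      (LINT z|\<gamma>. c z) = a * (LINT z|\<gamma>1. c z) + b * (LINT z|\<gamma>2. c z)"
proof -
  define \<kappa> where "\<kappa> t = (if t then \<gamma>1 else \<gamma>2)" for t
  have \<kappa>: "\<kappa> t \<in> borel_prob_measures (Y \<times> U)" for t
    using \<gamma> by (simp add: \<kappa>_def stationary_measures_iff)
  \<comment> \<open>A coin with success probability \<open>a\<close> selects between the two
    measures.\<close>
  define \<gamma> where "\<gamma> = measure_pmf (bernoulli_pmf a) \<bind> \<kappa>"
  have a1: "a \<le> 1" "1 - a = b"
    using a by auto
  have eq: "(LINT z|\<gamma>. c z) = a * (LINT z|\<gamma>1. c z) + b * (LINT z|\<gamma>2. c z)"
    if c: "continuous_on (Y \<times> U) c" for c :: "'y \<times> 'u \<Rightarrow> real"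
  proof -
    obtain B where B: "\<And>z. z \<in> Y \<times> U \<Longrightarrow> \<bar>c z\<bar> \<le> B"
      using continuous_on_compact_bounded[OF compact_YU c] by metis
    have "(LINT z|\<gamma>. c z) = (LINT t|measure_pmf (bernoulli_pmf a). LINT z|\<kappa> t. c z)"
      unfolding \<gamma>_def
      by (rule mixture_of_borel_prob_measures(3)[where \<kappa>=\<kappa>, OF \<kappa> borel_measurable_continuous_on_restrict[OF c] B])
    then show ?thesis
      using a(1) a1 by (simp add: \<kappa>_def mult.commute)
  qed
  have "(LINT z|\<gamma>. noise_mean \<phi> z - \<phi> (fst z)) = 0" if \<phi>: "continuous_on Y \<phi>" for \<phi> :: "'y \<Rightarrow> real"
  proof -
    have c: "continuous_on (Y \<times> U) (\<lambda>z. noise_mean \<phi> z - \<phi> (fst z))"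
      by (intro continuous_on_diff noise_mean_continuous[OF \<phi>]
          continuous_on_compose2[OF \<phi> continuous_on_fst[OF continuous_on_id]]) auto
    show ?thesis
      using \<gamma> \<phi> unfolding eq[OF c] by (simp add: stationary_measures_iff)
  qed
  then have "\<gamma> \<in> stationary"
    unfolding stationary_measures_iff \<gamma>_def using mixture_of_borel_prob_measures(1)[where \<kappa>=\<kappa>, OF \<kappa>] by blast
  then show ?thesis
    using that eq by blast
qed

text \<open>Counterexamples at unbounded horizons would have a stationary limit along a subsequence,
  and their integrals of the finitely many \<open>h i\<close> would approach those of this very
  limit.\<close>

lemma occupational_near_stationary:
  fixes h :: "nat \<Rightarrow> 'y \<times> 'u \<Rightarrow> real"
  assumes h: "\<And>i. i < j \<Longrightarrow> continuous_on (Y \<times> U) (h i)" and "0 < e"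
  shows "\<exists>T0. \<forall>T\<ge>T0. \<forall>y\<in>Y. \<forall>\<pi>\<in>plans. \<exists>\<gamma>\<in>stationary. \<forall>i<j.
    \<bar>(LINT z|occ \<pi> y T. h i z) - (LINT z|\<gamma>. h i z)\<bar> \<le> e"
proof (rule ccontr)
  assume "\<not> ?thesis"
  then have "\<forall>n. \<exists>T y \<pi>. Suc n \<le> T \<and> y \<in> Y \<and> \<pi> \<in> plans \<and> (\<forall>\<gamma>\<in>stationary. \<exists>i<j.
      \<not> \<bar>(LINT z|occ \<pi> y T. h i z) - (LINT z|\<gamma>. h i z)\<bar> \<le> e)"
    by blast
  then obtain T y \<pi> where *: "\<And>n::nat. Suc n \<le> T n" "\<And>n. y n \<in> Y" "\<And>n. \<pi> n \<in> plans"
    and bad: "\<And>n. \<forall>\<gamma>\<in>stationary. \<exists>i<j. \<not> \<bar>(LINT z|occ (\<pi> n) (y n) (T n). h i z) - (LINT z|\<gamma>. h i z)\<bar> \<le> e"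
    by metis
  have T: "n < T n" for n
    using *(1)[of n] by simp
  obtain r :: "nat \<Rightarrow> nat" and \<gamma> where r: "strict_mono r" "\<gamma> \<in> stationary"
    and lim: "\<forall>c :: 'y \<times> 'u \<Rightarrow> real. continuous_on (Y \<times> U) c \<longrightarrow>
      (\<lambda>n. LINT z|occ (\<pi> (r n)) (y (r n)) (T (r n)). c z) \<longlonglongrightarrow> (LINT z|\<gamma>. c z)"
    by (rule limit_of_occupational_measures[where \<pi>=\<pi> and y=y and T=T, OF *(3,2) T])
  have "eventually (\<lambda>n. \<forall>i\<in>{..<j}. dist (LINT z|occ (\<pi> (r n)) (y (r n)) (T (r n)). h i z) (LINT z|\<gamma>. h i z) < e)
      sequentially"
  proof (rule eventually_ball_finite[OF finite_lessThan], rule ballI)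
    fix i assume "i \<in> {..<j}"
    then have "continuous_on (Y \<times> U) (h i)"
      using h by simp
    from lim[rule_format, OF this]
    show "eventually (\<lambda>n. dist (LINT z|occ (\<pi> (r n)) (y (r n)) (T (r n)). h i z) (LINT z|\<gamma>. h i z) < e)
        sequentially"
      using \<open>0 < e\<close> by (rule tendstoD)
  qed
  then obtain n where "\<forall>i\<in>{..<j}. dist (LINT z|occ (\<pi> (r n)) (y (r n)) (T (r n)). h i z) (LINT z|\<gamma>. h i z) < e"
    using eventually_happens by force
  then show False
    using bad[of "r n"] r(2) by (force simp: dist_real_def)
qed

text \<open>The averages in the hypothesis run over the times 0 to \<open>T\<close>, that is
  \<open>T + 1\<close> terms, but are divided by \<open>T\<close>. The block length is therefore
  \<open>Suc T\<close>, and the bound \<open>e * real T\<close> so obtained lies below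
  \<open>real (Suc T) * e\<close>.\<close>

lemma weak_approximation_transfer:
  assumes w: "weak_approximation Y U S f M \<sigma> j h"
    and h: "\<And>i. i < j \<Longrightarrow> continuous_on (Y \<times> U) (h i)" and "0 < e"
  shows "\<exists>N>0. \<forall>\<pi>1\<in>plans. \<forall>y1\<in>Y. \<forall>y2\<in>Y. \<exists>\<pi>2\<in>plans. \<forall>i<j.
    \<bar>total_cost (h i) \<pi>1 y1 N - total_cost (h i) \<pi>2 y2 N\<bar> \<le> real N * e"
proof -
  obtain \<nu> :: "real \<Rightarrow> real" where lim: "(\<nu> \<longlongrightarrow> 0) at_top"
    and app: "\<forall>T>0. \<forall>y1\<in>Y. \<forall>y2\<in>Y. \<forall>\<pi>1\<in>plans. \<exists>\<pi>2\<in>plans.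
      eucl_dist j (average_vector f M \<sigma> j h \<pi>1 y1 T) (average_vector f M \<sigma> j h \<pi>2 y2 T) \<le> \<nu> (real T)"
    using w unfolding weak_approximation_def by blast
  have "eventually (\<lambda>t. dist (\<nu> t) 0 < e) at_top"
    using tendstoD[OF lim \<open>0 < e\<close>] .
  then obtain t0 where t0: "\<And>t. t0 \<le> t \<Longrightarrow> dist (\<nu> t) 0 < e"
    unfolding eventually_at_top_linorder by blast
  define T where "T = Suc (nat \<lceil>t0\<rceil>)"
  have "t0 \<le> real T"
    unfolding T_def by linarith
  then have \<nu>T: "\<nu> (real T) \<le> e"
    using t0[of "real T"] by (simp add: dist_real_def)
  have T: "0 < T"
    by (simp add: T_def)
  have avg: "average_vector f M \<sigma> j h \<pi> y T i = total_cost (h i) \<pi> y (Suc T) / real T"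
    if "i < j" "\<pi> \<in> plans" "y \<in> Y" for i \<pi> y
  proof -
    have "(LINT \<omega>|M. 1 / real T * (\<Sum>t=0..T. h i (trajectory f \<sigma> \<pi> y t \<omega>))) =
        (LINT x|seqlaw. 1 / real T * (\<Sum>t=0..T. h i (traj \<pi> y t x)))"
      unfolding trajectory_noise
      by (rule integral_noise[of "\<lambda>x. 1 / real T * (\<Sum>t=0..T. h i (traj \<pi> y t x))"])
        (intro borel_measurable_times borel_measurable_const borel_measurable_sum traj_borel that h)
    then show ?thesis
      using that(1) by (simp add: average_vector_def total_cost_def atLeast0AtMost lessThan_Suc_atMost)
  qed
  have "\<exists>\<pi>2\<in>plans. \<forall>i<j. \<bar>total_cost (h i) \<pi>1 y1 (Suc T) - total_cost (h i) \<pi>2 y2 (Suc T)\<bar> \<le> real (Suc T) * e"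
    if p: "\<pi>1 \<in> plans" "y1 \<in> Y" "y2 \<in> Y" for \<pi>1 y1 y2
  proof -
    obtain \<pi>2 where \<pi>2: "\<pi>2 \<in> plans"
      "eucl_dist j (average_vector f M \<sigma> j h \<pi>1 y1 T) (average_vector f M \<sigma> j h \<pi>2 y2 T) \<le> \<nu> (real T)"
      using app T p by blast
    have "\<bar>total_cost (h i) \<pi>1 y1 (Suc T) - total_cost (h i) \<pi>2 y2 (Suc T)\<bar> \<le> real (Suc T) * e" if i: "i < j" for i
    proof -
      have "\<bar>total_cost (h i) \<pi>1 y1 (Suc T) / real T - total_cost (h i) \<pi>2 y2 (Suc T) / real T\<bar> \<le> e"
        using component_le_eucl_dist[OF i, of "average_vector f M \<sigma> j h \<pi>1 y1 T" "average_vector f M \<sigma> j h \<pi>2 y2 T"]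
          \<pi>2(2) \<nu>T by (simp add: avg[OF i] p \<pi>2(1))
      then have "\<bar>total_cost (h i) \<pi>1 y1 (Suc T) - total_cost (h i) \<pi>2 y2 (Suc T)\<bar> \<le> e * real T"
        using T by (simp add: diff_divide_distrib[symmetric] abs_divide divide_le_eq)
      also have "\<dots> \<le> real (Suc T) * e"
        using \<open>0 < e\<close> by (simp add: algebra_simps)
      finally show ?thesis .
    qed
    then show ?thesis
      using \<pi>2(1) by blast
  qed
  then show ?thesis
    by (intro exI[of _ "Suc T"]) blast
qed

end

lemma integral_diff_bound:
  fixes c d :: "'a::topological_space \<Rightarrow> real"
  assumes X: "compact X" "\<gamma> \<in> borel_prob_measures X" and cd: "continuous_on X c" "continuous_on X d"
    and le: "\<And>x. x \<in> X \<Longrightarrow> \<bar>c x - d x\<bar> \<le> e"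
  shows "\<bar>(LINT x|\<gamma>. c x) - (LINT x|\<gamma>. d x)\<bar> \<le> e"
proof -
  interpret prob_space \<gamma>
    using X(2) by (simp add: borel_prob_measures_def)
  note int = integrable_borel_prob_measure[OF X]
  have "(LINT x|\<gamma>. c x) - (LINT x|\<gamma>. d x) = (LINT x|\<gamma>. c x - d x)"
    by (rule Bochner_Integration.integral_diff[symmetric]) (intro int cd)+
  also have "\<bar>\<dots>\<bar> \<le> (LINT x|\<gamma>. \<bar>c x - d x\<bar>)"
    by (rule integral_abs_bound)
  also have "\<dots> \<le> (LINT x|\<gamma>. e)"
    by (rule integral_mono) (use int cd le space_borel_prob_measures[OF X(2)] in auto)
  finally show ?thesis
    using prob_space by simp
qed

section \<open>Limit sets for the sequence of test functions\<close>

locale approximable_system = controlled_system Y U S f M \<sigma>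
  for Y :: "'y::metric_space set" and U :: "'u::metric_space set" and S :: "'s::metric_space set"
    and f :: "'y \<times> 'u \<times> 's \<Rightarrow> 'y" and M :: "'w measure" and \<sigma> :: "nat \<Rightarrow> 'w \<Rightarrow> 's" +
  fixes q :: "nat \<Rightarrow> 'y \<times> 'u \<Rightarrow> real"
  assumes dense: "dense_lipschitz_sequence (Y \<times> U) q"
    and weak: "\<And>j. 1 \<le> j \<Longrightarrow> weak_approximation Y U S f M \<sigma> j q"
begin

lemma q_continuous: "continuous_on (Y \<times> U) (q i)"
  using dense lipschitz_on_continuous_on unfolding dense_lipschitz_sequence_def by blast

lemma q_bound: "z \<in> Y \<times> U \<Longrightarrow> \<bar>q i z\<bar> \<le> 1"
  using dense unfolding dense_lipschitz_sequence_def by blast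

lemma integral_q_bound: "\<gamma> \<in> borel_prob_measures (Y \<times> U) \<Longrightarrow> \<bar>LINT z|\<gamma>. q i z\<bar> \<le> 1"
  using integral_diff_bound[OF compact_YU _ q_continuous continuous_on_const[of _ 0], of \<gamma> i 1] q_bound by simp

lemma integral_q_diff_bound:
  "\<gamma>1 \<in> borel_prob_measures (Y \<times> U) \<Longrightarrow> \<gamma>2 \<in> borel_prob_measures (Y \<times> U) \<Longrightarrow>
    \<bar>(LINT z|\<gamma>1. q i z) - (LINT z|\<gamma>2. q i z)\<bar> \<le> 2"
  using integral_q_bound[of \<gamma>1 i] integral_q_bound[of \<gamma>2 i] by linarith

lemma stationary_prob: "\<gamma> \<in> stationary \<Longrightarrow> \<gamma> \<in> borel_prob_measures (Y \<times> U)"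
  by (simp add: stationary_measures_iff)

lemma occupational_set_prob:
  "0 < T \<Longrightarrow> y \<in> Y \<Longrightarrow> \<gamma> \<in> occupational_set Y U S f M \<sigma> T y \<Longrightarrow> \<gamma> \<in> borel_prob_measures (Y \<times> U)"
  unfolding occupational_set_def using occupational_measure_in by auto

text \<open>The common source of both Hausdorff estimates: closeness of the first \<open>j\<close>
  integrals bounds the Euclidean distance of value vectors and, up to the tail of the series, the
  distance of measures.\<close>

lemma uniform_approximation:
  assumes "1 \<le> j" "0 < e"
  shows "\<exists>T0. \<forall>T\<ge>T0. \<forall>y\<in>Y.
    (\<forall>\<gamma>1\<in>occupational_set Y U S f M \<sigma> T y. \<exists>\<gamma>2\<in>stationary. \<forall>i<j. \<bar>(LINT z|\<gamma>1. q i z) - (LINT z|\<gamma>2. q i z)\<bar> \<le> e) \<and>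
    (\<forall>\<gamma>2\<in>stationary. \<exists>\<gamma>1\<in>occupational_set Y U S f M \<sigma> T y. \<forall>i<j. \<bar>(LINT z|\<gamma>2. q i z) - (LINT z|\<gamma>1. q i z)\<bar> \<le> e)"
proof -
  obtain T1 where T1: "\<forall>T\<ge>T1. \<forall>y\<in>Y. \<forall>\<pi>\<in>plans. \<exists>\<gamma>\<in>stationary. \<forall>i<j.
      \<bar>(LINT z|occ \<pi> y T. q i z) - (LINT z|\<gamma>. q i z)\<bar> \<le> e"
    using occupational_near_stationary[of j q, OF q_continuous \<open>0 < e\<close>] by blast
  obtain T2 where T2: "\<forall>T\<ge>T2. \<forall>y\<in>Y. \<forall>\<gamma>\<in>stationary. \<exists>\<pi>\<in>plans. \<forall>i<j.
      \<bar>total_cost (q i) \<pi> y T / real T - (LINT z|\<gamma>. q i z)\<bar> \<le> e"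
    using stationary_reachable[of j q, OF q_continuous q_bound
        weak_approximation_transfer[OF weak[OF \<open>1 \<le> j\<close>] q_continuous] \<open>0 < e\<close>] by blast
  show ?thesis
  \<comment> \<open>The \<open>1\<close> excludes horizon 0, for which integrals against the
    occupational measure are not time averages of costs.\<close>
  proof (intro exI[of _ "max 1 (max T1 T2)"] allI impI ballI conjI)
    fix T y assume T: "max 1 (max T1 T2) \<le> T" and y: "y \<in> Y"
    show "\<exists>\<gamma>2\<in>stationary. \<forall>i<j. \<bar>(LINT z|\<gamma>1. q i z) - (LINT z|\<gamma>2. q i z)\<bar> \<le> e"
      if "\<gamma>1 \<in> occupational_set Y U S f M \<sigma> T y" for \<gamma>1
      using T1 T y that by (auto simp: occupational_set_def)
    fix \<gamma>2 assume "\<gamma>2 \<in> stationary"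
    then obtain \<pi> where \<pi>: "\<pi> \<in> plans" "\<forall>i<j. \<bar>total_cost (q i) \<pi> y T / real T - (LINT z|\<gamma>2. q i z)\<bar> \<le> e"
      using T2 T y by fastforce
    then have "\<forall>i<j. \<bar>(LINT z|\<gamma>2. q i z) - (LINT z|occ \<pi> y T. q i z)\<bar> \<le> e"
      using T integral_occupational_measure[OF \<pi>(1) y _ q_continuous, of T] by (simp add: abs_minus_commute)
    then show "\<exists>\<gamma>1\<in>occupational_set Y U S f M \<sigma> T y. \<forall>i<j. \<bar>(LINT z|\<gamma>2. q i z) - (LINT z|\<gamma>1. q i z)\<bar> \<le> e"
      using \<pi>(1) unfolding occupational_set_def by blast
  qed
qed

lemma occupational_set_nonempty: "occupational_set Y U S f M \<sigma> T y \<noteq> {}"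
  using plans_nonempty by (simp add: occupational_set_def)

definition "stationary_values j = integral_vector j q ` stationary"

text \<open>A sequence of value vectors lifts to stationary measures, and a weak limit of these
  carries the limiting values.\<close>

lemma compactin_stationary_values: "compactin (Euclidean_space j) (stationary_values j)"
proof -
  have "\<exists>l\<in>stationary_values j. \<exists>r. strict_mono (r :: nat \<Rightarrow> nat) \<and> (F \<circ> r) \<longlonglongrightarrow> l"
    if F: "\<forall>n. F n \<in> stationary_values j" for F :: "nat \<Rightarrow> nat \<Rightarrow> real"
  proof -
    have "\<forall>n. \<exists>\<gamma>. \<gamma> \<in> stationary \<and> F n = integral_vector j q \<gamma>"
      using F by (auto simp: stationary_values_def)
    then obtain \<gamma> where \<gamma>: "\<And>n. \<gamma> n \<in> stationary" and eq: "\<And>n. F n = integral_vector j q (\<gamma> n)"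
      by metis
    obtain r :: "nat \<Rightarrow> nat" and \<gamma>' where r: "strict_mono r" "\<gamma>' \<in> stationary"
      and lim: "\<forall>c :: 'y \<times> 'u \<Rightarrow> real. continuous_on (Y \<times> U) c \<longrightarrow>
        (\<lambda>n. LINT z|\<gamma> (r n). c z) \<longlonglongrightarrow> (LINT z|\<gamma>'. c z)"
      by (rule stationary_seq_compact[where \<gamma>=\<gamma>, OF \<gamma>])
    have "(F \<circ> r) \<longlonglongrightarrow> integral_vector j q \<gamma>'"
      unfolding tendsto_fun_iff using lim q_continuous by (auto simp: eq integral_vector_def)
    then show ?thesis
      using r by (auto simp: stationary_values_def)
  qed
  then have "compact (stationary_values j)"
    unfolding compact_eq_seq_compact_metric seq_compact_def by blast
  then show ?thesis
    by (auto simp: compactin_Euclidean_space_iff stationary_values_def integral_vector_def)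
qed

lemma convex_stationary_values: "convex_fun_set (stationary_values j)"
  unfolding convex_fun_set_def
proof (intro ballI allI impI)
  fix v w and a b :: real
  assume "v \<in> stationary_values j" "w \<in> stationary_values j" and ab: "0 \<le> a" "0 \<le> b" "a + b = 1"
  then obtain \<gamma>1 \<gamma>2 where \<gamma>: "\<gamma>1 \<in> stationary" "\<gamma>2 \<in> stationary"
    and vw: "v = integral_vector j q \<gamma>1" "w = integral_vector j q \<gamma>2"
    by (auto simp: stationary_values_def)
  obtain \<gamma> where "\<gamma> \<in> stationary" and eq: "\<And>c :: 'y \<times> 'u \<Rightarrow> real. continuous_on (Y \<times> U) c \<Longrightarrow>
      (LINT z|\<gamma>. c z) = a * (LINT z|\<gamma>1. c z) + b * (LINT z|\<gamma>2. c z)"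
    using stationary_convex[OF \<gamma> ab] by blast
  moreover have "(\<lambda>i. a * v i + b * w i) = integral_vector j q \<gamma>"
    by (auto simp: vw integral_vector_def eq[OF q_continuous])
  ultimately show "(\<lambda>i. a * v i + b * w i) \<in> stationary_values j"
    by (simp add: stationary_values_def)
qed

lemma eucl_dist_integral_vector_le:
  assumes "\<forall>i<j. \<bar>(LINT z|\<gamma>1. q i z) - (LINT z|\<gamma>2. q i z)\<bar> \<le> e"
  shows "eucl_dist j (integral_vector j q \<gamma>1) (integral_vector j q \<gamma>2) \<le> real j * e"
  by (rule eucl_dist_le) (use assms in \<open>simp add: integral_vector_def\<close>)

lemma hausdorff_value_set_le:
  assumes "\<And>\<gamma>1. \<gamma>1 \<in> occupational_set Y U S f M \<sigma> T y \<Longrightarrow>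
      \<exists>\<gamma>2\<in>stationary. \<forall>i<j. \<bar>(LINT z|\<gamma>1. q i z) - (LINT z|\<gamma>2. q i z)\<bar> \<le> e"
    and "\<And>\<gamma>2. \<gamma>2 \<in> stationary \<Longrightarrow>
      \<exists>\<gamma>1\<in>occupational_set Y U S f M \<sigma> T y. \<forall>i<j. \<bar>(LINT z|\<gamma>2. q i z) - (LINT z|\<gamma>1. q i z)\<bar> \<le> e"
  shows "hausdorff_distance (eucl_dist j) (value_set Y U S f M \<sigma> j q T y) (stationary_values j) \<le> ennreal (real j * e)"
proof (rule hausdorff_distance_le)
  fix v assume "v \<in> value_set Y U S f M \<sigma> j q T y"
  then obtain \<gamma>1 where "\<gamma>1 \<in> occupational_set Y U S f M \<sigma> T y" and v: "v = integral_vector j q \<gamma>1"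
    by (auto simp: value_set_def)
  then obtain \<gamma>2 where "\<gamma>2 \<in> stationary" "\<forall>i<j. \<bar>(LINT z|\<gamma>1. q i z) - (LINT z|\<gamma>2. q i z)\<bar> \<le> e"
    using assms(1) by blast
  then show "\<exists>w\<in>stationary_values j. eucl_dist j v w \<le> real j * e"
    unfolding v stationary_values_def using eucl_dist_integral_vector_le by blast
next
  fix v assume "v \<in> stationary_values j"
  then obtain \<gamma>2 where "\<gamma>2 \<in> stationary" and v: "v = integral_vector j q \<gamma>2"
    by (auto simp: stationary_values_def)
  then obtain \<gamma>1 where "\<gamma>1 \<in> occupational_set Y U S f M \<sigma> T y"
    "\<forall>i<j. \<bar>(LINT z|\<gamma>2. q i z) - (LINT z|\<gamma>1. q i z)\<bar> \<le> e"
    using assms(2) by blast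
  then show "\<exists>w\<in>value_set Y U S f M \<sigma> j q T y. eucl_dist j v w \<le> real j * e"
    unfolding v value_set_def using eucl_dist_integral_vector_le by blast
qed

lemma is_limit_value_set_stationary_values:
  assumes "1 \<le> j"
  shows "is_limit_value_set Y U S f M \<sigma> j q (stationary_values j)"
  unfolding is_limit_value_set_def
proof (intro conjI convex_stationary_values compactin_stationary_values uniform_rate)
  show "hausdorff_distance (eucl_dist j) (value_set Y U S f M \<sigma> j q T y) (stationary_values j) \<le> ennreal (real j * 2)"
    if "0 < T" "y \<in> Y" for T y
    using integral_q_diff_bound stationary_prob occupational_set_prob[OF that]
      stationary_nonempty occupational_set_nonempty[of T y]
    by (intro hausdorff_value_set_le) blast+
  fix e :: real assume "0 < e"
  \<comment> \<open>The Euclidean norm is at most the sum of the \<open>j\<close> coordinate moduli,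
    hence the tolerance \<open>e / real j\<close> for each coordinate.\<close>
  then have "0 < e / real j"
    using assms by simp
  from uniform_approximation[OF assms this]
  obtain T0 where T0: "\<forall>T\<ge>T0. \<forall>y\<in>Y.
    (\<forall>\<gamma>1\<in>occupational_set Y U S f M \<sigma> T y. \<exists>\<gamma>2\<in>stationary. \<forall>i<j. \<bar>(LINT z|\<gamma>1. q i z) - (LINT z|\<gamma>2. q i z)\<bar> \<le> e / real j) \<and>
    (\<forall>\<gamma>2\<in>stationary. \<exists>\<gamma>1\<in>occupational_set Y U S f M \<sigma> T y. \<forall>i<j. \<bar>(LINT z|\<gamma>2. q i z) - (LINT z|\<gamma>1. q i z)\<bar> \<le> e / real j)"
    by blast
  have "hausdorff_distance (eucl_dist j) (value_set Y U S f M \<sigma> j q T y) (stationary_values j) \<le> ennreal e"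
    if "T0 \<le> T" "y \<in> Y" for T y
    using hausdorff_value_set_le[of T y j "e / real j"] T0 that assms by simp
  then show "\<exists>T0. \<forall>T\<ge>T0. \<forall>y\<in>Y.
      hausdorff_distance (eucl_dist j) (value_set Y U S f M \<sigma> j q T y) (stationary_values j) \<le> ennreal e"
    by blast
qed

text \<open>Both sets are approximated by the same value sets, so every point of one is a limit of
  points of the other, which is closed. Used in both directions, this identifies any given limit set
  with the set of stationary values.\<close>

lemma limit_value_set_subset:
  assumes V: "is_limit_value_set Y U S f M \<sigma> j q V" and V': "is_limit_value_set Y U S f M \<sigma> j q V'"
  shows "V \<subseteq> V'"
proof
  fix v assume v: "v \<in> V"
  obtain y where y: "y \<in> Y"
    using Y_nonempty by blast
  obtain \<nu> where \<nu>: "\<nu> \<longlonglongrightarrow> 0" "\<forall>T>0. \<forall>y0\<in>Y.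
      hausdorff_distance (eucl_dist j) (value_set Y U S f M \<sigma> j q T y0) V \<le> ennreal (\<nu> T)"
    using V unfolding is_limit_value_set_def by blast
  obtain \<nu>' where \<nu>': "\<nu>' \<longlonglongrightarrow> 0" "\<forall>T>0. \<forall>y0\<in>Y.
      hausdorff_distance (eucl_dist j) (value_set Y U S f M \<sigma> j q T y0) V' \<le> ennreal (\<nu>' T)"
    using V' unfolding is_limit_value_set_def by blast
  have supp: "V \<subseteq> {v. \<forall>i\<ge>j. v i = 0}" "V' \<subseteq> {v. \<forall>i\<ge>j. v i = 0}" and closed: "closed V'"
    using V V' unfolding is_limit_value_set_def compactin_Euclidean_space_iff
    by (auto intro: compact_imp_closed)
  have ex: "\<exists>w\<in>V'. \<forall>i<j. \<bar>w i - v i\<bar> \<le> 2 * e" if e: "0 < e" for e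
  proof -
    have "eventually (\<lambda>T. \<nu> T < e \<and> \<nu>' T < e \<and> 0 < T) sequentially"
      using order_tendstoD(2)[OF \<nu>(1) e] order_tendstoD(2)[OF \<nu>'(1) e] eventually_gt_at_top
      by (intro eventually_conj)
    then obtain T where T: "\<nu> T < e" "\<nu>' T < e" "0 < T"
      using eventually_happens by force
    have close: "hausdorff_distance (eucl_dist j) (value_set Y U S f M \<sigma> j q T y) V < ennreal e"
      "hausdorff_distance (eucl_dist j) (value_set Y U S f M \<sigma> j q T y) V' < ennreal e"
      using \<nu>(2) \<nu>'(2) T y e by (auto intro!: le_less_trans[OF _ ennreal_lessI])
    obtain a where a: "a \<in> value_set Y U S f M \<sigma> j q T y" "eucl_dist j v a < e"
      using hausdorff_distance_lessD(2)[OF close(1) v] by blast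
    obtain w where "w \<in> V'" "eucl_dist j a w < e"
      using hausdorff_distance_lessD(1)[OF close(2) a(1)] by blast
    moreover have "\<bar>w i - v i\<bar> \<le> eucl_dist j v a + eucl_dist j a w" if "i < j" for i
      using component_le_eucl_dist[OF that, of v a] component_le_eucl_dist[OF that, of a w] by linarith
    ultimately show ?thesis
      using a(2) by (intro bexI[of _ w]) force+
  qed
  have "\<exists>w\<in>V'. \<forall>i<j. \<bar>w i - v i\<bar> \<le> 2 * inverse (real (Suc n))" for n
    by (rule ex) simp
  then obtain w where w: "\<And>n. w n \<in> V'" "\<And>n i. i < j \<Longrightarrow> \<bar>w n i - v i\<bar> \<le> 2 * inverse (real (Suc n))"
    by metis
  have "(\<lambda>n. w n i) \<longlonglongrightarrow> v i" for i
  proof (cases "i < j")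
    case True
    have "(\<lambda>n. w n i - v i) \<longlonglongrightarrow> 0"
    proof (rule Lim_null_comparison)
      show "eventually (\<lambda>n. norm (w n i - v i) \<le> 2 * inverse (real (Suc n))) sequentially"
        using w(2)[OF True] by (simp only: real_norm_def eventually_True)
      show "(\<lambda>n. 2 * inverse (real (Suc n))) \<longlonglongrightarrow> 0"
        by (rule tendsto_mult_right_zero[OF LIMSEQ_inverse_real_of_nat])
    qed
    then show ?thesis
      by (rule LIM_zero_cancel)
  next
    case False
    \<comment> \<open>Membership in the Euclidean space settles the coordinates that
      \<open>eucl_dist j\<close> does not measure.\<close>
    have "v \<in> {v. \<forall>i\<ge>j. v i = 0}" "w n \<in> {v. \<forall>i\<ge>j. v i = 0}" for n
      using supp v w(1)[of n] by blast+
    then have "w n i = v i" for n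
      using False by simp
    then show ?thesis
      by simp
  qed
  then have "w \<longlonglongrightarrow> v"
    by (simp add: tendsto_fun_iff)
  then show "v \<in> V'"
    by (rule closed_sequentially[OF closed w(1)])
qed

lemma limit_value_set_unique:
  assumes "1 \<le> j" "is_limit_value_set Y U S f M \<sigma> j q V"
  shows "V = stationary_values j"
  using limit_value_set_subset[OF assms(2) is_limit_value_set_stationary_values[OF assms(1)]]
    limit_value_set_subset[OF is_limit_value_set_stationary_values[OF assms(1)] assms(2)]
  by (rule equalityI)

text \<open>The stationary witness may change with \<open>j\<close>. That suffices, because the
  stationarity defect for a given \<phi> is approximated by a single \<open>q i\<close>, and a
  witness for \<open>Suc i\<close> has the same integral of \<open>q i\<close> as \<gamma> while its
  own defect is zero.\<close>

lemma stationary_if_stationary_values: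
  assumes \<gamma>: "\<gamma> \<in> borel_prob_measures (Y \<times> U)"
    and val: "\<And>j. 1 \<le> j \<Longrightarrow> integral_vector j q \<gamma> \<in> stationary_values j"
  shows "\<gamma> \<in> stationary"
proof -
  have "(LINT z|\<gamma>. noise_mean \<phi> z - \<phi> (fst z)) = 0" if \<phi>: "continuous_on Y \<phi>" for \<phi> :: "'y \<Rightarrow> real"
  proof -
    let ?c = "\<lambda>z. noise_mean \<phi> z - \<phi> (fst z)"
    have c: "continuous_on (Y \<times> U) ?c"
      by (intro continuous_on_diff noise_mean_continuous[OF \<phi>]
          continuous_on_compose2[OF \<phi> continuous_on_fst[OF continuous_on_id]]) auto
    obtain B where B: "0 < B" "\<And>z. z \<in> Y \<times> U \<Longrightarrow> \<bar>?c z\<bar> \<le> B"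
      using continuous_on_compact_bounded[OF compact_YU c] by metis
    \<comment> \<open>The \<open>q i\<close> are dense in the unit ball, so the defect is scaled by
      its bound \<open>B\<close>.\<close>
    define g where "g z = ?c z / B" for z
    have g: "continuous_on (Y \<times> U) g" "\<forall>z\<in>Y \<times> U. \<bar>g z\<bar> \<le> 1"
      unfolding g_def using c B by (auto intro!: continuous_on_divide continuous_on_const simp: abs_divide)
    have "\<bar>LINT z|\<gamma>. g z\<bar> \<le> 0 + e" if e: "0 < e" for e
    proof -
      obtain i where i: "\<forall>z\<in>Y \<times> U. \<bar>g z - q i z\<bar> < e / 2"
        using dense g e unfolding dense_lipschitz_sequence_def by (meson half_gt_zero)
      obtain \<gamma>' where \<gamma>': "\<gamma>' \<in> stationary" "integral_vector (Suc i) q \<gamma> = integral_vector (Suc i) q \<gamma>'"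
        using val[of "Suc i"] by (auto simp: stationary_values_def)
      then have same: "(LINT z|\<gamma>. q i z) = (LINT z|\<gamma>'. q i z)"
        by (auto simp: integral_vector_def dest: fun_cong[of _ _ i])
      have "(LINT z|\<gamma>'. g z) = 0"
        using \<gamma>'(1) \<phi> by (simp add: g_def stationary_measures_iff)
      moreover have "\<bar>(LINT z|\<gamma>. g z) - (LINT z|\<gamma>. q i z)\<bar> \<le> e / 2"
        using i by (intro integral_diff_bound[OF compact_YU \<gamma> g(1) q_continuous]) force
      moreover have "\<bar>(LINT z|\<gamma>'. g z) - (LINT z|\<gamma>'. q i z)\<bar> \<le> e / 2"
        using i by (intro integral_diff_bound[OF compact_YU stationary_prob[OF \<gamma>'(1)] g(1) q_continuous]) force
      ultimately show ?thesis
        using same by linarith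
    qed
    then have "(LINT z|\<gamma>. g z) = 0"
      using field_le_epsilon[of "\<bar>LINT z|\<gamma>. g z\<bar>" 0] by simp
    then show ?thesis
      using B(1) by (simp add: g_def)
  qed
  then show ?thesis
    using \<gamma> by (simp add: stationary_measures_iff)
qed

lemma limit_measures_eq_stationary:
  assumes V: "\<forall>j\<ge>1. is_limit_value_set Y U S f M \<sigma> j q (V j)"
  shows "limit_measures Y U q V = stationary"
proof -
  have "V j = stationary_values j" if "1 \<le> j" for j
    using limit_value_set_unique[OF that] V that by blast
  then show ?thesis
    using stationary_if_stationary_values stationary_prob
    by (auto simp: limit_measures_def stationary_values_def)
qed

lemma occupational_sets_converge:
  "\<exists>\<nu> :: nat \<Rightarrow> real. \<nu> \<longlonglongrightarrow> 0 \<and> (\<forall>T>0. \<forall>y\<in>Y.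
    hausdorff_distance (measure_dist q) (occupational_set Y U S f M \<sigma> T y) stationary \<le> ennreal (\<nu> T))"
proof (rule uniform_rate)
  let ?O = "\<lambda>T y. occupational_set Y U S f M \<sigma> T y"
  have le: "measure_dist q \<gamma>1 \<gamma>2 \<le> 4"
    if "\<gamma>1 \<in> borel_prob_measures (Y \<times> U)" "\<gamma>2 \<in> borel_prob_measures (Y \<times> U)" for \<gamma>1 \<gamma>2
  proof -
    \<comment> \<open>With the tolerance 4 the condition on the first terms reads
      \<open>a i \<le> 2\<close> and always holds; this gives the crude bound at every positive
      horizon.\<close>
    obtain j where "\<forall>a. (\<forall>i. 0 \<le> a i \<and> a i \<le> 2) \<and> (\<forall>i<j. a i \<le> 4/2) \<longrightarrow> (\<Sum>i. (1/2)^Suc i * a i) \<le> (4::real)"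
      using weighted_series_small[of 4] by auto
    then show ?thesis
      unfolding measure_dist_def using integral_q_diff_bound[OF that] by simp
  qed
  show "hausdorff_distance (measure_dist q) (?O T y) stationary \<le> ennreal 4" if "0 < T" "y \<in> Y" for T y
    using le stationary_prob occupational_set_prob[OF that]
      stationary_nonempty occupational_set_nonempty[of T y]
    by (intro hausdorff_distance_le) blast+
  fix e :: real assume e: "0 < e"
  obtain j where j: "1 \<le> j" and small: "\<forall>a. (\<forall>i. 0 \<le> a i \<and> a i \<le> 2) \<and> (\<forall>i<j. a i \<le> e/2) \<longrightarrow>
      (\<Sum>i. (1/2)^Suc i * a i) \<le> e"
    using weighted_series_small[OF e] by blast
  have dist: "measure_dist q \<gamma>1 \<gamma>2 \<le> e"
    if "\<gamma>1 \<in> borel_prob_measures (Y \<times> U)" "\<gamma>2 \<in> borel_prob_measures (Y \<times> U)"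
      "\<forall>i<j. \<bar>(LINT z|\<gamma>1. q i z) - (LINT z|\<gamma>2. q i z)\<bar> \<le> e/2" for \<gamma>1 \<gamma>2
    unfolding measure_dist_def using small integral_q_diff_bound[OF that(1,2)] that(3) by simp
  obtain T0 where T0: "\<forall>T\<ge>T0. \<forall>y\<in>Y.
    (\<forall>\<gamma>1\<in>?O T y. \<exists>\<gamma>2\<in>stationary. \<forall>i<j. \<bar>(LINT z|\<gamma>1. q i z) - (LINT z|\<gamma>2. q i z)\<bar> \<le> e/2) \<and>
    (\<forall>\<gamma>2\<in>stationary. \<exists>\<gamma>1\<in>?O T y. \<forall>i<j. \<bar>(LINT z|\<gamma>2. q i z) - (LINT z|\<gamma>1. q i z)\<bar> \<le> e/2)"
    using uniform_approximation[OF j half_gt_zero[OF e]] by blast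
  have "hausdorff_distance (measure_dist q) (?O T y) stationary \<le> ennreal e"
    if T: "max 1 T0 \<le> T" and y: "y \<in> Y" for T y
  proof (rule hausdorff_distance_le)
    have O: "\<gamma> \<in> borel_prob_measures (Y \<times> U)" if "\<gamma> \<in> ?O T y" for \<gamma>
      using occupational_set_prob[OF _ y that] T by simp
    show "\<exists>\<gamma>2\<in>stationary. measure_dist q \<gamma>1 \<gamma>2 \<le> e" if "\<gamma>1 \<in> ?O T y" for \<gamma>1
    proof -
      obtain \<gamma>2 where "\<gamma>2 \<in> stationary" "\<forall>i<j. \<bar>(LINT z|\<gamma>1. q i z) - (LINT z|\<gamma>2. q i z)\<bar> \<le> e/2"
        using T0 T y \<open>\<gamma>1 \<in> ?O T y\<close> by (meson max.boundedE)
      then show ?thesis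
        using dist[OF O[OF that] stationary_prob] by blast
    qed
    show "\<exists>\<gamma>1\<in>?O T y. measure_dist q \<gamma>2 \<gamma>1 \<le> e" if "\<gamma>2 \<in> stationary" for \<gamma>2
    proof -
      obtain \<gamma>1 where "\<gamma>1 \<in> ?O T y" "\<forall>i<j. \<bar>(LINT z|\<gamma>2. q i z) - (LINT z|\<gamma>1. q i z)\<bar> \<le> e/2"
        using T0 T y \<open>\<gamma>2 \<in> stationary\<close> by (meson max.boundedE)
      then show ?thesis
        using dist[OF stationary_prob[OF that] O] by blast
    qed
  qed
  then show "\<exists>T0. \<forall>T\<ge>T0. \<forall>y\<in>Y. hausdorff_distance (measure_dist q) (?O T y) stationary \<le> ennreal e"
    by blast
qed

end

section \<open>Degenerate spaces and conclusion\<close>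

lemma borel_prob_measures_empty: "borel_prob_measures {} = {}"
  using prob_space.not_empty space_borel_prob_measures by (fastforce simp: borel_prob_measures_def)

theorem corollary3p4:
  fixes Y :: "(real ^ 'm) set"
    and U :: "'u::metric_space set"
    and S :: "'s::metric_space set"
    and f :: "(real ^ 'm) \<times> 'u \<times> 's \<Rightarrow> real ^ 'm"
    and M :: "'w measure"
    and \<sigma> :: "nat \<Rightarrow> 'w \<Rightarrow> 's"
    and q :: "nat \<Rightarrow> (real ^ 'm) \<times> 'u \<Rightarrow> real"
  assumes "compact Y" and "compact U" and "compact S"
    and "continuous_on (Y \<times> U \<times> S) f"
    and "\<And>y u s. y \<in> Y \<Longrightarrow> u \<in> U \<Longrightarrow> s \<in> S \<Longrightarrow> f (y, u, s) \<in> Y"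
    and "iid_random_elements M S \<sigma>"
    and "dense_lipschitz_sequence (Y \<times> U) q"
    and "\<And>j. j \<ge> 1 \<Longrightarrow> weak_approximation Y U S f M \<sigma> j q"
  shows "(\<exists>V. \<forall>j\<ge>1. is_limit_value_set Y U S f M \<sigma> j q (V j)) \<and>
    (\<forall>V. (\<forall>j\<ge>1. is_limit_value_set Y U S f M \<sigma> j q (V j)) \<longrightarrow>
       limit_measures Y U q V = stationary_measures Y U f M (\<sigma> 0)) \<and>
    (\<exists>\<nu> :: nat \<Rightarrow> real. \<nu> \<longlonglongrightarrow> 0 \<and>
       (\<forall>T>0. \<forall>y0\<in>Y.
          hausdorff_distance (measure_dist q)
            (occupational_set Y U S f M \<sigma> T y0) (stationary_measures Y U f M (\<sigma> 0))
          \<le> ennreal (\<nu> T)))"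
\<comment> \<open>An empty product carries no probability measure. If \<open>Y\<close> is empty,
  claims about initial states are vacuous; if \<open>U\<close> is empty, there is no plan, so all
  occupational sets are empty and have distance 0 from the empty set.\<close>
proof (cases "Y = {} \<or> U = {}")
  case True
  then have "Y \<times> U = {}"
    by auto
  then have W: "stationary_measures Y U f M (\<sigma> 0) = {}" "limit_measures Y U q V = {}" for V
    unfolding stationary_measures_def limit_measures_def by (simp_all only: borel_prob_measures_empty) auto
  have occ: "occupational_set Y U S f M \<sigma> T y = {}" if "y \<in> Y" for T y
  proof -
    have "U = {}"
      using True that by auto
    have "\<pi> \<notin> control_plans S U" for \<pi>
    proof
      assume "\<pi> \<in> control_plans S U"
      then have "\<pi> 0 \<in> PiM {..<0} (\<lambda>_. restrict_space borel S) \<rightarrow>\<^sub>M restrict_space borel U"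
        unfolding control_plans_def by blast
      \<comment> \<open>The product over no coordinates has one point even if \<open>S\<close> is
        empty, so a plan has to name an element of \<open>U\<close> at time 0.\<close>
      from measurable_space[OF this, of "\<lambda>_. undefined"] show False
        using \<open>U = {}\<close> by (simp add: space_PiM space_restrict_space)
    qed
    then show ?thesis
      by (auto simp: occupational_set_def)
  qed
  have empty: "hausdorff_distance d {} {} \<le> ennreal 0" for d :: "'b \<Rightarrow> 'b \<Rightarrow> real"
    by (rule hausdorff_distance_le) auto
  have "is_limit_value_set Y U S f M \<sigma> j q {}" for j
    unfolding is_limit_value_set_def
    by (intro conjI exI[of _ "\<lambda>_. 0"]) (use empty occ in \<open>auto simp: convex_fun_set_def value_set_def\<close>)
  moreover have "\<exists>\<nu> :: nat \<Rightarrow> real. \<nu> \<longlonglongrightarrow> 0 \<and> (\<forall>T>0. \<forall>y0\<in>Y.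
      hausdorff_distance (measure_dist q) (occupational_set Y U S f M \<sigma> T y0)
        (stationary_measures Y U f M (\<sigma> 0)) \<le> ennreal (\<nu> T))"
    by (rule exI[of _ "\<lambda>_. 0"]) (use empty occ W in auto)
  ultimately show ?thesis
    using W by (intro conjI exI[of _ "\<lambda>_. {}"]) auto
next
  case False
  interpret approximable_system Y U S f M \<sigma> q
    using False assms by unfold_locales auto
  show ?thesis
    using is_limit_value_set_stationary_values limit_measures_eq_stationary occupational_sets_converge
    by blast
qed

end
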